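(* Let $\mu\in\mathbb{R}$ and let $\lambda\in\mathbb{C}$ with $\operatorname{Im}\lambda>0$ and $\lambda\neq-i\mu$. Then the kernel of $(L^\mu-\lambda^2)^{-1}$ is \[K(\mu,\lambda,x,y)=\frac{e^{i\lambda|x-y|}}{4\pi|x-y|}+\frac{i\,e^{i\lambda(|x|+|y|)}}{4\pi|x||y|(\lambda+i\mu)}.\]
   Context: All functions are complex-valued. Let $L=-\sum_{i=1}^3\partial^2/\partial x_i^2$ in $L^2(\mathbb{R}^3)$ with domain $C_c^\infty(\mathbb{R}^3\setminus\{0\})$. For $\mu\in\mathbb{R}$, $L^\mu$ is the self-adjoint extension of $L$ (a restriction of the adjoint $L^*$) with domain \[D(L^\mu)=\Big\{\chi\beta\Big(\frac{1}{|x|}+\mu\Big)+\varphi':\ \varphi'\in W^{2,2}(\mathbb{R}^3),\ \varphi'(0)=0,\ \beta\in\mathbb{C}\Big\},\] where $\chi\in C_c^\infty(\mathbb{R}^3)$ is a fixed function with $\chi\equiv1$ near $0$ (and $\varphi'$ is just a name, not a derivative). That $K$ is the kernel of $(L^\mu-\lambda^2)^{-1}$ means that $\lambda^2$ is in the resolvent set of $L^\mu$ and $\big((L^\mu-\lambda^2)^{-1}f\big)(x)=\int_{\mathbb{R}^3}K(\mu,\lambda,x,y)f(y)\,dy$ for all $f\in L^2(\mathbb{R}^3)$ and almost every $x$. *)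

theory Defs
  imports "HOL-Analysis.Analysis"
begin

(* Elements of L^2(R^3) are represented by Borel functions; equality in L^2 is
   equality almost everywhere. Every Lebesgue class contains a Borel function. *)

definition L2 :: "(real^3 \<Rightarrow> complex) set" where
  "L2 = {f \<in> borel_measurable lborel. integrable lborel (\<lambda>x. (cmod (f x))\<^sup>2)}"

definition L2_inner :: "(real^3 \<Rightarrow> complex) \<Rightarrow> (real^3 \<Rightarrow> complex) \<Rightarrow> complex" where
  "L2_inner f g = (\<integral>x. f x * cnj (g x) \<partial>lborel)"

definition L2_norm :: "(real^3 \<Rightarrow> complex) \<Rightarrow> real" where
  "L2_norm f = sqrt (\<integral>x. (cmod (f x))\<^sup>2 \<partial>lborel)"

definition partial :: "3 \<Rightarrow> (real^3 \<Rightarrow> complex) \<Rightarrow> real^3 \<Rightarrow> complex" where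
  "partial i f x = vector_derivative (\<lambda>t. f (x + t *\<^sub>R axis i 1)) (at 0)"

primrec partials :: "3 list \<Rightarrow> (real^3 \<Rightarrow> complex) \<Rightarrow> real^3 \<Rightarrow> complex" where
  "partials [] f = f"
| "partials (i # is) f = partial i (partials is f)"

definition smooth :: "(real^3 \<Rightarrow> complex) \<Rightarrow> bool" where
  "smooth f \<longleftrightarrow> (\<forall>is. partials is f differentiable_on UNIV)"

(* Elements of C_c^infty(U) are extended by zero to R^3. *)
definition test_functions :: "(real^3) set \<Rightarrow> (real^3 \<Rightarrow> complex) set" where
  "test_functions U =
     {f. smooth f \<and> compact (closure {x. f x \<noteq> 0}) \<and> closure {x. f x \<noteq> 0} \<subseteq> U}"

(* The list is a multi-index written out as a sequence of directions. *)
definition weak_partials ::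
    "3 list \<Rightarrow> (real^3 \<Rightarrow> complex) \<Rightarrow> (real^3 \<Rightarrow> complex) \<Rightarrow> bool" where
  "weak_partials is f g \<longleftrightarrow>
     (\<forall>\<phi> \<in> test_functions UNIV.
        (\<integral>x. f x * partials is \<phi> x \<partial>lborel) = (-1) ^ length is * (\<integral>x. g x * \<phi> x \<partial>lborel))"

definition sobolev :: "nat \<Rightarrow> (real^3 \<Rightarrow> complex) set" where
  "sobolev k = {f \<in> L2. \<forall>is. length is \<le> k \<longrightarrow> (\<exists>g \<in> L2. weak_partials is f g)}"

(* An operator in L^2(R^3) is given by its graph: pairs (u, v) of representatives
   with v = T u. *)
type_synonym L2_operator = "((real^3 \<Rightarrow> complex) \<times> (real^3 \<Rightarrow> complex)) set"

definition L_op :: L2_operator where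
  "L_op = {(\<phi>, \<lambda>x. - (\<Sum>i\<in>UNIV. partials [i, i] \<phi> x)) | \<phi>. \<phi> \<in> test_functions (- {0})}"

definition adjoint :: "L2_operator \<Rightarrow> L2_operator" where
  "adjoint T = {(g, h). g \<in> L2 \<and> h \<in> L2 \<and>
     (\<forall>(\<phi>, \<psi>) \<in> T. L2_inner \<psi> g = L2_inner \<phi> h)}"

(* In three dimensions an element of W^{2,2} has a unique continuous representative;
   its value at 0 is the one meant in the condition phi 0 = 0. *)
definition L_mu_domain ::
    "(real^3 \<Rightarrow> complex) \<Rightarrow> real \<Rightarrow> (real^3 \<Rightarrow> complex) set" where
  "L_mu_domain \<eta> \<mu> = {u \<in> L2. \<exists>\<beta> \<phi>. \<phi> \<in> sobolev 2 \<and> continuous_on UNIV \<phi> \<and> \<phi> 0 = 0 \<and>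
     (AE x in lborel. u x = \<eta> x * \<beta> * of_real (1 / norm x + \<mu>) + \<phi> x)}"

definition L_mu :: "(real^3 \<Rightarrow> complex) \<Rightarrow> real \<Rightarrow> L2_operator" where
  "L_mu \<eta> \<mu> = {(u, v) \<in> adjoint L_op. u \<in> L_mu_domain \<eta> \<mu>}"

(* Graph of the inverse of T - z, as a relation if T - z is not injective. *)
definition resolvent :: "L2_operator \<Rightarrow> complex \<Rightarrow> L2_operator" where
  "resolvent T z = {(f, u). f \<in> L2 \<and> (\<exists>v. (u, v) \<in> T \<and> (AE x in lborel. f x = v x - z * u x))}"

definition resolvent_set :: "L2_operator \<Rightarrow> complex set" where
  "resolvent_set T = {z.
     (\<forall>f \<in> L2. \<exists>u. (f, u) \<in> resolvent T z) \<and>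
     (\<forall>f u u'. (f, u) \<in> resolvent T z \<longrightarrow> (f, u') \<in> resolvent T z \<longrightarrow> (AE x in lborel. u x = u' x)) \<and>
     (\<exists>C. \<forall>(f, u) \<in> resolvent T z. L2_norm u \<le> C * L2_norm f)}"

definition is_resolvent_kernel ::
    "L2_operator \<Rightarrow> complex \<Rightarrow> (real^3 \<Rightarrow> real^3 \<Rightarrow> complex) \<Rightarrow> bool" where
  "is_resolvent_kernel T z K \<longleftrightarrow> z \<in> resolvent_set T \<and>
     (\<forall>(f, u) \<in> resolvent T z. AE x in lborel.
        integrable lborel (\<lambda>y. K x y * f y) \<and> u x = (\<integral>y. K x y * f y \<partial>lborel))"

end

theory Submission
  imports Defs
begin

text \<open>Let \<open>G(x) = exp (i l \<bar>x\<bar>) / (4 \<pi> \<bar>x\<bar>)\<close>. Regularising \<open>\<bar>x\<bar>\<close> to \<open>sqrt (\<bar>x\<bar>\<^sup>2 + e\<^sup>2)\<close> shows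
  \<open>G * ((\<Delta> + l\<^sup>2) \<phi>) = - \<phi>\<close> for test functions, and convolving a weak equation
  \<open>(\<Delta> + l\<^sup>2) u = - h\<close> in \<open>L\<^sup>2\<close> with \<open>G\<close> gives \<open>u = G * h\<close>. Conversely \<open>G * h\<close> is continuous and lies in \<open>W\<^sup>2\<^sup>,\<^sup>2\<close>: the
  energy identity \<open>\<Sum>\<^sub>i\<^sub>j \<parallel>G * \<partial>\<^sub>i\<partial>\<^sub>j\<phi>\<parallel>\<^sup>2 = \<parallel>G * \<Delta>\<phi>\<parallel>\<^sup>2\<close> and duality avoid the Fourier transform. The singular part
  satisfies \<open>4 \<pi> G - \<eta> / \<bar>x\<bar> = G * F\<close> with \<open>F\<close> in \<open>L\<^sup>2\<close> and \<open>(G * F)(0) = i l\<close>. Hence the solutions of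
  \<open>(L\<^sup>\<mu> - l\<^sup>2) u = f\<close> are \<open>u = G * f + 4 \<pi> \<beta> G\<close>, where the boundary condition at \<open>0\<close> reads
  \<open>(G * f)(0) + \<beta> (i l - \<mu>) = 0\<close>.\<close>

section \<open>The space of square-integrable functions\<close>

text \<open>The adjoint relation is tested only with functions that vanish near 0, so a point source
  at the origin is invisible: any multiple of G may be added to a solution, and only the domain of
  \<open>L_mu\<close> fixes it. Distributions supported at a point are never classified. Instead,
  membership in the domain gives the regular part an L2 source h with respect to all test functions;
  away from the origin this source is f, and since a point is a null set, h = f almost everywhere.
  The expansion 4 pi G = 1/|x| + i l + o(1) explains the constants: a singular part \<beta> / |x|
  must come with the constant term \<beta> \<mu>, while G itself supplies \<beta> i l. The
  coefficient i l - \<mu> = i (l + i \<mu>) vanishes exactly at the excluded l, whence the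
  denominator. In dimension three G lies in L1, which makes convolution bounded on L2, and also in
  L2, which makes (G * f)(0) a bounded functional of f; so the correction to the free resolvent is
  bounded of rank at most one.\<close>

lemma nn_integral_lborel_affine:
  fixes t :: "'a::euclidean_space"
  assumes [measurable]: "f \<in> borel_measurable borel" and c: "c \<noteq> 0"
  shows "(\<integral>\<^sup>+x. f x \<partial>lborel) = ennreal (\<bar>c\<bar>^DIM('a)) * (\<integral>\<^sup>+x. f (t + c *\<^sub>R x) \<partial>lborel)"
proof -
  have "(\<integral>\<^sup>+x. f x \<partial>lborel) = (\<integral>\<^sup>+x. f x \<partial>density (distr lborel borel (\<lambda>x. t + c *\<^sub>R x)) (\<lambda>_. \<bar>c\<bar>^DIM('a)))"
    by (rule arg_cong[where f="\<lambda>M. integral\<^sup>N M f"]) (rule lborel_affine[OF c])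
  also have "\<dots> = ennreal (\<bar>c\<bar>^DIM('a)) * (\<integral>\<^sup>+x. f (t + c *\<^sub>R x) \<partial>lborel)"
    by (simp add: nn_integral_density nn_integral_distr nn_integral_cmult)
  finally show ?thesis .
qed

lemma integrable_lborel_affine:
  fixes t :: "'a::euclidean_space" and f :: "'a \<Rightarrow> 'b::{banach,second_countable_topology}"
  assumes f: "integrable lborel f" and c: "c \<noteq> 0"
  shows "integrable lborel (\<lambda>x. f (t + c *\<^sub>R x))"
proof -
  have [measurable]: "f \<in> borel_measurable borel" using f by auto
  have "(\<integral>\<^sup>+x. norm (f x) \<partial>lborel) < \<infinity>"
    using f by (simp add: integrable_iff_bounded)
  then have "(\<integral>\<^sup>+x. norm (f (t + c *\<^sub>R x)) \<partial>lborel) < \<infinity>"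
    using c by (subst (asm) nn_integral_lborel_affine[OF _ c, of _ t]) (auto simp: ennreal_mult_less_top top_unique)
  then show ?thesis by (auto simp: integrable_iff_bounded)
qed

lemma integral_lborel_affine:
  fixes t :: "'a::euclidean_space" and f :: "'a \<Rightarrow> 'b::{banach,second_countable_topology}"
  assumes [measurable]: "f \<in> borel_measurable borel" and c: "c \<noteq> 0"
  shows "(\<integral>x. f x \<partial>lborel) = \<bar>c\<bar>^DIM('a) *\<^sub>R (\<integral>x. f (t + c *\<^sub>R x) \<partial>lborel)"
proof -
  have "(\<integral>x. f x \<partial>lborel) = (\<integral>x. f x \<partial>density (distr lborel borel (\<lambda>x. t + c *\<^sub>R x)) (\<lambda>_. \<bar>c\<bar>^DIM('a)))"
    by (rule arg_cong[where f="\<lambda>M. integral\<^sup>L M f"]) (rule lborel_affine[OF c])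
  also have "\<dots> = (\<integral>x. \<bar>c\<bar>^DIM('a) *\<^sub>R f x \<partial>distr lborel borel (\<lambda>x. t + c *\<^sub>R x))"
    by (intro integral_density) auto
  also have "\<dots> = (\<integral>x. \<bar>c\<bar>^DIM('a) *\<^sub>R f (t + c *\<^sub>R x) \<partial>lborel)"
    by (subst integral_distr) auto
  finally show ?thesis by simp
qed

lemma integral_translate:
  fixes f :: "'a::euclidean_space \<Rightarrow> 'b::{banach,second_countable_topology}"
  assumes "f \<in> borel_measurable borel"
  shows "(\<integral>x. f (x - a) \<partial>lborel) = (\<integral>x. f x \<partial>lborel)"
proof -
  have "(\<lambda>x. f (-a + (1::real) *\<^sub>R x)) = (\<lambda>x. f (x - a))"
    by simp
  then show ?thesis using integral_lborel_affine[OF assms, of 1 "-a"] by simp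
qed

lemma integrable_translate:
  fixes f :: "'a::euclidean_space \<Rightarrow> 'b::{banach,second_countable_topology}"
  assumes "integrable lborel f"
  shows "integrable lborel (\<lambda>x. f (x - a))"
proof -
  have "(\<lambda>x. f (-a + (1::real) *\<^sub>R x)) = (\<lambda>x. f (x - a))"
    by simp
  then show ?thesis using integrable_lborel_affine[OF assms, of 1 "-a"] by simp
qed

lemma integral_translate':
  fixes f :: "'a::euclidean_space \<Rightarrow> 'b::{banach,second_countable_topology}"
  assumes "f \<in> borel_measurable borel"
  shows "(\<integral>x. f (x + a) \<partial>lborel) = (\<integral>x. f x \<partial>lborel)"
proof -
  have "(\<lambda>x. f (a + (1::real) *\<^sub>R x)) = (\<lambda>x. f (x + a))"
    by (simp add: add.commute)
  then show ?thesis using integral_lborel_affine[OF assms, of 1 a] by simp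
qed

lemma integrable_translate':
  fixes f :: "'a::euclidean_space \<Rightarrow> 'b::{banach,second_countable_topology}"
  assumes "integrable lborel f"
  shows "integrable lborel (\<lambda>x. f (x + a))"
proof -
  have "(\<lambda>x. f (a + (1::real) *\<^sub>R x)) = (\<lambda>x. f (x + a))"
    by (simp add: add.commute)
  then show ?thesis using integrable_lborel_affine[OF assms, of 1 a] by simp
qed

lemma integral_reflect:
  fixes f :: "'a::euclidean_space \<Rightarrow> 'b::{banach,second_countable_topology}"
  assumes "f \<in> borel_measurable borel"
  shows "(\<integral>x. f (a - x) \<partial>lborel) = (\<integral>x. f x \<partial>lborel)"
proof -
  have "(\<lambda>x. f (a + (-1::real) *\<^sub>R x)) = (\<lambda>x. f (a - x))"
    by simp
  then show ?thesis using integral_lborel_affine[OF assms, of "-1" a] by simp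
qed

lemma integrable_reflect:
  fixes f :: "'a::euclidean_space \<Rightarrow> 'b::{banach,second_countable_topology}"
  assumes "integrable lborel f"
  shows "integrable lborel (\<lambda>x. f (a - x))"
proof -
  have "(\<lambda>x. f (a + (-1::real) *\<^sub>R x)) = (\<lambda>x. f (a - x))"
    by simp
  then show ?thesis using integrable_lborel_affine[OF assms, of "-1" a] by simp
qed

text \<open>Linearity of the integral as a closed set of rules for \<open>simp only\<close>: the
  integrability side conditions of the equations are solved by rules of the same set.\<close>

lemmas integral_linear = Bochner_Integration.integral_add Bochner_Integration.integral_diff
  Bochner_Integration.integral_minus Bochner_Integration.integral_sum Bochner_Integration.integrable_add
  Bochner_Integration.integrable_diff Bochner_Integration.integrable_minus Bochner_Integration.integrable_sum
  integrable_mult_right integral_mult_right_zero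

text \<open>Balls have positive measure. This is the bridge from identities that hold almost
  everywhere to statements at a point: it provides good points as close to a given centre as
  desired.\<close>

lemma AE_ball_witness:
  assumes "AE x in lborel. P x" "0 < e"
  obtains x where "x \<in> ball (c::real^3) e" "P x"
proof -
  have "\<exists>x\<in>ball c e. P x"
  proof (rule ccontr)
    assume "\<not> ?thesis"
    then have "AE x in lborel. x \<notin> ball c e"
      using assms(1) by (auto elim!: eventually_mono)
    then have "emeasure lborel (ball c e) = 0"
      by (subst (asm) AE_iff_measurable[OF _ refl]) (auto simp: ball_def)
    then show False using assms(2) by (simp add: emeasure_ball unit_ball_vol_3)
  qed
  then show ?thesis using that by blast
qed

section \<open>Norm, Cauchy-Schwarz inequality, completeness and duality in L2\<close>

lemma L2_measurable: "f \<in> L2 \<Longrightarrow> f \<in> borel_measurable borel"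
  by (simp add: L2_def)

lemma L2_integrable: "f \<in> L2 \<Longrightarrow> integrable lborel (\<lambda>x. (cmod (f x))\<^sup>2)"
  by (simp add: L2_def)

lemma L2_iff: "f \<in> L2 \<longleftrightarrow> f \<in> borel_measurable borel \<and> integrable lborel (\<lambda>x. (cmod (f x))\<^sup>2)"
  by (simp add: L2_def)

lemma L2_nn: "f \<in> L2 \<longleftrightarrow> f \<in> borel_measurable borel \<and> (\<integral>\<^sup>+x. ennreal ((cmod (f x))\<^sup>2) \<partial>lborel) < \<infinity>"
  by (auto simp: L2_def integrable_iff_bounded)

lemma L2_norm_nonneg [simp]: "0 \<le> L2_norm f"
  by (simp add: L2_norm_def)

lemma L2_norm_sq: "(L2_norm f)\<^sup>2 = (\<integral>x. (cmod (f x))\<^sup>2 \<partial>lborel)"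
  by (simp add: L2_norm_def)

lemma L2_nn_integral:
  "f \<in> L2 \<Longrightarrow> (\<integral>\<^sup>+x. ennreal ((cmod (f x))\<^sup>2) \<partial>lborel) = ennreal ((L2_norm f)\<^sup>2)"
  unfolding L2_norm_sq by (intro nn_integral_eq_integral) (auto simp: L2_def)

lemma L2_norm_le_iff:
  assumes "f \<in> L2" "0 \<le> C"
  shows "L2_norm f \<le> C \<longleftrightarrow> (\<integral>\<^sup>+x. ennreal ((cmod (f x))\<^sup>2) \<partial>lborel) \<le> ennreal (C\<^sup>2)"
  using assms power2_le_iff_abs_le[of C "L2_norm f"]
  by (simp add: L2_nn_integral)

lemma L2_by_bound:
  assumes [measurable]: "f \<in> borel_measurable borel" and "0 \<le> C"
    and "(\<integral>\<^sup>+x. ennreal ((cmod (f x))\<^sup>2) \<partial>lborel) \<le> ennreal (C\<^sup>2)"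
  shows "f \<in> L2" "L2_norm f \<le> C"
proof -
  show "f \<in> L2" using assms by (auto simp: L2_nn intro: le_less_trans)
  then show "L2_norm f \<le> C" using assms by (simp add: L2_norm_le_iff)
qed

lemma L2_dominated:
  assumes "g \<in> L2" and [measurable]: "f \<in> borel_measurable borel"
    and "AE x in lborel. cmod (f x) \<le> C * cmod (g x)"
  shows "f \<in> L2"
proof -
  have [measurable]: "g \<in> borel_measurable borel" using assms by (simp add: L2_def)
  have "integrable lborel (\<lambda>x. (C * cmod (g x))\<^sup>2)"
    using assms(1) by (simp add: L2_def power_mult_distrib)
  then have "integrable lborel (\<lambda>x. (cmod (f x))\<^sup>2)"
    by (rule Bochner_Integration.integrable_bound)
       (use assms(3) in \<open>auto elim!: eventually_mono intro!: power_mono\<close>)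
  then show ?thesis by (simp add: L2_def)
qed

lemma L2_zero [simp]: "(\<lambda>x. 0) \<in> L2" by (simp add: L2_def)

lemma L2_scale: "f \<in> L2 \<Longrightarrow> (\<lambda>x. c * f x) \<in> L2"
  by (auto simp: L2_iff norm_mult power_mult_distrib)

lemma L2_add:
  assumes f: "f \<in> L2" and g: "g \<in> L2"
  shows "(\<lambda>x. f x + g x) \<in> L2"
proof -
  note [measurable] = L2_measurable[OF f] L2_measurable[OF g]
  have "integrable lborel (\<lambda>x. 2 * (cmod (f x))\<^sup>2 + 2 * (cmod (g x))\<^sup>2)"
    using f g by (simp add: L2_def)
  then have "integrable lborel (\<lambda>x. (cmod (f x + g x))\<^sup>2)"
  proof (rule Bochner_Integration.integrable_bound; (intro AE_I2)?)
    fix x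
    have "(cmod (f x + g x))\<^sup>2 \<le> (cmod (f x) + cmod (g x))\<^sup>2"
      by (intro power_mono norm_triangle_ineq) auto
    also have "\<dots> \<le> 2 * (cmod (f x))\<^sup>2 + 2 * (cmod (g x))\<^sup>2"
      using sum_squares_bound[of "cmod (f x)" "cmod (g x)"] by (simp add: power2_sum)
    finally show "norm ((cmod (f x + g x))\<^sup>2) \<le> norm (2 * (cmod (f x))\<^sup>2 + 2 * (cmod (g x))\<^sup>2)"
      by simp
  qed measurable
  then show ?thesis by (simp add: L2_def)
qed

lemma L2_uminus: "f \<in> L2 \<Longrightarrow> (\<lambda>x. - f x) \<in> L2"
  using L2_scale[of f "-1"] by simp

lemma L2_diff: "f \<in> L2 \<Longrightarrow> g \<in> L2 \<Longrightarrow> (\<lambda>x. f x - g x) \<in> L2"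
  using L2_add[of f "\<lambda>x. - g x"] L2_uminus[of g] by simp

lemma L2_sum: "(\<And>i. i \<in> I \<Longrightarrow> f i \<in> L2) \<Longrightarrow> (\<lambda>x. \<Sum>i\<in>I. f i x) \<in> L2"
  by (induction I rule: infinite_finite_induct) (auto intro!: L2_add)

lemma L2_cnj: "f \<in> L2 \<Longrightarrow> (\<lambda>x. cnj (f x)) \<in> L2"
  by (auto simp: L2_iff intro: borel_measurable_continuous_on[OF continuous_on_cnj[OF continuous_on_id]])

lemma L2_translate: "f \<in> L2 \<Longrightarrow> (\<lambda>x. f (x - a)) \<in> L2"
  by (auto simp: L2_iff intro: integrable_translate[where f="\<lambda>x. (cmod (f x))\<^sup>2"])

lemma L2_reflect: "f \<in> L2 \<Longrightarrow> (\<lambda>x. f (a - x)) \<in> L2"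
  by (auto simp: L2_iff intro: integrable_reflect[where f="\<lambda>x. (cmod (f x))\<^sup>2"])

lemma L2_norm_scale: "L2_norm (\<lambda>x. c * f x) = cmod c * L2_norm f"
  by (simp add: L2_norm_def norm_mult power_mult_distrib real_sqrt_mult)

lemma L2_norm_uminus: "L2_norm (\<lambda>x. - f x) = L2_norm f"
  by (simp add: L2_norm_def)

lemma L2_norm_cnj: "L2_norm (\<lambda>x. cnj (f x)) = L2_norm f"
  by (simp add: L2_norm_def)

lemma L2_norm_translate: "f \<in> L2 \<Longrightarrow> L2_norm (\<lambda>x. f (x - a)) = L2_norm f"
  unfolding L2_norm_def
  by (subst integral_translate[where f="\<lambda>x. (cmod (f x))\<^sup>2"]) (auto simp: L2_def)

lemma L2_norm_reflect: "f \<in> L2 \<Longrightarrow> L2_norm (\<lambda>x. f (a - x)) = L2_norm f"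
  unfolding L2_norm_def
  by (subst integral_reflect[where f="\<lambda>x. (cmod (f x))\<^sup>2"]) (auto simp: L2_def)

lemma L2_norm_cong_AE:
  assumes "AE x in lborel. f x = g x" "f \<in> borel_measurable borel" "g \<in> borel_measurable borel"
  shows "L2_norm f = L2_norm g"
proof -
  have "(\<integral>x. (cmod (f x))\<^sup>2 \<partial>lborel) = (\<integral>x. (cmod (g x))\<^sup>2 \<partial>lborel)"
    using assms by (intro integral_cong_AE) auto
  then show ?thesis by (simp add: L2_norm_def)
qed

lemma L2_norm_eq_0:
  assumes "f \<in> L2" "L2_norm f = 0"
  shows "AE x in lborel. f x = 0"
proof -
  have "(\<integral>x. (cmod (f x))\<^sup>2 \<partial>lborel) = 0" using assms(2) by (simp add: L2_norm_sq[symmetric])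
  then show ?thesis
    using assms(1) by (subst (asm) integral_nonneg_eq_0_iff_AE) (auto simp: L2_def)
qed

lemma L2_mult_integrable:
  assumes f: "f \<in> L2" and g: "g \<in> L2"
  shows "integrable lborel (\<lambda>x. f x * g x)"
proof -
  note [measurable] = L2_measurable[OF f] L2_measurable[OF g]
  have "integrable lborel (\<lambda>x. (cmod (f x))\<^sup>2 + (cmod (g x))\<^sup>2)"
    using f g by (simp add: L2_def)
  then show ?thesis
  proof (rule Bochner_Integration.integrable_bound; (intro AE_I2)?)
    fix x
    show "norm (f x * g x) \<le> norm ((cmod (f x))\<^sup>2 + (cmod (g x))\<^sup>2)"
      using sum_squares_bound[of "cmod (f x)" "cmod (g x)"]
        mult_nonneg_nonneg[of "cmod (f x)" "cmod (g x)"]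
      unfolding norm_mult real_norm_def by linarith
  qed measurable
qed

text \<open>The version with nonnegative integrals serves as a bound inside iterated integrals,
  where integrability on the product space is still to be shown.\<close>

lemma L2_Cauchy_Schwarz_nn:
  assumes f: "f \<in> L2" and g: "g \<in> L2"
  shows "(\<integral>\<^sup>+x. ennreal (cmod (f x * g x)) \<partial>lborel) \<le> ennreal (L2_norm f * L2_norm g)"
proof -
  note [measurable] = L2_measurable[OF f] L2_measurable[OF g]
  have int: "integrable lborel (\<lambda>x. f x * g x)" by (rule L2_mult_integrable[OF f g])
  have eq: "(\<integral>\<^sup>+x. ennreal (cmod (f x * g x)) \<partial>lborel) = ennreal (\<integral>x. cmod (f x * g x) \<partial>lborel)"
    by (intro nn_integral_eq_integral integrable_norm int) auto
  have "(\<integral>\<^sup>+x. ennreal (cmod (f x)) * ennreal (cmod (g x)) \<partial>lborel)\<^sup>2 \<le>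
      (\<integral>\<^sup>+x. ennreal (cmod (f x)) ^ 2 \<partial>lborel) * (\<integral>\<^sup>+x. ennreal (cmod (g x)) ^ 2 \<partial>lborel)"
    by (rule Cauchy_Schwarz_nn_integral) auto
  also have "(\<lambda>x. ennreal (cmod (f x)) * ennreal (cmod (g x))) = (\<lambda>x. ennreal (cmod (f x * g x)))"
    by (simp add: norm_mult ennreal_mult)
  finally have "ennreal ((\<integral>x. cmod (f x * g x) \<partial>lborel)\<^sup>2) \<le> ennreal ((L2_norm f)\<^sup>2 * (L2_norm g)\<^sup>2)"
    unfolding eq using L2_nn_integral[OF f] L2_nn_integral[OF g]
    by (simp add: ennreal_power ennreal_mult)
  then have "(\<integral>x. cmod (f x * g x) \<partial>lborel)\<^sup>2 \<le> (L2_norm f * L2_norm g)\<^sup>2"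
    by (simp add: power_mult_distrib)
  then show ?thesis unfolding eq
    by (rule ennreal_leI[OF power2_le_imp_le]) auto
qed

lemma L2_Cauchy_Schwarz:
  assumes f: "f \<in> L2" and g: "g \<in> L2"
  shows "(\<integral>x. cmod (f x * g x) \<partial>lborel) \<le> L2_norm f * L2_norm g"
    and "cmod (\<integral>x. f x * g x \<partial>lborel) \<le> L2_norm f * L2_norm g"
proof -
  have int: "integrable lborel (\<lambda>x. f x * g x)" by (rule L2_mult_integrable[OF f g])
  have "(\<integral>\<^sup>+x. ennreal (cmod (f x * g x)) \<partial>lborel) = ennreal (\<integral>x. cmod (f x * g x) \<partial>lborel)"
    by (intro nn_integral_eq_integral integrable_norm int) auto
  then show *: "(\<integral>x. cmod (f x * g x) \<partial>lborel) \<le> L2_norm f * L2_norm g"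
    using L2_Cauchy_Schwarz_nn[OF f g] by (simp add: ennreal_le_iff)
  have "cmod (\<integral>x. f x * g x \<partial>lborel) \<le> (\<integral>x. cmod (f x * g x) \<partial>lborel)"
    by (rule integral_norm_bound)
  then show "cmod (\<integral>x. f x * g x \<partial>lborel) \<le> L2_norm f * L2_norm g" using * by linarith
qed

lemma L2_norm_triangle:
  assumes f: "f \<in> L2" and g: "g \<in> L2"
  shows "L2_norm (\<lambda>x. f x + g x) \<le> L2_norm f + L2_norm g"
proof (rule power2_le_imp_le)
  have int: "integrable lborel (\<lambda>x. cmod (f x * g x))"
    by (intro integrable_norm L2_mult_integrable f g)
  have "(L2_norm (\<lambda>x. f x + g x))\<^sup>2 = (\<integral>x. (cmod (f x + g x))\<^sup>2 \<partial>lborel)" by (rule L2_norm_sq)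
  also have "\<dots> \<le> (\<integral>x. (cmod (f x))\<^sup>2 + (cmod (g x))\<^sup>2 + 2 * cmod (f x * g x) \<partial>lborel)"
  proof (intro integral_mono)
    fix x
    have "(cmod (f x + g x))\<^sup>2 \<le> (cmod (f x) + cmod (g x))\<^sup>2"
      by (intro power_mono norm_triangle_ineq) auto
    then show "(cmod (f x + g x))\<^sup>2 \<le> (cmod (f x))\<^sup>2 + (cmod (g x))\<^sup>2 + 2 * cmod (f x * g x)"
      by (simp add: power2_sum norm_mult)
  qed (use L2_add[OF f g] f g int in \<open>auto simp: L2_def\<close>)
  also have "\<dots> = (L2_norm f)\<^sup>2 + (L2_norm g)\<^sup>2 + 2 * (\<integral>x. cmod (f x * g x) \<partial>lborel)"
    using int f g by (simp add: L2_norm_sq L2_def)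
  also have "\<dots> \<le> (L2_norm f + L2_norm g)\<^sup>2"
    using L2_Cauchy_Schwarz(1)[OF f g] by (simp add: power2_sum)
  finally show "(L2_norm (\<lambda>x. f x + g x))\<^sup>2 \<le> (L2_norm f + L2_norm g)\<^sup>2" .
qed simp

text \<open>The rate \<open>(1/8)^n\<close> makes \<open>2\<^sup>n \<bar>f\<^sub>n\<^sub>+\<^sub>1 - f\<^sub>n\<bar>\<^sup>2\<close> summable in \<open>L\<^sup>1\<close>, so the sequence converges
  almost everywhere, and Fatou's lemma gives the limit in norm.\<close>

lemma L2_complete:
  assumes L2: "\<And>n. f n \<in> L2"
    and Cauchy: "\<And>n m. n \<le> m \<Longrightarrow> (L2_norm (\<lambda>x. f n x - f m x))\<^sup>2 \<le> (1/8)^n"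
  obtains g where "g \<in> L2" "\<And>n. (L2_norm (\<lambda>x. f n x - g x))\<^sup>2 \<le> (1/8)^n"
proof -
  note [measurable] = L2_measurable[OF L2]
  define d where "d n x = f (Suc n) x - f n x" for n x
  have dL2: "d n \<in> L2" for n unfolding d_def[abs_def] by (rule L2_diff[OF L2 L2])
  note [measurable] = L2_measurable[OF dL2]
  have dn: "(\<integral>\<^sup>+x. ennreal ((cmod (d n x))\<^sup>2) \<partial>lborel) \<le> ennreal ((1/8)^n)" for n
  proof -
    have "(L2_norm (d n))\<^sup>2 \<le> (1/8)^n"
      using Cauchy[of n "Suc n"] L2_norm_uminus[of "\<lambda>x. f n x - f (Suc n) x"] by (simp add: d_def[abs_def])
    then show ?thesis by (simp add: L2_nn_integral[OF dL2] ennreal_leI)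
  qed
  have "(\<integral>\<^sup>+x. (\<Sum>n. ennreal (2^n * (cmod (d n x))\<^sup>2)) \<partial>lborel)
      = (\<Sum>n. \<integral>\<^sup>+x. ennreal (2^n * (cmod (d n x))\<^sup>2) \<partial>lborel)"
    by (rule nn_integral_suminf) measurable
  also have "\<dots> \<le> (\<Sum>n. ennreal ((1/4)^n))"
  proof (intro suminf_le allI)
    fix n
    have "(\<integral>\<^sup>+x. ennreal (2^n * (cmod (d n x))\<^sup>2) \<partial>lborel)
        = ennreal (2^n) * (\<integral>\<^sup>+x. ennreal ((cmod (d n x))\<^sup>2) \<partial>lborel)"
      by (simp add: ennreal_mult nn_integral_cmult)
    also have "\<dots> \<le> ennreal (2^n) * ennreal ((1/8)^n)"
      by (intro mult_left_mono dn) auto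
    also have "\<dots> = ennreal ((1/4)^n)"
      by (simp add: ennreal_mult[symmetric] power_mult_distrib[symmetric])
    finally show "(\<integral>\<^sup>+x. ennreal (2^n * (cmod (d n x))\<^sup>2) \<partial>lborel) \<le> ennreal ((1/4)^n)" .
  qed auto
  also have "\<dots> < \<infinity>"
    by (subst suminf_ennreal2) (auto intro!: summable_geometric)
  finally have "AE x in lborel. (\<Sum>n. ennreal (2^n * (cmod (d n x))\<^sup>2)) \<noteq> \<infinity>"
    by (intro nn_integral_PInf_AE) auto
  then have conv: "AE x in lborel. convergent (\<lambda>n. f n x)"
  proof eventually_elim
    fix x assume "(\<Sum>n. ennreal (2^n * (cmod (d n x))\<^sup>2)) \<noteq> \<infinity>"
    then have s: "summable (\<lambda>n. 2^n * (cmod (d n x))\<^sup>2)"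
      by (intro summable_suminf_not_top) auto
    have "summable (\<lambda>n. 2^n * (cmod (d n x))\<^sup>2 + (1/2)^n)"
      by (intro summable_add s summable_geometric) auto
    then have "summable (\<lambda>n. d n x)"
    proof (rule summable_comparison_test'[where N=0])
      fix n :: nat
      \<comment> \<open>Expanding this square gives 2 |d| <= 2^n |d|^2 + 2^(-n), so
        square-summability with weights 2^n already yields absolute summability.\<close>
      have "0 \<le> (2^n * cmod (d n x) - 1)\<^sup>2" by simp
      then have "2 * 2^n * cmod (d n x) \<le> 2^n * (2^n * (cmod (d n x))\<^sup>2) + 2^n * (1/2)^n"
        by (simp add: power2_diff power_mult_distrib power2_eq_square power_divide algebra_simps)
      also have "\<dots> = 2^n * (2^n * (cmod (d n x))\<^sup>2 + (1/2)^n)" by (simp add: algebra_simps)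
      finally have "2^n * (2 * cmod (d n x)) \<le> 2^n * (2^n * (cmod (d n x))\<^sup>2 + (1/2)^n)" by simp
      then have "2 * cmod (d n x) \<le> 2^n * (cmod (d n x))\<^sup>2 + (1/2)^n"
        by (subst (asm) mult_le_cancel_left_pos) auto
      then show "norm (d n x) \<le> 2^n * (cmod (d n x))\<^sup>2 + (1/2)^n"
        using norm_ge_zero[of "d n x"] by linarith
    qed
    then have "(\<lambda>n. \<Sum>i<n. d i x) \<longlonglongrightarrow> (\<Sum>n. d n x)" by (rule summable_LIMSEQ)
    also have "(\<lambda>n. \<Sum>i<n. d i x) = (\<lambda>n. f n x - f 0 x)"
      unfolding d_def by (rule ext) (rule sum_lessThan_telescope)
    finally have "(\<lambda>n. (f n x - f 0 x) + f 0 x) \<longlonglongrightarrow> (\<Sum>n. d n x) + f 0 x"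
      by (intro tendsto_intros)
    then show "convergent (\<lambda>n. f n x)" by (auto simp: convergent_def)
  qed
  \<comment> \<open>On the null set of divergence \<open>lim\<close> is an unspecified value;
    \<open>g\<close> is measurable all the same.\<close>
  define g where "g x = lim (\<lambda>n. f n x)" for x
  have [measurable]: "g \<in> borel_measurable borel"
    unfolding g_def by measurable
  have lim: "AE x in lborel. (\<lambda>n. f n x) \<longlonglongrightarrow> g x"
    using conv by eventually_elim (simp add: g_def convergent_LIMSEQ_iff)
  have bound: "(\<integral>\<^sup>+x. ennreal ((cmod (f n x - g x))\<^sup>2) \<partial>lborel) \<le> ennreal ((1/8)^n)" for n
  proof -
    have "(\<integral>\<^sup>+x. ennreal ((cmod (f n x - g x))\<^sup>2) \<partial>lborel)
        = (\<integral>\<^sup>+x. liminf (\<lambda>m. ennreal ((cmod (f n x - f m x))\<^sup>2)) \<partial>lborel)"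
    proof (rule nn_integral_cong_AE, use lim in eventually_elim)
      fix x assume "(\<lambda>n. f n x) \<longlonglongrightarrow> g x"
      then have "(\<lambda>m. ennreal ((cmod (f n x - f m x))\<^sup>2)) \<longlonglongrightarrow> ennreal ((cmod (f n x - g x))\<^sup>2)"
        by (intro tendsto_intros tendsto_ennrealI)
      then show "ennreal ((cmod (f n x - g x))\<^sup>2) = liminf (\<lambda>m. ennreal ((cmod (f n x - f m x))\<^sup>2))"
        using lim_imp_Liminf[OF sequentially_bot] by metis
    qed
    also have "\<dots> \<le> liminf (\<lambda>m. \<integral>\<^sup>+x. ennreal ((cmod (f n x - f m x))\<^sup>2) \<partial>lborel)"
      by (rule nn_integral_liminf) measurable
    also have "\<dots> \<le> limsup (\<lambda>m. \<integral>\<^sup>+x. ennreal ((cmod (f n x - f m x))\<^sup>2) \<partial>lborel)"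
      by (rule Liminf_le_Limsup) simp
    also have "\<dots> \<le> ennreal ((1/8)^n)"
    proof (rule Limsup_bounded)
      show "\<forall>\<^sub>F m in sequentially. (\<integral>\<^sup>+x. ennreal ((cmod (f n x - f m x))\<^sup>2) \<partial>lborel) \<le> ennreal ((1/8)^n)"
        using eventually_ge_at_top[of n]
        by eventually_elim (simp add: L2_nn_integral[OF L2_diff[OF L2 L2]] Cauchy)
    qed
    finally show ?thesis .
  qed
  have diff: "(\<lambda>x. f n x - g x) \<in> L2" for n
    using bound[of n] by (auto simp: L2_nn intro: le_less_trans)
  have "g \<in> L2" using L2_diff[OF L2[of 0] diff[of 0]] by simp
  moreover have "(L2_norm (\<lambda>x. f n x - g x))\<^sup>2 \<le> (1/8)^n" for n
    using bound[of n] by (simp add: L2_nn_integral[OF diff])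
  ultimately show ?thesis using that by blast
qed

lemma L2_norm_add_sq:
  assumes f: "f \<in> L2" and g: "g \<in> L2"
  shows "(L2_norm (\<lambda>x. f x + g x))\<^sup>2 = (L2_norm f)\<^sup>2 + (L2_norm g)\<^sup>2 + 2 * Re (L2_inner f g)"
proof -
  have int: "integrable lborel (\<lambda>x. f x * cnj (g x))"
    by (intro L2_mult_integrable f L2_cnj g)
  note i1 = L2_integrable[OF f] and i2 = L2_integrable[OF g]
    and i3 = integrable_mult_right[OF integrable_Re[OF int], of 2]
  have eq: "(cmod (a + b))\<^sup>2 = (cmod a)\<^sup>2 + (cmod b)\<^sup>2 + 2 * Re (a * cnj b)" for a b :: complex
    by (simp add: cmod_power2) (simp add: power2_eq_square algebra_simps)
  have "(L2_norm (\<lambda>x. f x + g x))\<^sup>2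
      = (\<integral>x. (cmod (f x))\<^sup>2 + (cmod (g x))\<^sup>2 + 2 * Re (f x * cnj (g x)) \<partial>lborel)"
    by (simp add: L2_norm_sq eq)
  also have "\<dots> = (\<integral>x. (cmod (f x))\<^sup>2 \<partial>lborel) + (\<integral>x. (cmod (g x))\<^sup>2 \<partial>lborel)
      + (\<integral>x. 2 * Re (f x * cnj (g x)) \<partial>lborel)"
    by (subst Bochner_Integration.integral_add[OF Bochner_Integration.integrable_add[OF i1 i2] i3],
        subst Bochner_Integration.integral_add[OF i1 i2]) simp
  also have "(\<integral>x. 2 * Re (f x * cnj (g x)) \<partial>lborel) = 2 * Re (L2_inner f g)"
    unfolding L2_inner_def integral_Re[OF int, symmetric] by (rule integral_mult_right_zero)
  finally show ?thesis by (simp add: L2_norm_sq)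
qed

lemma L2_parallelogram:
  assumes f: "f \<in> L2" and g: "g \<in> L2"
  shows "(L2_norm (\<lambda>x. f x - g x))\<^sup>2 + (L2_norm (\<lambda>x. f x + g x))\<^sup>2 = 2 * (L2_norm f)\<^sup>2 + 2 * (L2_norm g)\<^sup>2"
  using L2_norm_add_sq[OF f g] L2_norm_add_sq[OF f L2_uminus[OF g]]
  by (simp add: L2_norm_uminus L2_inner_def)

text \<open>The representing function is the limit of a sequence in \<open>V\<close> that minimises
  \<open>J f = \<parallel>f\<parallel>\<^sup>2 - 2 Re (\<Lambda> f)\<close>.\<close>

lemma L2_Riesz:
  fixes V :: "(real^3 \<Rightarrow> complex) set" and \<Lambda> :: "(real^3 \<Rightarrow> complex) \<Rightarrow> complex"
  assumes V: "V \<subseteq> L2" "V \<noteq> {}"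
    and V_add: "\<And>f g. f \<in> V \<Longrightarrow> g \<in> V \<Longrightarrow> (\<lambda>x. f x + g x) \<in> V"
    and V_scale: "\<And>c f. f \<in> V \<Longrightarrow> (\<lambda>x. c * f x) \<in> V"
    and \<Lambda>_add: "\<And>f g. f \<in> V \<Longrightarrow> g \<in> V \<Longrightarrow> \<Lambda> (\<lambda>x. f x + g x) = \<Lambda> f + \<Lambda> g"
    and \<Lambda>_scale: "\<And>c f. f \<in> V \<Longrightarrow> \<Lambda> (\<lambda>x. c * f x) = c * \<Lambda> f"
    and \<Lambda>_bound: "\<And>f. f \<in> V \<Longrightarrow> cmod (\<Lambda> f) \<le> C * L2_norm f"
  obtains g where "g \<in> L2" "\<And>f. f \<in> V \<Longrightarrow> \<Lambda> f = (\<integral>x. g x * f x \<partial>lborel)"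
proof -
  define J where "J f = (L2_norm f)\<^sup>2 - 2 * Re (\<Lambda> f)" for f
  have J_bound: "- C\<^sup>2 \<le> J f" if "f \<in> V" for f
  proof -
    have "0 \<le> (L2_norm f - C)\<^sup>2" by simp
    then have "- C\<^sup>2 \<le> (L2_norm f)\<^sup>2 - 2 * (C * L2_norm f)"
      by (simp add: power2_diff mult_ac)
    also have "\<dots> \<le> J f"
      using \<Lambda>_bound[OF that] complex_Re_le_cmod[of "\<Lambda> f"] by (simp add: J_def)
    finally show ?thesis .
  qed
  define m where "m = Inf (J ` V)"
  have bdd: "bdd_below (J ` V)" using J_bound by (intro bdd_belowI2) auto
  have m_le: "m \<le> J f" if "f \<in> V" for f
    unfolding m_def using bdd that by (intro cInf_lower) auto
  \<comment> \<open>The parallelogram law bounds the squared distance of two members by 2 (J f - m)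
    + 2 (J f' - m). With a quarter of (1/8)^n here, this is at most the (1/8)^n that
    \<open>L2_complete\<close> asks for.\<close>
  have "\<exists>f\<in>V. J f < m + (1/8)^n / 4" for n
  proof -
    have "Inf (J ` V) < m + (1/8)^n / 4" by (simp add: m_def)
    then show ?thesis using V(2) bdd by (subst (asm) cInf_less_iff) auto
  qed
  then obtain f where fV: "\<And>n::nat. f n \<in> V" and fJ: "\<And>n. J (f n) < m + (1/8)^n / 4"
    by metis
  have fL2: "f n \<in> L2" for n using fV V by auto
  have "(L2_norm (\<lambda>x. f n x - f k x))\<^sup>2 \<le> (1/8)^n" if "n \<le> k" for n k
  proof -
    \<comment> \<open>The midpoint stays in V, so J cannot fall below m there. The limit of the
      sequence, by contrast, need not belong to V, which is not assumed closed.\<close>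
    define h where "h x = (1/2) * (f n x + f k x)" for x
    have hV: "h \<in> V" unfolding h_def[abs_def] by (intro V_scale V_add fV)
    have "L2_norm h = (1/2) * L2_norm (\<lambda>x. f n x + f k x)"
      unfolding h_def[abs_def] L2_norm_scale by simp
    then have "L2_norm (\<lambda>x. f n x + f k x) = 2 * L2_norm h" by simp
    then have 1: "(L2_norm (\<lambda>x. f n x + f k x))\<^sup>2 = 4 * (L2_norm h)\<^sup>2"
      by (simp add: power_mult_distrib)
    have 2: "\<Lambda> h = (1/2) * (\<Lambda> (f n) + \<Lambda> (f k))"
      unfolding h_def[abs_def]
      by (subst \<Lambda>_scale, intro V_add fV, subst \<Lambda>_add, auto intro: fV)
    have "(L2_norm (\<lambda>x. f n x - f k x))\<^sup>2 = 2 * J (f n) + 2 * J (f k) - 4 * J h"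
      using L2_parallelogram[OF fL2[of n] fL2[of k]] 1 arg_cong[OF 2, of Re]
      unfolding J_def by simp
    moreover have "(1/8::real)^k \<le> (1/8)^n" using that by (intro power_decreasing) auto
    ultimately show ?thesis using fJ[of n] fJ[of k] m_le[OF hV] by linarith
  qed
  from L2_complete[OF fL2 this]
  obtain g0 where g0: "g0 \<in> L2" and g0_lim: "\<And>n. (L2_norm (\<lambda>x. f n x - g0 x))\<^sup>2 \<le> (1/8)^n"
    by blast
  have lim0: "(\<lambda>n. c * (1/8::real)^n) \<longlonglongrightarrow> 0" for c
    using tendsto_mult_right_zero[OF LIMSEQ_power_zero, of "1/8::real" c] by simp
  have "\<Lambda> \<psi> = L2_inner \<psi> g0" if \<psi>: "\<psi> \<in> V" for \<psi>
  proof -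
    have \<psi>L2: "\<psi> \<in> L2" using \<psi> V by auto
    define d where "d n = L2_inner \<psi> (f n) - \<Lambda> \<psi>" for n
    \<comment> \<open>Moving from \<open>f n\<close> by t \<psi> with t = - s cnj (d n) changes J by
      - s |d n|^2 (2 - s |\<psi>|^2). This s makes the bracket at least 1, also when \<psi> has norm
      0, so near-minimality of \<open>f n\<close> forces \<open>d n\<close> to be small.\<close>
    define s where "s = 1 / (1 + (L2_norm \<psi>)\<^sup>2)"
    have pos: "0 < 1 + (L2_norm \<psi>)\<^sup>2" by (smt (verit) zero_le_power2)
    then have s: "0 < s" "s * (1 + (L2_norm \<psi>)\<^sup>2) = 1" by (auto simp: s_def)
    have d_bound: "(cmod (d n))\<^sup>2 \<le> (1/s) * (1/8)^n" for n
    proof -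
      define t where "t = - of_real s * cnj (d n)"
      have tV: "(\<lambda>x. f n x + t * \<psi> x) \<in> V" by (intro V_add V_scale fV \<psi>)
      have inner: "L2_inner (f n) (\<lambda>x. t * \<psi> x) = cnj (t * L2_inner \<psi> (f n))"
      proof -
        have "cnj (t * L2_inner \<psi> (f n)) = cnj (\<integral>x. t * (\<psi> x * cnj (f n x)) \<partial>lborel)"
          by (simp add: L2_inner_def)
        also have "\<dots> = (\<integral>x. cnj (t * (\<psi> x * cnj (f n x))) \<partial>lborel)"
          by (rule Bochner_Integration.integral_cnj[symmetric])
        also have "\<dots> = L2_inner (f n) (\<lambda>x. t * \<psi> x)"
          by (simp add: L2_inner_def mult_ac)
        finally show ?thesis by simp
      qed
      have "t * d n = - of_real (s * (cmod (d n))\<^sup>2)"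
        using complex_norm_square[of "d n"] by (simp add: t_def mult_ac)
      then have Re: "Re (t * d n) = - s * (cmod (d n))\<^sup>2" by simp
      have ct: "cmod t = s * cmod (d n)" using s(1) by (simp add: t_def norm_mult)
      have "J (\<lambda>x. f n x + t * \<psi> x) = J (f n) + 2 * Re (t * d n) + (cmod t)\<^sup>2 * (L2_norm \<psi>)\<^sup>2"
        unfolding J_def L2_norm_add_sq[OF fL2 L2_scale[OF \<psi>L2]] inner L2_norm_scale
          \<Lambda>_add[OF fV V_scale[OF \<psi>]] \<Lambda>_scale[OF \<psi>] d_def
        by (simp add: power_mult_distrib algebra_simps)
      also have "\<dots> = J (f n) - s * (cmod (d n))\<^sup>2 * (2 - s * (L2_norm \<psi>)\<^sup>2)"
        unfolding Re ct by (simp add: power2_eq_square algebra_simps)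
      finally have "m \<le> J (f n) - s * (cmod (d n))\<^sup>2 * (2 - s * (L2_norm \<psi>)\<^sup>2)"
        using m_le[OF tV] by simp
      moreover have "s * (cmod (d n))\<^sup>2 * 1 \<le> s * (cmod (d n))\<^sup>2 * (2 - s * (L2_norm \<psi>)\<^sup>2)"
        using s by (intro mult_left_mono) (auto simp: algebra_simps)
      moreover have "(0::real) < (1/8)^n" by simp
      ultimately have "s * (cmod (d n))\<^sup>2 \<le> (1/8)^n" using fJ[of n] by linarith
      then show ?thesis using s(1) by (simp add: field_simps)
    qed
    have "(\<lambda>n. (cmod (d n))\<^sup>2) \<longlonglongrightarrow> 0"
      by (rule tendsto_sandwich[OF _ _ tendsto_const lim0[of "1/s"]]) (use d_bound in auto)
    then have "(\<lambda>n. sqrt ((cmod (d n))\<^sup>2)) \<longlonglongrightarrow> sqrt 0" by (rule tendsto_real_sqrt)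
    then have d0: "d \<longlonglongrightarrow> 0" by (simp add: tendsto_norm_zero_iff)
    have "(cmod (L2_inner \<psi> (f n) - L2_inner \<psi> g0))\<^sup>2 \<le> (L2_norm \<psi>)\<^sup>2 * (1/8)^n" for n
    proof -
      have "L2_inner \<psi> (f n) - L2_inner \<psi> g0 = (\<integral>x. \<psi> x * cnj (f n x - g0 x) \<partial>lborel)"
        unfolding L2_inner_def using L2_mult_integrable[OF \<psi>L2 L2_cnj] fL2 g0
        by (subst Bochner_Integration.integral_diff[symmetric]) (auto simp: algebra_simps)
      then have "cmod (L2_inner \<psi> (f n) - L2_inner \<psi> g0) \<le> L2_norm \<psi> * L2_norm (\<lambda>x. f n x - g0 x)"
        using L2_Cauchy_Schwarz(2)[OF \<psi>L2 L2_cnj[OF L2_diff[OF fL2[of n] g0]]]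
        by (simp add: L2_norm_cnj del: complex_cnj_diff)
      then have "(cmod (L2_inner \<psi> (f n) - L2_inner \<psi> g0))\<^sup>2 \<le> (L2_norm \<psi> * L2_norm (\<lambda>x. f n x - g0 x))\<^sup>2"
        by (intro power_mono) auto
      also have "\<dots> \<le> (L2_norm \<psi>)\<^sup>2 * (1/8)^n"
        unfolding power_mult_distrib by (intro mult_left_mono g0_lim) auto
      finally show ?thesis .
    qed
    then have "(\<lambda>n. (cmod (L2_inner \<psi> (f n) - L2_inner \<psi> g0))\<^sup>2) \<longlonglongrightarrow> 0"
      by (intro tendsto_sandwich[OF _ _ tendsto_const lim0[of "(L2_norm \<psi>)\<^sup>2"]]) auto
    then have "(\<lambda>n. sqrt ((cmod (L2_inner \<psi> (f n) - L2_inner \<psi> g0))\<^sup>2)) \<longlonglongrightarrow> sqrt 0"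
      by (rule tendsto_real_sqrt)
    then have "(\<lambda>n. L2_inner \<psi> (f n) - L2_inner \<psi> g0) \<longlonglongrightarrow> 0" by (simp add: tendsto_norm_zero_iff)
    then have "(\<lambda>n. (L2_inner \<psi> (f n) - L2_inner \<psi> g0) - d n) \<longlonglongrightarrow> 0 - 0"
      by (intro tendsto_diff d0)
    then have "(\<lambda>n::nat. \<Lambda> \<psi> - L2_inner \<psi> g0) \<longlonglongrightarrow> 0" by (simp add: d_def)
    then show ?thesis by (simp add: LIMSEQ_const_iff)
  qed
  then show ?thesis
    using that[OF L2_cnj[OF g0]] by (simp add: L2_inner_def mult.commute)
qed

section \<open>Convolution\<close>

text \<open>The translation sits on the second factor: the result is an average of translates of u
  with weight g, and an identity for all translates of u therefore passes to the
  convolution.\<close>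

definition conv :: "(real^3 \<Rightarrow> complex) \<Rightarrow> (real^3 \<Rightarrow> complex) \<Rightarrow> real^3 \<Rightarrow> complex" where
  "conv g u x = (\<integral>a. g a * u (x - a) \<partial>lborel)"

lemma conv_measurable [measurable]:
  assumes [measurable]: "g \<in> borel_measurable borel" "u \<in> borel_measurable borel"
  shows "conv g u \<in> borel_measurable borel"
  unfolding conv_def[abs_def] by (rule lborel.borel_measurable_lebesgue_integral) measurable

text \<open>Cauchy-Schwarz after splitting |g| |u| into sqrt |g| and sqrt |g| |u|. Integrability is
  not assumed: where it fails, the Bochner integral is 0 and the bound is trivial.\<close>

lemma conv_norm_sq_le:
  assumes [measurable]: "g \<in> borel_measurable borel" "u \<in> borel_measurable borel"
  shows "ennreal ((cmod (conv g u x))\<^sup>2) \<le> (\<integral>\<^sup>+a. ennreal (cmod (g a)) \<partial>lborel)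
           * (\<integral>\<^sup>+a. ennreal (cmod (g a) * (cmod (u (x - a)))\<^sup>2) \<partial>lborel)"
proof -
  have "ennreal (cmod (conv g u x)) \<le> (\<integral>\<^sup>+a. ennreal (cmod (g a * u (x - a))) \<partial>lborel)"
  proof (cases "integrable lborel (\<lambda>a. g a * u (x - a))")
    case True
    then show ?thesis unfolding conv_def by (rule integral_norm_bound_ennreal)
  next
    case False
    then show ?thesis unfolding conv_def by (simp add: not_integrable_integral_eq)
  qed
  also have "\<dots> = (\<integral>\<^sup>+a. ennreal (sqrt (cmod (g a))) * ennreal (sqrt (cmod (g a)) * cmod (u (x - a))) \<partial>lborel)"
    by (intro nn_integral_cong) (simp add: ennreal_mult[symmetric] norm_mult mult.assoc[symmetric])
  finally have "(ennreal (cmod (conv g u x)))\<^sup>2 \<le> \<dots>\<^sup>2" by (rule power_mono) simp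
  also have "\<dots> \<le> (\<integral>\<^sup>+a. (ennreal (sqrt (cmod (g a))))\<^sup>2 \<partial>lborel)
      * (\<integral>\<^sup>+a. (ennreal (sqrt (cmod (g a)) * cmod (u (x - a))))\<^sup>2 \<partial>lborel)"
    by (rule Cauchy_Schwarz_nn_integral) auto
  finally show ?thesis by (simp add: ennreal_power power_mult_distrib)
qed

text \<open>Integrate the pointwise bound over x and exchange the integrals: by translation
  invariance the inner integral is the squared norm of u, and a second factor |g|_1 remains.\<close>

lemma conv_Young:
  assumes g: "integrable lborel g" and u: "u \<in> L2"
  shows conv_L2: "conv g u \<in> L2"
    and conv_L2_norm: "L2_norm (conv g u) \<le> (\<integral>x. cmod (g x) \<partial>lborel) * L2_norm u"
proof -
  have [measurable]: "g \<in> borel_measurable borel" using g by auto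
  note [measurable] = L2_measurable[OF u]
  define c where "c = (\<integral>x. cmod (g x) \<partial>lborel)"
  have c: "0 \<le> c" "(\<integral>\<^sup>+a. ennreal (cmod (g a)) \<partial>lborel) = ennreal c"
    unfolding c_def using g by (auto intro!: nn_integral_eq_integral)
  have "(\<integral>\<^sup>+x. ennreal ((cmod (conv g u x))\<^sup>2) \<partial>lborel)
      \<le> (\<integral>\<^sup>+x. ennreal c * (\<integral>\<^sup>+a. ennreal (cmod (g a) * (cmod (u (x - a)))\<^sup>2) \<partial>lborel) \<partial>lborel)"
    unfolding c(2)[symmetric] by (intro nn_integral_mono conv_norm_sq_le) auto
  also have "\<dots> = ennreal c * (\<integral>\<^sup>+x. (\<integral>\<^sup>+a. ennreal (cmod (g a) * (cmod (u (x - a)))\<^sup>2) \<partial>lborel) \<partial>lborel)"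
    by (intro nn_integral_cmult) measurable
  also have "(\<integral>\<^sup>+x. (\<integral>\<^sup>+a. ennreal (cmod (g a) * (cmod (u (x - a)))\<^sup>2) \<partial>lborel) \<partial>lborel)
      = (\<integral>\<^sup>+a. (\<integral>\<^sup>+x. ennreal (cmod (g a) * (cmod (u (x - a)))\<^sup>2) \<partial>lborel) \<partial>lborel)"
    by (rule lborel_pair.Fubini'[where f="\<lambda>a x. ennreal (cmod (g a) * (cmod (u (x - a)))\<^sup>2)"]) measurable
  also have "\<dots> = (\<integral>\<^sup>+a. ennreal (cmod (g a)) * ennreal ((L2_norm u)\<^sup>2) \<partial>lborel)"
  proof (intro nn_integral_cong)
    fix a
    have "(\<integral>\<^sup>+x. ennreal (cmod (g a) * (cmod (u (x - a)))\<^sup>2) \<partial>lborel)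
        = ennreal (cmod (g a)) * (\<integral>\<^sup>+x. ennreal ((cmod (u (x - a)))\<^sup>2) \<partial>lborel)"
      by (simp add: ennreal_mult nn_integral_cmult)
    also have "\<dots> = ennreal (cmod (g a)) * ennreal ((L2_norm u)\<^sup>2)"
      using L2_nn_integral[OF L2_translate[OF u, of a]] by (simp add: L2_norm_translate[OF u])
    finally show "(\<integral>\<^sup>+x. ennreal (cmod (g a) * (cmod (u (x - a)))\<^sup>2) \<partial>lborel)
      = ennreal (cmod (g a)) * ennreal ((L2_norm u)\<^sup>2)" .
  qed
  also have "ennreal c * \<dots> = ennreal ((c * L2_norm u)\<^sup>2)"
    using c by (simp add: nn_integral_multc) (simp add: ennreal_mult[symmetric] power_mult_distrib power2_eq_square mult_ac)
  finally have *: "(\<integral>\<^sup>+x. ennreal ((cmod (conv g u x))\<^sup>2) \<partial>lborel) \<le> ennreal ((c * L2_norm u)\<^sup>2)" .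
  have "0 \<le> c * L2_norm u" using c by simp
  from L2_by_bound[OF _ this *]
  show "conv g u \<in> L2" "L2_norm (conv g u) \<le> (\<integral>x. cmod (g x) \<partial>lborel) * L2_norm u"
    by (auto simp: c_def)
qed

text \<open>Fubini; absolute convergence on the product follows from Cauchy-Schwarz for each
  translate, with a bound independent of a, and integrability of g.\<close>

lemma conv_pairing:
  assumes g: "integrable lborel g" and u: "u \<in> L2" and v: "v \<in> L2"
  shows "(\<integral>x. conv g u x * v x \<partial>lborel) = (\<integral>a. g a * (\<integral>x. u (x - a) * v x \<partial>lborel) \<partial>lborel)"
proof -
  have [measurable]: "g \<in> borel_measurable borel" using g by auto
  note [measurable] = L2_measurable[OF u] L2_measurable[OF v]
  have int: "integrable (lborel \<Otimes>\<^sub>M lborel) (\<lambda>(a, x). g a * u (x - a) * v x)"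
  proof (rule integrableI_bounded)
    have "(\<integral>\<^sup>+p. ennreal (norm (case p of (a, x) \<Rightarrow> g a * u (x - a) * v x)) \<partial>(lborel \<Otimes>\<^sub>M lborel))
        = (\<integral>\<^sup>+a. \<integral>\<^sup>+x. ennreal (norm (g a * u (x - a) * v x)) \<partial>lborel \<partial>lborel)"
      by (subst lborel.nn_integral_fst[symmetric]) (auto intro!: nn_integral_cong)
    also have "\<dots> \<le> (\<integral>\<^sup>+a. ennreal (cmod (g a)) * ennreal (L2_norm u * L2_norm v) \<partial>lborel)"
    proof (intro nn_integral_mono)
      fix a
      have "(\<integral>\<^sup>+x. ennreal (norm (g a * u (x - a) * v x)) \<partial>lborel)
          = ennreal (cmod (g a)) * (\<integral>\<^sup>+x. ennreal (cmod (u (x - a) * v x)) \<partial>lborel)"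
        by (subst nn_integral_cmult[symmetric]) (auto simp: norm_mult ennreal_mult mult.assoc)
      also have "\<dots> \<le> ennreal (cmod (g a)) * ennreal (L2_norm u * L2_norm v)"
        using L2_Cauchy_Schwarz_nn[OF L2_translate[OF u, of a] v]
        by (intro mult_left_mono) (auto simp: L2_norm_translate[OF u])
      finally show "(\<integral>\<^sup>+x. ennreal (norm (g a * u (x - a) * v x)) \<partial>lborel)
          \<le> ennreal (cmod (g a)) * ennreal (L2_norm u * L2_norm v)" .
    qed
    also have "\<dots> = (\<integral>\<^sup>+a. ennreal (cmod (g a)) \<partial>lborel) * ennreal (L2_norm u * L2_norm v)"
      by (rule nn_integral_multc) auto
    also have "\<dots> < \<infinity>"
      using g by (auto simp: integrable_iff_bounded ennreal_mult_less_top)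
    finally show "(\<integral>\<^sup>+p. ennreal (norm (case p of (a, x) \<Rightarrow> g a * u (x - a) * v x)) \<partial>(lborel \<Otimes>\<^sub>M lborel)) < \<infinity>" .
  qed measurable
  have "(\<integral>x. conv g u x * v x \<partial>lborel) = (\<integral>x. (\<integral>a. g a * u (x - a) * v x \<partial>lborel) \<partial>lborel)"
    by (simp add: conv_def)
  also have "\<dots> = (\<integral>a. (\<integral>x. g a * u (x - a) * v x \<partial>lborel) \<partial>lborel)"
    by (rule lborel_pair.Fubini_integral[OF int])
  also have "\<dots> = (\<integral>a. g a * (\<integral>x. u (x - a) * v x \<partial>lborel) \<partial>lborel)"
    by (simp add: mult.assoc)
  finally show ?thesis .
qed

text \<open>A pairing of two convolutions is a double average over a and b of the pairings of
  translates, so it depends on p and q only through the latter. Derivatives can thus be moved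
  between p and q without ever differentiating a kernel.\<close>

lemma conv_conv_pairing_cong:
  assumes g: "integrable lborel g" and h: "integrable lborel h"
    and L2: "p \<in> L2" "q \<in> L2" "p' \<in> L2" "q' \<in> L2"
    and eq: "\<And>a b. (\<integral>x. p (x - a) * q (x - b) \<partial>lborel) = (\<integral>x. p' (x - a) * q' (x - b) \<partial>lborel)"
  shows "(\<integral>x. conv g p x * conv h q x \<partial>lborel) = (\<integral>x. conv g p' x * conv h q' x \<partial>lborel)"
proof -
  have *: "(\<integral>x. conv g p x * conv h q x \<partial>lborel)
      = (\<integral>a. g a * (\<integral>b. h b * (\<integral>x. p (x - a) * q (x - b) \<partial>lborel) \<partial>lborel) \<partial>lborel)"
    if "p \<in> L2" "q \<in> L2" for p q
  proof -
    have "(\<integral>x. p (x - a) * conv h q x \<partial>lborel) = (\<integral>b. h b * (\<integral>x. p (x - a) * q (x - b) \<partial>lborel) \<partial>lborel)" for a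
      using conv_pairing[OF h that(2) L2_translate[OF that(1), of a]] by (simp add: mult.commute)
    then show ?thesis
      by (simp add: conv_pairing[OF g that(1) conv_L2[OF h that(2)]])
  qed
  show ?thesis using L2 by (simp add: * eq)
qed

text \<open>The transpose of translation by a is translation by -a, so the transpose of convolution
  with g is convolution with the reflected kernel.\<close>

lemma conv_pairing_reflect:
  assumes g: "integrable lborel g" and u: "u \<in> L2" and v: "v \<in> L2"
  shows "(\<integral>x. conv g u x * v x \<partial>lborel) = (\<integral>x. u x * conv (\<lambda>a. g (- a)) v x \<partial>lborel)"
proof -
  have g': "integrable lborel (\<lambda>a. g (- a))" using integrable_reflect[OF g, of 0] by simp
  have [measurable]: "g \<in> borel_measurable borel" using g by auto
  note [measurable] = L2_measurable[OF u] L2_measurable[OF v]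
  have "(\<integral>x. u x * conv (\<lambda>a. g (- a)) v x \<partial>lborel) = (\<integral>a. g (- a) * (\<integral>x. v (x - a) * u x \<partial>lborel) \<partial>lborel)"
    using conv_pairing[OF g' v u] by (simp add: mult.commute)
  also have "\<dots> = (\<integral>a. g (- (0 - a)) * (\<integral>x. v (x - (0 - a)) * u x \<partial>lborel) \<partial>lborel)"
    by (subst integral_reflect[of _ 0]) measurable
  also have "\<dots> = (\<integral>a. g a * (\<integral>x. u (x - a) * v x \<partial>lborel) \<partial>lborel)"
  proof (intro Bochner_Integration.integral_cong refl)
    fix a
    have "(\<integral>x. v (x + a) * u x \<partial>lborel) = (\<integral>x. v (x - a + a) * u (x - a) \<partial>lborel)"
      by (rule integral_translate[symmetric, where f="\<lambda>x. v (x + a) * u x"]) measurable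
    then show "g (- (0 - a)) * (\<integral>x. v (x - (0 - a)) * u x \<partial>lborel) = g a * (\<integral>x. u (x - a) * v x \<partial>lborel)"
      by (simp add: mult.commute)
  qed
  finally show ?thesis by (simp add: conv_pairing[OF g u v])
qed

lemma conv_pairing_even:
  assumes "integrable lborel g" "\<And>x. g (- x) = g x" "u \<in> L2" "v \<in> L2"
  shows "(\<integral>x. conv g u x * v x \<partial>lborel) = (\<integral>x. u x * conv g v x \<partial>lborel)"
  using conv_pairing_reflect[OF assms(1,3,4)] assms(2) by simp

lemma conv_integrable:
  "g \<in> L2 \<Longrightarrow> u \<in> L2 \<Longrightarrow> integrable lborel (\<lambda>a. g a * u (x - a))"
  by (intro L2_mult_integrable L2_reflect)

text \<open>For two L2 functions the defining integral converges at every point. This gives (G *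
  f)(0) a meaning and makes it continuous in f.\<close>

lemma conv_bound:
  assumes "g \<in> L2" "u \<in> L2"
  shows "cmod (conv g u x) \<le> L2_norm g * L2_norm u"
  unfolding conv_def using L2_Cauchy_Schwarz(2)[OF assms(1) L2_reflect[OF assms(2), of x]]
  by (simp add: L2_norm_reflect[OF assms(2)])

lemma conv_add:
  assumes "g \<in> L2" "u \<in> L2" "v \<in> L2"
  shows "conv g (\<lambda>x. u x + v x) x = conv g u x + conv g v x"
  unfolding conv_def using assms by (simp add: distrib_left conv_integrable)

lemma conv_scale: "conv g (\<lambda>x. c * u x) x = c * conv g u x"
  unfolding conv_def by (subst integral_mult_right_zero[symmetric]) (simp add: mult_ac)

lemma conv_sum:
  assumes "g \<in> L2" "\<And>i. i \<in> I \<Longrightarrow> u i \<in> L2"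
  shows "conv g (\<lambda>x. \<Sum>i\<in>I. u i x) x = (\<Sum>i\<in>I. conv g (u i) x)"
  using assms(2)
  by (induction I rule: infinite_finite_induct)
     (auto simp: conv_add[OF assms(1)] L2_sum, auto simp: conv_def)

lemma conv_diff_left:
  assumes "g \<in> L2" "h \<in> L2" "u \<in> L2"
  shows "conv (\<lambda>x. g x - h x) u x = conv g u x - conv h u x"
  unfolding conv_def using assms by (simp add: left_diff_distrib conv_integrable)

lemma conv_commute:
  assumes [measurable]: "g \<in> borel_measurable borel" "u \<in> borel_measurable borel"
  shows "conv g u x = (\<integral>y. g (x - y) * u y \<partial>lborel)"
  unfolding conv_def
  using integral_reflect[where f="\<lambda>a. g a * u (x - a)" and a=x] by simp

lemma conv_cnj: "conv (\<lambda>x. cnj (g x)) (\<lambda>x. cnj (u x)) x = cnj (conv g u x)"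
  unfolding conv_def by (simp flip: complex_cnj_mult)

section \<open>Smooth functions and test functions\<close>

text \<open>\<open>partial\<close> has an unspecified value where no derivative exists. The relation
  records existence as well, which permits differentiating functions, such as 1/|x|, that are smooth
  only on part of space.\<close>

abbreviation line_deriv :: "3 \<Rightarrow> (real^3 \<Rightarrow> complex) \<Rightarrow> real^3 \<Rightarrow> complex \<Rightarrow> bool" where
  "line_deriv i f x D \<equiv> ((\<lambda>t. f (x + t *\<^sub>R axis i 1)) has_vector_derivative D) (at 0)"

lemma partial_eqI: "line_deriv i f x D \<Longrightarrow> partial i f x = D"
  unfolding partial_def by (rule vector_derivative_at)

lemma line_deriv_at:
  assumes "line_deriv i f (x + t *\<^sub>R axis i 1) D"
  shows "((\<lambda>s. f (x + s *\<^sub>R axis i 1)) has_vector_derivative D) (at t)"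
proof -
  have "((\<lambda>s. s - t) has_vector_derivative 1) (at t)" by (auto intro!: derivative_eq_intros)
  moreover have "((\<lambda>s. f (x + t *\<^sub>R axis i 1 + s *\<^sub>R axis i 1)) has_vector_derivative D) (at (t - t))"
    using assms by simp
  ultimately have "((\<lambda>s. f (x + t *\<^sub>R axis i 1 + s *\<^sub>R axis i 1)) \<circ> (\<lambda>s. s - t) has_vector_derivative (1 *\<^sub>R D)) (at t)"
    by (rule vector_diff_chain_at)
  then show ?thesis by (simp add: o_def algebra_simps)
qed

lemma line_deriv_quotient:
  assumes "line_deriv i f x D"
  shows "((\<lambda>t. (f (x + t *\<^sub>R axis i 1) - f x) /\<^sub>R t) \<longlongrightarrow> D) (at 0)"
proof -
  have "((\<lambda>h. cmod (f (x + h *\<^sub>R axis i 1) - f x - h *\<^sub>R D) / norm h) \<longlongrightarrow> 0) (at 0)"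
    using assms by (simp add: has_vector_derivative_def has_derivative_at)
  moreover have "\<forall>\<^sub>F h in at 0. cmod (f (x + h *\<^sub>R axis i 1) - f x - h *\<^sub>R D) / norm h
      = cmod ((f (x + h *\<^sub>R axis i 1) - f x) /\<^sub>R h - D)"
    unfolding eventually_at_filter
  proof (intro always_eventually allI impI)
    fix h :: real assume "h \<noteq> 0"
    then have "(f (x + h *\<^sub>R axis i 1) - f x) /\<^sub>R h - D = (f (x + h *\<^sub>R axis i 1) - f x - h *\<^sub>R D) /\<^sub>R h"
      by (simp add: scaleR_diff_right)
    then show "cmod (f (x + h *\<^sub>R axis i 1) - f x - h *\<^sub>R D) / norm h
      = cmod ((f (x + h *\<^sub>R axis i 1) - f x) /\<^sub>R h - D)"
      by (simp add: divide_inverse mult.commute)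
  qed
  ultimately have "((\<lambda>h. cmod ((f (x + h *\<^sub>R axis i 1) - f x) /\<^sub>R h - D)) \<longlongrightarrow> 0) (at 0)"
    by (rule Lim_transform_eventually)
  then show ?thesis by (simp only: tendsto_norm_zero_iff LIM_zero_iff)
qed

lemma line_deriv_differentiable:
  assumes "f differentiable (at x)"
  shows "line_deriv i f x (partial i f x)"
proof -
  have "(\<lambda>t::real. x + t *\<^sub>R axis i 1) differentiable (at 0)" by (intro derivative_intros)
  then have "f \<circ> (\<lambda>t::real. x + t *\<^sub>R axis i 1) differentiable (at 0)"
    using assms by (intro differentiable_chain_at) auto
  then show ?thesis unfolding partial_def vector_derivative_works by (simp add: o_def)
qed

lemma line_deriv_transform:
  assumes "line_deriv i f x D" "\<forall>\<^sub>F y in nhds x. f y = g y"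
  shows "line_deriv i g x D"
proof -
  have "((\<lambda>t::real. x + t *\<^sub>R axis i 1) \<longlongrightarrow> x) (at 0)"
    by (auto intro!: tendsto_eq_intros)
  then have "\<forall>\<^sub>F t in at 0. f (x + t *\<^sub>R axis i 1) = g (x + t *\<^sub>R axis i 1)"
    using assms(2) by (auto simp: filterlim_iff)
  then show ?thesis
    using assms(1) eventually_nhds_x_imp_x[OF assms(2)] unfolding has_vector_derivative_def
    by (rule_tac has_derivative_transform_eventually[where f="\<lambda>t. f (x + t *\<^sub>R axis i 1)"]) simp_all
qed

lemma line_deriv_add: "line_deriv i f x D \<Longrightarrow> line_deriv i g x E \<Longrightarrow> line_deriv i (\<lambda>x. f x + g x) x (D + E)"
  by (rule has_vector_derivative_add)

lemma line_deriv_mult: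
  assumes "line_deriv i f x D" "line_deriv i g x E"
  shows "line_deriv i (\<lambda>x. f x * g x) x (f x * E + D * g x)"
  using has_vector_derivative_mult[OF assms] by simp

lemma line_deriv_cmult:
  assumes "line_deriv i f x D"
  shows "line_deriv i (\<lambda>x. c * f x) x (c * D)"
  using bounded_linear.has_vector_derivative[OF bounded_linear_mult_right assms, of c] by simp

lemma line_deriv_cnj: "line_deriv i f x D \<Longrightarrow> line_deriv i (\<lambda>x. cnj (f x)) x (cnj D)"
  using bounded_linear.has_vector_derivative[OF bounded_linear_cnj] by blast

lemma line_deriv_affine:
  assumes "line_deriv i f (a + c *\<^sub>R x) D"
  shows "line_deriv i (\<lambda>x. f (a + c *\<^sub>R x)) x (c *\<^sub>R D)"
proof -
  have "((\<lambda>s. c * s) has_vector_derivative c) (at 0)" by (auto intro!: derivative_eq_intros)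
  moreover have "((\<lambda>t. f (a + c *\<^sub>R x + t *\<^sub>R axis i 1)) has_vector_derivative D) (at (c * 0))"
    using assms by simp
  ultimately have "((\<lambda>t. f (a + c *\<^sub>R x + t *\<^sub>R axis i 1)) \<circ> (\<lambda>s. c * s) has_vector_derivative (c *\<^sub>R D)) (at 0)"
    by (rule vector_diff_chain_at)
  then show ?thesis by (simp add: o_def algebra_simps)
qed

section \<open>Iterated partial derivatives and closure properties of smooth functions\<close>

lemma partials_snoc: "partials (is @ [i]) f = partials is (partial i f)"
  by (induction "is") auto

lemma smooth_differentiable: "smooth f \<Longrightarrow> f differentiable (at x)"
  unfolding smooth_def by (drule spec[of _ "[]"]) (simp add: differentiable_on_def)

lemma smooth_partial: "smooth f \<Longrightarrow> smooth (partial i f)"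
  unfolding smooth_def using partials_snoc by metis

lemma smooth_partials: "smooth f \<Longrightarrow> smooth (partials is f)"
  by (induction "is") (auto intro: smooth_partial)

lemma smooth_continuous: "smooth f \<Longrightarrow> continuous_on UNIV f"
  unfolding smooth_def by (drule spec[of _ "[]"]) (simp add: differentiable_imp_continuous_on)

lemma smooth_measurable: "smooth f \<Longrightarrow> f \<in> borel_measurable borel"
  by (intro borel_measurable_continuous_onI smooth_continuous)

lemma smooth_line_deriv: "smooth f \<Longrightarrow> line_deriv i f x (partial i f x)"
  by (intro line_deriv_differentiable smooth_differentiable)

text \<open>A graded form of \<open>smooth\<close> that strips the innermost derivative first. The
  Leibniz rule turns a derivative of a product into a sum of products with one order less to spare,
  so closure under products is an induction on the order and not on a single list of
  directions.\<close>

primrec smooth_upto :: "nat \<Rightarrow> (real^3 \<Rightarrow> complex) \<Rightarrow> bool" where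
  "smooth_upto 0 f \<longleftrightarrow> f differentiable_on UNIV"
| "smooth_upto (Suc n) f \<longleftrightarrow> f differentiable_on UNIV \<and> (\<forall>i. smooth_upto n (partial i f))"

lemma smooth_upto_iff: "smooth_upto n f \<longleftrightarrow> (\<forall>is. length is \<le> n \<longrightarrow> partials is f differentiable_on UNIV)"
proof (induction n arbitrary: f)
  case 0 then show ?case by simp
next
  case (Suc n)
  have "(\<forall>is. length is \<le> Suc n \<longrightarrow> partials is f differentiable_on UNIV) \<longleftrightarrow>
     f differentiable_on UNIV \<and> (\<forall>i is. length is \<le> n \<longrightarrow> partials (is @ [i]) f differentiable_on UNIV)"
    (is "?L \<longleftrightarrow> ?R")
  proof
    assume ?L
    then show ?R by (metis length_append_singleton not_less_eq_eq partials.simps(1) list.size(3) zero_le)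
  next
    assume R: ?R
    show ?L
    proof (intro allI impI)
      fix "is" :: "3 list" assume "length is \<le> Suc n"
      then show "partials is f differentiable_on UNIV"
        using R by (cases "is" rule: rev_cases) auto
    qed
  qed
  then show ?case by (simp add: Suc.IH partials_snoc)
qed

lemma smooth_iff_upto: "smooth f \<longleftrightarrow> (\<forall>n. smooth_upto n f)"
  unfolding smooth_def smooth_upto_iff by auto

lemma smooth_upto_line_deriv: "smooth_upto n f \<Longrightarrow> line_deriv i f x (partial i f x)"
  by (intro line_deriv_differentiable) (cases n, auto simp: differentiable_on_def)

lemma smooth_upto_mono: "smooth_upto (Suc n) f \<Longrightarrow> smooth_upto n f"
  unfolding smooth_upto_iff by auto

lemma smooth_upto_add: "smooth_upto n f \<Longrightarrow> smooth_upto n g \<Longrightarrow> smooth_upto n (\<lambda>x. f x + g x)"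
proof (induction n arbitrary: f g)
  case 0 then show ?case by (auto intro: differentiable_on_add)
next
  case (Suc n)
  have "partial i (\<lambda>x. f x + g x) = (\<lambda>x. partial i f x + partial i g x)" for i
    by (rule ext, rule partial_eqI, rule line_deriv_add; rule smooth_upto_line_deriv[OF Suc.prems(1)] smooth_upto_line_deriv[OF Suc.prems(2)])
  then show ?case using Suc by (auto intro: differentiable_on_add)
qed

lemma smooth_upto_mult: "smooth_upto n f \<Longrightarrow> smooth_upto n g \<Longrightarrow> smooth_upto n (\<lambda>x. f x * g x)"
proof (induction n arbitrary: f g)
  case 0 then show ?case by (auto intro: differentiable_on_mult)
next
  case (Suc n)
  have "partial i (\<lambda>x. f x * g x) = (\<lambda>x. f x * partial i g x + partial i f x * g x)" for i
    by (rule ext, rule partial_eqI, rule line_deriv_mult; rule smooth_upto_line_deriv[OF Suc.prems(1)] smooth_upto_line_deriv[OF Suc.prems(2)])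
  then show ?case
    using Suc.prems Suc.IH[OF smooth_upto_mono[OF Suc.prems(1)]] Suc.IH[OF _ smooth_upto_mono[OF Suc.prems(2)]]
    by (auto intro!: differentiable_on_mult smooth_upto_add)
qed

lemma smooth_add: "smooth f \<Longrightarrow> smooth g \<Longrightarrow> smooth (\<lambda>x. f x + g x)"
  by (simp add: smooth_iff_upto smooth_upto_add)

lemma smooth_mult: "smooth f \<Longrightarrow> smooth g \<Longrightarrow> smooth (\<lambda>x. f x * g x)"
  by (simp add: smooth_iff_upto smooth_upto_mult)

lemma partials_affine:
  assumes "smooth f"
  shows "partials is (\<lambda>x. f (a + c *\<^sub>R x)) = (\<lambda>x. c ^ length is *\<^sub>R partials is f (a + c *\<^sub>R x))"
proof (induction "is")
  case (Cons i "is")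
  have "line_deriv i (\<lambda>x. c ^ length is *\<^sub>R partials is f (a + c *\<^sub>R x)) x
    (c ^ length is *\<^sub>R (c *\<^sub>R partials (i # is) f (a + c *\<^sub>R x)))" for x
    using smooth_line_deriv[OF smooth_partials[OF assms]]
    by (intro bounded_linear.has_vector_derivative[OF bounded_linear_scaleR_right] line_deriv_affine) auto
  then have "partial i (\<lambda>x. c ^ length is *\<^sub>R partials is f (a + c *\<^sub>R x)) x
    = c ^ length is *\<^sub>R (c *\<^sub>R partials (i # is) f (a + c *\<^sub>R x))" for x
    by (rule partial_eqI)
  then show ?case using Cons by (auto simp: mult.commute)
qed simp

lemma smooth_affine:
  assumes "smooth f"
  shows "smooth (\<lambda>x. f (a + c *\<^sub>R x))"
  unfolding smooth_def partials_affine[OF assms]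
proof (intro allI)
  fix "is"
  have "partials is f \<circ> (\<lambda>x. a + c *\<^sub>R x) differentiable (at x)" for x
    by (intro differentiable_chain_at smooth_differentiable[OF smooth_partials[OF assms]] derivative_intros)
  then show "(\<lambda>x. c ^ length is *\<^sub>R partials is f (a + c *\<^sub>R x)) differentiable_on UNIV"
    by (auto simp: differentiable_on_def o_def intro!: derivative_intros)
qed

lemma partials_cnj:
  assumes "smooth f"
  shows "partials is (\<lambda>x. cnj (f x)) = (\<lambda>x. cnj (partials is f x))"
proof (induction "is")
  case (Cons i "is")
  have "partial i (\<lambda>x. cnj (partials is f x)) = (\<lambda>x. cnj (partial i (partials is f) x))"
    by (intro ext partial_eqI line_deriv_cnj smooth_line_deriv smooth_partials assms)
  then show ?case using Cons by simp
qed simp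

lemma smooth_cnj:
  assumes "smooth f"
  shows "smooth (\<lambda>x. cnj (f x))"
  unfolding smooth_def partials_cnj[OF assms]
proof (intro allI)
  fix "is"
  show "(\<lambda>x. cnj (partials is f x)) differentiable_on UNIV"
    unfolding differentiable_on_def
  proof
    fix x
    obtain D where "(partials is f has_derivative D) (at x)"
      using smooth_differentiable[OF smooth_partials[OF assms]] by (auto simp: differentiable_def)
    then have "((\<lambda>x. cnj (partials is f x)) has_derivative (\<lambda>h. cnj (D h))) (at x)"
      by (rule bounded_linear.has_derivative[OF bounded_linear_cnj])
    then show "(\<lambda>x. cnj (partials is f x)) differentiable (at x)" by (auto simp: differentiable_def)
  qed
qed

lemma partials_add:
  assumes "smooth f" "smooth g"
  shows "partials is (\<lambda>x. f x + g x) = (\<lambda>x. partials is f x + partials is g x)"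
proof (induction "is")
  case (Cons i "is")
  have "partial i (\<lambda>x. partials is f x + partials is g x)
      = (\<lambda>x. partial i (partials is f) x + partial i (partials is g) x)"
    by (intro ext partial_eqI line_deriv_add smooth_line_deriv smooth_partials assms)
  then show ?case using Cons by simp
qed simp

lemma partials_cmult:
  assumes "smooth f"
  shows "partials is (\<lambda>x. c * f x) = (\<lambda>x. c * partials is f x)"
proof (induction "is")
  case (Cons i "is")
  have "partial i (\<lambda>x. c * partials is f x) = (\<lambda>x. c * partial i (partials is f) x)"
    by (intro ext partial_eqI line_deriv_cmult smooth_line_deriv smooth_partials assms)
  then show ?case using Cons by simp
qed simp

lemma smooth_cmult:
  assumes "smooth f"
  shows "smooth (\<lambda>x. c * f x)"
  using smooth_partials[OF assms] unfolding smooth_def[of "\<lambda>x. c * f x"] partials_cmult[OF assms]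
  by (auto simp: differentiable_on_def intro!: differentiable_mult[OF differentiable_const] smooth_differentiable)

section \<open>Test functions: closure properties and supports\<close>

lemma test_smooth: "f \<in> test_functions U \<Longrightarrow> smooth f"
  by (simp add: test_functions_def)

lemma test_subset:
  assumes "f \<in> test_functions U" "smooth g" "{x. g x \<noteq> 0} \<subseteq> closure {x. f x \<noteq> 0}"
  shows "g \<in> test_functions U"
proof -
  have "closure {x. g x \<noteq> 0} \<subseteq> closure {x. f x \<noteq> 0}"
    using closure_mono[OF assms(3)] by simp
  moreover have "bounded {x. g x \<noteq> 0}"
    using assms(1,3) by (auto simp: test_functions_def intro: bounded_subset compact_imp_bounded)
  ultimately show ?thesis using assms(1,2)
    by (auto simp: test_functions_def compact_closure)
qed

lemma test_UNIV: "f \<in> test_functions U \<Longrightarrow> f \<in> test_functions UNIV"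
  by (simp add: test_functions_def)

lemma test_UNIV_iff: "f \<in> test_functions UNIV \<longleftrightarrow> smooth f \<and> bounded {x. f x \<noteq> 0}"
  by (auto simp: test_functions_def compact_closure)

lemma test_zero: "(\<lambda>x. 0) \<in> test_functions U"
proof -
  have "partials is (\<lambda>x. 0) = (\<lambda>x. 0)" for "is"
    by (induction "is") (auto intro!: partial_eqI)
  then show ?thesis by (simp add: test_functions_def smooth_def)
qed

lemma test_add:
  assumes "f \<in> test_functions U" "g \<in> test_functions U"
  shows "(\<lambda>x. f x + g x) \<in> test_functions U"
proof -
  have "closure {x. f x + g x \<noteq> 0} \<subseteq> closure ({x. f x \<noteq> 0} \<union> {x. g x \<noteq> 0})"
    by (intro closure_mono) auto
  then have "closure {x. f x + g x \<noteq> 0} \<subseteq> closure {x. f x \<noteq> 0} \<union> closure {x. g x \<noteq> 0}"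
    by (simp add: closure_Un)
  moreover have "bounded ({x. f x \<noteq> 0} \<union> {x. g x \<noteq> 0})"
    using assms by (simp add: test_functions_def compact_closure)
  then have "bounded {x. f x + g x \<noteq> 0}" by (rule bounded_subset) auto
  ultimately show ?thesis using assms
    by (auto simp: test_functions_def smooth_add compact_closure)
qed

lemma test_mult:
  assumes "f \<in> test_functions U" "smooth g"
  shows "(\<lambda>x. f x * g x) \<in> test_functions U"
  using closure_subset[of "{x. f x \<noteq> 0}"]
  by (intro test_subset[OF assms(1) smooth_mult[OF test_smooth[OF assms(1)] assms(2)]]) auto

lemma test_scale:
  assumes "f \<in> test_functions U"
  shows "(\<lambda>x. c * f x) \<in> test_functions U"
  using closure_subset[of "{x. f x \<noteq> 0}"]
  by (intro test_subset[OF assms smooth_cmult[OF test_smooth[OF assms]]]) auto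

lemma test_cnj:
  assumes "f \<in> test_functions U"
  shows "(\<lambda>x. cnj (f x)) \<in> test_functions U"
  using closure_subset[of "{x. f x \<noteq> 0}"]
  by (intro test_subset[OF assms smooth_cnj[OF test_smooth[OF assms]]]) auto

lemma line_deriv_zero:
  assumes "x \<notin> closure {x. f x \<noteq> 0}" "line_deriv i f x D"
  shows "D = 0"
proof -
  have "\<forall>\<^sub>F y in nhds x. f y = 0"
    unfolding eventually_nhds using assms(1) closure_subset[of "{x. f x \<noteq> 0}"]
    by (intro exI[of _ "- closure {x. f x \<noteq> 0}"]) (auto simp: open_Compl)
  then have "partial i (\<lambda>x. 0) x = D"
    by (intro partial_eqI line_deriv_transform[OF assms(2)])
  moreover have "partial i (\<lambda>x. 0) x = 0" by (intro partial_eqI) simp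
  ultimately show ?thesis by simp
qed

text \<open>Outside the closed support the function vanishes on a neighbourhood. The closure
  matters: a function can vanish at a point where its derivative does not.\<close>

lemma line_deriv_support:
  assumes "\<And>x. line_deriv i f x (f' x)"
  shows "{x. f' x \<noteq> 0} \<subseteq> closure {x. f x \<noteq> 0}"
proof
  fix x assume "x \<in> {x. f' x \<noteq> 0}"
  then show "x \<in> closure {x. f x \<noteq> 0}"
    using line_deriv_zero[where x=x and f=f and i=i and D="f' x"] assms[of x] by auto
qed

lemma partial_support: "smooth f \<Longrightarrow> {x. partial i f x \<noteq> 0} \<subseteq> closure {x. f x \<noteq> 0}"
  by (rule line_deriv_support[where i=i and f'="partial i f"]) (rule smooth_line_deriv)

lemma test_partial: "f \<in> test_functions U \<Longrightarrow> partial i f \<in> test_functions U"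
  by (rule test_subset[OF _ smooth_partial partial_support]) (auto dest: test_smooth)

lemma test_partials: "f \<in> test_functions U \<Longrightarrow> partials is f \<in> test_functions U"
  by (induction "is") (auto intro: test_partial)

lemma test_support:
  assumes "f \<in> test_functions U"
  obtains R where "0 < R" "\<And>x. R < norm x \<Longrightarrow> f x = 0"
proof -
  have "bounded {x. f x \<noteq> 0}" using assms test_UNIV test_UNIV_iff by blast
  then show ?thesis using that by (force simp: bounded_pos not_le[symmetric])
qed

lemma test_affine:
  assumes "f \<in> test_functions UNIV" "c \<noteq> 0"
  shows "(\<lambda>x. f (a + c *\<^sub>R x)) \<in> test_functions UNIV"
proof -
  have "{x. f (a + c *\<^sub>R x) \<noteq> 0} \<subseteq> (\<lambda>y. (1/c) *\<^sub>R (y - a)) ` {x. f x \<noteq> 0}"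
    using assms(2) by (auto simp: image_iff intro!: exI[of _ "a + c *\<^sub>R _"])
  moreover have "bounded ((\<lambda>y. (1/c) *\<^sub>R y) ` (\<lambda>y. y - a) ` {x. f x \<noteq> 0})"
    using assms(1) by (intro bounded_scaling bounded_translation_minus) (simp add: test_UNIV_iff)
  then have "bounded ((\<lambda>y. (1/c) *\<^sub>R (y - a)) ` {x. f x \<noteq> 0})" by (simp add: image_image)
  ultimately show ?thesis
    using assms(1) smooth_affine by (auto simp: test_UNIV_iff intro: bounded_subset)
qed

section \<open>Compactly supported functions: integrability, integration by parts, symmetry of
  second derivatives\<close>

lemma compactly_supported_bounded:
  fixes f :: "real^3 \<Rightarrow> complex"
  assumes "continuous_on UNIV f" "bounded {x. f x \<noteq> 0}"
  obtains M where "0 < M" "\<And>x. cmod (f x) \<le> M"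
proof -
  have "compact (f ` closure {x. f x \<noteq> 0})"
    using assms by (intro compact_continuous_image) (auto simp: compact_closure intro: continuous_on_subset)
  then have "bounded (f ` closure {x. f x \<noteq> 0})" by (rule compact_imp_bounded)
  then obtain M where "0 < M" and M: "\<And>x. x \<in> closure {x. f x \<noteq> 0} \<Longrightarrow> cmod (f x) \<le> M"
    unfolding bounded_pos ball_simps by metis
  then have "cmod (f x) \<le> M" for x
    using closure_subset[of "{x. f x \<noteq> 0}"] by (cases "f x = 0") auto
  then show ?thesis using that \<open>0 < M\<close> by meson
qed

lemma compactly_supported_integrable:
  fixes f :: "real^3 \<Rightarrow> complex"
  assumes "continuous_on UNIV f" "bounded {x. f x \<noteq> 0}"
  shows "integrable lborel f"
proof -
  have "integrable lborel (\<lambda>x. indicator (closure {x. f x \<noteq> 0}) x *\<^sub>R f x)"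
    using assms by (intro borel_integrable_compact) (auto simp: compact_closure intro: continuous_on_subset)
  moreover have "(\<lambda>x. indicator (closure {x. f x \<noteq> 0}) x *\<^sub>R f x) = f"
    using closure_subset[of "{x. f x \<noteq> 0}"] by (auto simp: indicator_def fun_eq_iff)
  ultimately show ?thesis by simp
qed

lemma compactly_supported_L2:
  fixes f :: "real^3 \<Rightarrow> complex"
  assumes "continuous_on UNIV f" "bounded {x. f x \<noteq> 0}"
  shows "f \<in> L2"
proof -
  obtain M where M: "0 < M" "\<And>x. cmod (f x) \<le> M" using compactly_supported_bounded[OF assms] by metis
  have [measurable]: "f \<in> borel_measurable borel" using assms by (intro borel_measurable_continuous_onI)
  have "integrable lborel (\<lambda>x. M * cmod (f x))"
    using compactly_supported_integrable[OF assms] by simp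
  then have "integrable lborel (\<lambda>x. (cmod (f x))\<^sup>2)"
    by (rule Bochner_Integration.integrable_bound)
       (use M in \<open>auto simp: power2_eq_square intro!: mult_right_mono\<close>)
  then show ?thesis by (simp add: L2_iff)
qed

lemma test_continuous: "f \<in> test_functions U \<Longrightarrow> continuous_on UNIV f"
  by (intro smooth_continuous test_smooth)

lemma test_bounded_support: "f \<in> test_functions U \<Longrightarrow> bounded {x. f x \<noteq> 0}"
  using test_UNIV test_UNIV_iff by blast

lemma test_L2: "f \<in> test_functions U \<Longrightarrow> f \<in> L2"
  by (intro compactly_supported_L2 test_continuous test_bounded_support)

lemma test_integrable: "f \<in> test_functions U \<Longrightarrow> integrable lborel f"
  by (intro compactly_supported_integrable test_continuous test_bounded_support)

lemma test_bounded:
  assumes "f \<in> test_functions U"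
  obtains M where "0 < M" "\<And>x. cmod (f x) \<le> M"
  using that by (rule compactly_supported_bounded[OF test_continuous[OF assms] test_bounded_support[OF assms]])

text \<open>The mean value inequality in the form used for difference quotients; complex values
  admit no mean value equation.\<close>

lemma norm_difference_bound:
  fixes g :: "real \<Rightarrow> complex"
  assumes "0 \<le> h" "\<And>t. 0 \<le> t \<Longrightarrow> t \<le> h \<Longrightarrow> (g has_vector_derivative g' t) (at t)"
    "\<And>t. 0 \<le> t \<Longrightarrow> t \<le> h \<Longrightarrow> cmod (g' t) \<le> B"
  shows "cmod (g h - g 0) \<le> B * h"
proof -
  have "norm (g h - g 0) \<le> B * norm (h - 0)"
  proof (rule differentiable_bound[where S="{0..h}" and f'="\<lambda>t s. s *\<^sub>R g' t"])
    fix t assume t: "t \<in> {0..h}"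
    show "(g has_derivative (\<lambda>s. s *\<^sub>R g' t)) (at t within {0..h})"
      using assms(2)[of t] t by (auto simp: has_vector_derivative_def intro: has_derivative_at_withinI)
    show "onorm (\<lambda>s. s *\<^sub>R g' t) \<le> B"
    proof (rule onorm_le)
      fix s
      have "\<bar>s\<bar> * cmod (g' t) \<le> \<bar>s\<bar> * B"
        using assms(3)[of t] t by (intro mult_left_mono) auto
      then show "norm (s *\<^sub>R g' t) \<le> B * norm s" by (simp add: mult.commute)
    qed
  qed (use assms(1) in auto)
  then show ?thesis using assms(1) by simp
qed

text \<open>The difference quotients of \<open>p\<close> have integral zero by translation invariance, are bounded by
  \<open>sup \<bar>p'\<bar>\<close> and vanish outside a ball, so dominated convergence applies.\<close>

lemma integral_line_deriv_zero:
  assumes p: "continuous_on UNIV p" and supp: "bounded {x. p x \<noteq> 0}"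
    and D: "\<And>x. line_deriv i p x (p' x)" and p': "continuous_on UNIV p'"
  shows "(\<integral>x. p' x \<partial>lborel) = 0"
proof -
  have [measurable]: "p \<in> borel_measurable borel" "p' \<in> borel_measurable borel"
    using p p' by (auto intro: borel_measurable_continuous_onI)
  define e :: "real^3" where "e = axis i 1"
  have e: "norm e = 1" by (simp add: e_def norm_axis_1)
  obtain R where R: "0 < R" "\<And>x. R < norm x \<Longrightarrow> p x = 0"
    using supp by (force simp: bounded_pos not_le[symmetric])
  have "{x. p' x \<noteq> 0} \<subseteq> closure {x. p x \<noteq> 0}"
    by (rule line_deriv_support[OF D])
  then have "bounded {x. p' x \<noteq> 0}" using supp bounded_closure bounded_subset by blast
  then obtain M where M: "0 < M" "\<And>x. cmod (p' x) \<le> M"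
    using compactly_supported_bounded[OF p'] by blast
  define d where "d n x = of_nat (Suc n) * (p (x + (1 / real (Suc n)) *\<^sub>R e) - p x)" for n x
  have [measurable]: "d n \<in> borel_measurable borel" for n unfolding d_def[abs_def] by measurable
  have d_bound: "cmod (d n x) \<le> M" for n x
  proof -
    define h where "h = 1 / real (Suc n)"
    have h: "0 < h" "h * real (Suc n) = 1" by (auto simp: h_def)
    have "cmod (p (x + h *\<^sub>R e) - p (x + 0 *\<^sub>R e)) \<le> M * h"
      by (rule norm_difference_bound[where g'="\<lambda>t. p' (x + t *\<^sub>R e)"])
         (use h M D in \<open>auto simp: e_def intro: line_deriv_at\<close>)
    then have "real (Suc n) * cmod (p (x + h *\<^sub>R e) - p x) \<le> real (Suc n) * (M * h)"
      by (intro mult_left_mono) auto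
    also have "\<dots> = M" using h by (simp add: mult_ac)
    finally show ?thesis unfolding d_def h_def[symmetric] norm_mult norm_of_nat .
  qed
  \<comment> \<open>The step 1 / (n + 1) is at most 1, so one ball carries all difference
    quotients.\<close>
  have d_zero: "d n x = 0" if "R + 1 < norm x" for n x
  proof -
    have "norm x \<le> norm (x + (1 / real (Suc n)) *\<^sub>R e) + norm ((1 / real (Suc n)) *\<^sub>R e)"
      using norm_triangle_ineq4[of "x + (1 / real (Suc n)) *\<^sub>R e" "(1 / real (Suc n)) *\<^sub>R e"] by simp
    also have "norm ((1 / real (Suc n)) *\<^sub>R e) \<le> 1" using e by simp
    finally have "R < norm (x + (1 / real (Suc n)) *\<^sub>R e)" using that by linarith
    then show ?thesis using R that by (simp add: d_def)
  qed
  have "integrable lborel p" by (rule compactly_supported_integrable[OF p supp])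
  then have "(\<integral>x. d n x \<partial>lborel) = 0" for n
    unfolding d_def by (simp add: integrable_translate' integral_translate')
  moreover have "(\<lambda>n. \<integral>x. d n x \<partial>lborel) \<longlonglongrightarrow> (\<integral>x. p' x \<partial>lborel)"
  proof (rule integral_dominated_convergence[where w="\<lambda>x. M * indicator (cball 0 (R + 1)) x"])
    have "integrable lborel (indicator (cball (0::real^3) (R + 1)) :: _ \<Rightarrow> real)"
      using emeasure_lborel_cball_finite[of "0::real^3" "R + 1"] by (intro integrable_real_indicator) auto
    then show "integrable lborel (\<lambda>x::real^3. M * indicator (cball 0 (R + 1)) x)" by simp
    show "AE x in lborel. cmod (d n x) \<le> M * indicator (cball 0 (R + 1)) x" for n
      using d_bound d_zero by (intro AE_I2) (auto simp: indicator_def)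
    show "AE x in lborel. (\<lambda>n. d n x) \<longlonglongrightarrow> p' x"
    proof (intro AE_I2)
      fix x
      have "((\<lambda>t. (p (x + t *\<^sub>R e) - p x) /\<^sub>R t) \<longlongrightarrow> p' x) (at 0)"
        using line_deriv_quotient[OF D[of x]] by (simp add: e_def)
      moreover have "filterlim (\<lambda>n. 1 / real (Suc n)) (at 0) sequentially"
        using LIMSEQ_Suc[OF lim_1_over_n] by (auto simp: filterlim_at)
      ultimately have "(\<lambda>n. (p (x + (1 / real (Suc n)) *\<^sub>R e) - p x) /\<^sub>R (1 / real (Suc n))) \<longlonglongrightarrow> p' x"
        by (rule filterlim_compose)
      then show "(\<lambda>n. d n x) \<longlonglongrightarrow> p' x"
        by (simp add: d_def scaleR_conv_of_real)
    qed
  qed measurable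
  ultimately show ?thesis using LIMSEQ_unique[OF tendsto_const] by fastforce
qed

lemma integration_by_parts:
  assumes f: "f \<in> test_functions UNIV" and g: "smooth g"
  shows "(\<integral>x. partial i f x * g x \<partial>lborel) = - (\<integral>x. f x * partial i g x \<partial>lborel)"
proof -
  note sf = test_smooth[OF f]
  have c: "continuous_on UNIV f" "continuous_on UNIV g" "continuous_on UNIV (partial i f)" "continuous_on UNIV (partial i g)"
    using sf g by (auto intro: smooth_continuous smooth_partial)
  have fg: "(\<lambda>x. f x * g x) \<in> test_functions UNIV" by (rule test_mult[OF f g])
  have "(\<integral>x. f x * partial i g x + partial i f x * g x \<partial>lborel) = 0"
    by (rule integral_line_deriv_zero[OF test_continuous[OF fg] test_bounded_support[OF fg]])
       (auto intro!: continuous_intros c line_deriv_mult smooth_line_deriv sf g)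
  moreover have "integrable lborel (\<lambda>x. f x * partial i g x)" "integrable lborel (\<lambda>x. partial i f x * g x)"
    using f g by (auto intro!: test_integrable test_mult test_partial smooth_partial)
  ultimately show ?thesis by (simp add: eq_neg_iff_add_eq_0 add.commute)
qed

text \<open>The difference quotients in direction \<open>i\<close> converge together with their \<open>j\<close>-derivatives, the latter
  uniformly, hence to the \<open>j\<close>-derivative of the limit.\<close>

lemma partial_commute:
  assumes f: "smooth f"
  shows "partial i (partial j f) x = partial j (partial i f) x"
proof -
  define ei ej :: "real^3" where "ei = axis i 1" and "ej = axis j 1"
  have norm: "norm ei = 1" "norm ej = 1" by (simp_all add: ei_def ej_def norm_axis_1)
  define u where "u = partial j f"
  define h where "h n = 1 / real (Suc n)" for n
  have h: "0 < h n" "h n \<le> 1" "real (Suc n) * h n = 1" for n by (auto simp: h_def)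
  have h_lim: "h \<longlonglongrightarrow> 0" unfolding h_def by (rule LIMSEQ_Suc[OF lim_1_over_n])
  have u: "smooth u" unfolding u_def by (rule smooth_partial[OF f])
  define q where "q n s = real (Suc n) *\<^sub>R (f (x + h n *\<^sub>R ei + s *\<^sub>R ej) - f (x + s *\<^sub>R ej))" for n s
  define q' where "q' n s = real (Suc n) *\<^sub>R (u (x + h n *\<^sub>R ei + s *\<^sub>R ej) - u (x + s *\<^sub>R ej))" for n s
  define g' where "g' s = partial i u (x + s *\<^sub>R ej)" for s
  have q: "(q n has_vector_derivative q' n s) (at s)" for n s
    unfolding q_def[abs_def] q'_def
    by (intro has_vector_derivative_diff bounded_linear.has_vector_derivative[OF bounded_linear_scaleR_right])
       (auto simp: u_def ej_def intro!: line_deriv_at smooth_line_deriv f)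
  have q_lim: "(\<lambda>n. q n s) \<longlonglongrightarrow> partial i f (x + s *\<^sub>R ej)" for s
  proof -
    have "filterlim h (at 0) sequentially"
      using h_lim h(1) by (auto simp: filterlim_at less_imp_neq[symmetric])
    from filterlim_compose[OF line_deriv_quotient[OF smooth_line_deriv[OF f]] this, of "x + s *\<^sub>R ej" i]
    show ?thesis by (simp add: q_def h_def ei_def algebra_simps)
  qed
  have unif: "\<forall>\<^sub>F n in sequentially. \<forall>s\<in>{-1..1}. \<forall>k. norm (k *\<^sub>R q' n s - k *\<^sub>R g' s) \<le> e * norm k"
    if e: "0 < e" for e
  proof -
    \<comment> \<open>The points that occur are x + s ej + t ei with |s| <= 1 and 0 <= t <= 1; they
      stay within distance 2 of x.\<close>
    have "uniformly_continuous_on (cball x 2) (partial i u)"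
      by (intro compact_uniformly_continuous continuous_on_subset[OF smooth_continuous[OF smooth_partial[OF u]]]) auto
    then obtain \<delta> where \<delta>: "0 < \<delta>" "\<And>y z. y \<in> cball x 2 \<Longrightarrow> z \<in> cball x 2 \<Longrightarrow> dist z y < \<delta> \<Longrightarrow> dist (partial i u z) (partial i u y) < e"
      using e unfolding uniformly_continuous_on_def by metis
    have "\<forall>\<^sub>F n in sequentially. h n < \<delta>" using h_lim \<delta>(1) by (rule order_tendstoD)
    then show ?thesis
    proof (eventually_elim, intro ballI allI)
      fix n and s k :: real assume hn: "h n < \<delta>" and s: "s \<in> {-1..1::real}"
      define y where "y = x + s *\<^sub>R ej"
      have "dist x y \<le> 1" using s norm by (simp add: y_def dist_norm abs_le_iff)
      \<comment> \<open>The mean value inequality is applied to u(y + t ei) minus its linearisation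
        at t = 0. Its derivative is a difference of values of \<open>partial i u\<close> at points
        closer than \<delta>, so the bound is uniform in s.\<close>
      have "cmod ((u (y + h n *\<^sub>R ei) - h n *\<^sub>R partial i u y) - (u (y + 0 *\<^sub>R ei) - 0 *\<^sub>R partial i u y)) \<le> e * h n"
      proof (rule norm_difference_bound)
        fix t assume t: "0 \<le> t" "t \<le> h n"
        show "((\<lambda>t. u (y + t *\<^sub>R ei) - t *\<^sub>R partial i u y) has_vector_derivative
            partial i u (y + t *\<^sub>R ei) - 1 *\<^sub>R partial i u y) (at t)"
          unfolding ei_def
          by (rule has_vector_derivative_diff[OF line_deriv_at[OF smooth_line_deriv[OF u]]
              bounded_linear.has_vector_derivative[OF bounded_linear_scaleR_left has_vector_derivative_id]])
        have "dist y (y + t *\<^sub>R ei) = t" using t norm by (simp add: dist_norm)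
        moreover have "dist x (y + t *\<^sub>R ei) \<le> dist x y + dist y (y + t *\<^sub>R ei)" by (rule dist_triangle)
        ultimately have "y \<in> cball x 2" "y + t *\<^sub>R ei \<in> cball x 2" "dist (y + t *\<^sub>R ei) y < \<delta>"
          using t hn h(2)[of n] \<open>dist x y \<le> 1\<close> unfolding mem_cball dist_commute[of "y + t *\<^sub>R ei"] by linarith+
        from \<delta>(2)[OF this] show "cmod (partial i u (y + t *\<^sub>R ei) - 1 *\<^sub>R partial i u y) \<le> e"
          by (simp add: dist_norm)
      qed (use h(1)[of n] in simp)
      then have "real (Suc n) * cmod (u (y + h n *\<^sub>R ei) - u y - h n *\<^sub>R partial i u y) \<le> real (Suc n) * (e * h n)"
        by (intro mult_left_mono) (simp_all add: diff_diff_eq add.commute)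
      also have "\<dots> = e" using h(3)[of n] by (simp only: mult_ac)
      also have "real (Suc n) * cmod (u (y + h n *\<^sub>R ei) - u y - h n *\<^sub>R partial i u y)
          = cmod (real (Suc n) *\<^sub>R (u (y + h n *\<^sub>R ei) - u y - h n *\<^sub>R partial i u y))"
        by (simp only: norm_scaleR abs_of_nat)
      also have "real (Suc n) *\<^sub>R (u (y + h n *\<^sub>R ei) - u y - h n *\<^sub>R partial i u y) = q' n s - g' s"
        unfolding scaleR_diff_right[of _ _ "h n *\<^sub>R partial i u y"] scaleR_scaleR h(3)
        by (simp add: q'_def g'_def y_def add_ac)
      finally have "norm k * cmod (q' n s - g' s) \<le> norm k * e" by (intro mult_left_mono) auto
      then show "norm (k *\<^sub>R q' n s - k *\<^sub>R g' s) \<le> e * norm k"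
        by (simp add: scaleR_diff_right[symmetric] mult.commute)
    qed
  qed
  have "\<exists>g. \<forall>s\<in>{-1..1}. (\<lambda>n. q n s) \<longlonglongrightarrow> g s \<and> (g has_derivative (\<lambda>k. k *\<^sub>R g' s)) (at s within {-1..1})"
  proof (rule has_derivative_sequence[of "{-1..1}" q "\<lambda>n s k. k *\<^sub>R q' n s" "\<lambda>s k. k *\<^sub>R g' s" 0 "partial i f x"])
    show "(q n has_derivative (\<lambda>k. k *\<^sub>R q' n s)) (at s within {-1..1})" for n s
      using q[of n s] unfolding has_vector_derivative_def by (rule has_derivative_at_withinI)
  qed (use unif q_lim[of 0] in auto)
  then obtain g where g: "\<And>s. s \<in> {-1..1} \<Longrightarrow> (\<lambda>n. q n s) \<longlonglongrightarrow> g s"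
    "\<And>s. s \<in> {-1..1} \<Longrightarrow> (g has_derivative (\<lambda>k. k *\<^sub>R g' s)) (at s within {-1..1})" by blast
  have g_eq: "g s = partial i f (x + s *\<^sub>R ej)" if "s \<in> {-1..1}" for s
    using LIMSEQ_unique[OF g(1)[OF that] q_lim] .
  have "(g has_derivative (\<lambda>k. k *\<^sub>R g' 0)) (at 0)"
    using g(2)[of 0] at_within_interior[of 0 "{-1..1::real}"] by simp
  then have "((\<lambda>s. partial i f (x + s *\<^sub>R ej)) has_derivative (\<lambda>k. k *\<^sub>R g' 0)) (at 0)"
    by (rule has_derivative_transform_within_open[of _ _ _ _ "{-1<..<1}"]) (use g_eq in auto)
  then have "line_deriv j (partial i f) x (g' 0)"
    by (simp add: has_vector_derivative_def ej_def)
  from partial_eqI[OF this] show ?thesis by (simp add: g'_def u_def)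
qed

section \<open>Radial integrals\<close>

text \<open>Polar coordinates without a surface measure: the image of Lebesgue measure under the
  norm and the measure with density 4 pi r^2 both give (4/3) pi a^3 to {..a}, by the volume of a
  ball, and such half-lines determine the measure.\<close>

lemma nn_integral_radial:
  assumes F [measurable]: "F \<in> borel_measurable borel"
  shows "(\<integral>\<^sup>+(x::real^3). F (norm x) \<partial>lborel) = (\<integral>\<^sup>+r. F r * (ennreal (4 * pi * r\<^sup>2) * indicator {0..} r) \<partial>lborel)"
proof -
  define M where "M = distr lborel borel (norm :: real^3 \<Rightarrow> real)"
  define N where "N = density lborel (\<lambda>r::real. ennreal (4 * pi * r\<^sup>2) * indicator {0..} r)"
  have M_atMost: "emeasure M {..a} = (if 0 \<le> a then ennreal (4 / 3 * pi * a^3) else 0)" for a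
  proof -
    have "emeasure M {..a} = emeasure lborel {x::real^3. norm x \<le> a}"
      unfolding M_def by (subst emeasure_distr) (auto intro!: arg_cong[where f="emeasure lborel"])
    also have "{x::real^3. norm x \<le> a} = cball 0 a" by (auto simp: dist_norm)
    also have "emeasure lborel (cball (0::real^3) a) = (if 0 \<le> a then ennreal (4 / 3 * pi * a^3) else 0)"
      by (auto simp: emeasure_cball unit_ball_vol_3)
    finally show ?thesis .
  qed
  have N_atMost: "emeasure N {..a} = (if 0 \<le> a then ennreal (4 / 3 * pi * a^3) else 0)" for a
  proof (cases "0 \<le> a")
    case True
    have "emeasure N {..a} = (\<integral>\<^sup>+r. ennreal (4 * pi * r\<^sup>2) * indicator {0..a} r \<partial>lborel)"
      unfolding N_def by (subst emeasure_density) (auto intro!: nn_integral_cong simp: indicator_def)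
    also have "\<dots> = ennreal (4 / 3 * pi * a^3 - 4 / 3 * pi * 0^3)"
      by (rule nn_integral_FTC_Icc) (auto intro!: derivative_eq_intros simp: True power2_eq_square)
    finally show ?thesis using True by simp
  next
    case False
    then have "(\<lambda>r. ennreal (4 * pi * r\<^sup>2) * indicator {0..} r * indicator {..a} r) = (\<lambda>r. 0)"
      by (auto simp: indicator_def fun_eq_iff)
    then show ?thesis using False unfolding N_def by (simp add: emeasure_density)
  qed
  have "M = N"
  proof (rule measure_eqI_generator_eq)
    show "Int_stable (range (\<lambda>a::real. {..a}))"
      by (auto simp: Int_stable_def image_iff intro!: exI[of _ "min _ _"])
    show "sets M = sigma_sets UNIV (range (\<lambda>a::real. {..a}))"
      "sets N = sigma_sets UNIV (range (\<lambda>a::real. {..a}))"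
      unfolding M_def N_def by (simp_all add: borel_eq_atMost)
    show "(\<Union>i. {..real i}) = UNIV" using real_arch_simple by auto
  qed (auto simp: M_atMost N_atMost)
  have "(\<integral>\<^sup>+(x::real^3). F (norm x) \<partial>lborel) = (\<integral>\<^sup>+r. F r \<partial>M)"
    unfolding M_def by (simp add: nn_integral_distr)
  also have "\<dots> = (\<integral>\<^sup>+r. F r * (ennreal (4 * pi * r\<^sup>2) * indicator {0..} r) \<partial>lborel)"
    unfolding \<open>M = N\<close> N_def by (subst nn_integral_density) (auto simp: mult.commute)
  finally show ?thesis .
qed

section \<open>Majorants with a singularity at the origin\<close>

lemma le_exp_self: "r \<le> exp (r::real)"
  using exp_ge_add_one_self[of r] by linarith

text \<open>The density r^2 of polar coordinates cancels the singularity and leaves an exponential.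
  This one majorant serves for |G|, for |G|^2 and for compactly supported functions of size 1/|x| or
  1/|x|^2.\<close>

lemma integrable_exp_over_norm_sq:
  assumes b: "0 < b"
  shows "integrable lborel (\<lambda>x::real^3. exp (- b * norm x) / (norm x)\<^sup>2)"
proof (rule integrableI_bounded)
  have "(\<integral>\<^sup>+(x::real^3). ennreal (norm (exp (- b * norm x) / (norm x)\<^sup>2)) \<partial>lborel)
      = (\<integral>\<^sup>+r. ennreal (exp (- b * r) / r\<^sup>2) * (ennreal (4 * pi * r\<^sup>2) * indicator {0..} r) \<partial>lborel)"
    using nn_integral_radial[of "\<lambda>r. ennreal (exp (- b * r) / r\<^sup>2)"] by simp
  also have "\<dots> \<le> (\<integral>\<^sup>+r. ennreal (4 * pi * exp (- b * r)) * indicator {0..} r \<partial>lborel)"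
    by (intro nn_integral_mono)
       (auto simp: indicator_def ennreal_mult[symmetric] intro!: ennreal_leI)
  also have "\<dots> = ennreal (0 - (- 4 * pi / b * exp (- b * 0)))"
  proof (rule nn_integral_FTC_atLeast)
    have "((\<lambda>r. exp (- (b * r))) \<longlongrightarrow> 0) at_top"
      using b by (intro filterlim_compose[OF exp_at_bot])
        (auto simp: filterlim_uminus_at_bot intro!: filterlim_tendsto_pos_mult_at_top filterlim_ident)
    from tendsto_mult_right_zero[OF this, of "- 4 * pi / b"]
    show "((\<lambda>r. - 4 * pi / b * exp (- b * r)) \<longlongrightarrow> 0) at_top" by simp
  qed (use b in \<open>auto intro!: derivative_eq_intros\<close>)
  also have "\<dots> < \<infinity>" by simp
  finally show "(\<integral>\<^sup>+(x::real^3). ennreal (norm (exp (- b * norm x) / (norm x)\<^sup>2)) \<partial>lborel) < \<infinity>" .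
qed measurable

text \<open>The factor exp R outweighs the exponential decay on the ball of radius R. Since division
  by zero gives 0, the bound at the origin says f 0 = 0, which holds for functions written with a
  factor 1/|x|.\<close>

lemma integrable_bounded_over_norm_sq:
  fixes f :: "real^3 \<Rightarrow> 'a::{banach,second_countable_topology}"
  assumes [measurable]: "f \<in> borel_measurable borel"
    and f: "\<And>x. norm (f x) \<le> C / (norm x)\<^sup>2" and supp: "\<And>x. R < norm x \<Longrightarrow> f x = 0" and C: "0 \<le> C"
  shows "integrable lborel f"
proof -
  have "integrable lborel (\<lambda>x::real^3. C * exp R * (exp (- 1 * norm x) / (norm x)\<^sup>2))"
    by (intro integrable_mult_right integrable_exp_over_norm_sq) simp
  then show ?thesis
  proof (rule Bochner_Integration.integrable_bound; (intro AE_I2)?)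
    fix x
    show "norm (f x) \<le> norm (C * exp R * (exp (- 1 * norm x) / (norm x)\<^sup>2))"
    proof (cases "R < norm x")
      case False
      then have "1 \<le> exp R * exp (- 1 * norm x)" by (simp add: exp_minus field_simps)
      then have "C / (norm x)\<^sup>2 * 1 \<le> C / (norm x)\<^sup>2 * (exp R * exp (- 1 * norm x))"
        using C by (intro mult_left_mono) auto
      also have "\<dots> = norm (C * exp R * (exp (- 1 * norm x) / (norm x)\<^sup>2))"
        using C by (simp add: norm_mult)
      finally show ?thesis using f[of x] by simp
    qed (use supp C in simp)
  qed simp
qed

lemma integrable_bounded_over_norm:
  fixes f :: "real^3 \<Rightarrow> 'a::{banach,second_countable_topology}"
  assumes [measurable]: "f \<in> borel_measurable borel"
    and f: "\<And>x. norm (f x) \<le> C / norm x" and supp: "\<And>x. R < norm x \<Longrightarrow> f x = 0" and C: "0 \<le> C"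
  shows "integrable lborel f"
proof (rule integrable_bounded_over_norm_sq[where C="C * max R 0" and R=R])
  fix x
  show "norm (f x) \<le> C * max R 0 / (norm x)\<^sup>2"
  proof (cases "R < norm x \<or> x = 0")
    case False
    then have "C / norm x = C * norm x / (norm x)\<^sup>2" by (simp add: power2_eq_square)
    also have "\<dots> \<le> C * max R 0 / (norm x)\<^sup>2"
      using False C by (intro divide_right_mono mult_left_mono) auto
    finally show ?thesis using f[of x] by linarith
  qed (use supp C f[of 0] in auto)
qed (use C supp in auto)

text \<open>\<open>r\<^sup>3 (1 + r\<^sup>2)\<^sup>-\<^sup>3\<^sup>/\<^sup>2\<close> is a primitive of \<open>3 r\<^sup>2 (1 + r\<^sup>2)\<^sup>-\<^sup>5\<^sup>/\<^sup>2\<close>.\<close>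

lemma nn_integral_kernel:
  "(\<integral>\<^sup>+(x::real^3). ennreal (3 / (4 * pi * sqrt (1 + (norm x)\<^sup>2) ^ 5)) \<partial>lborel) = 1"
proof -
  have "(\<integral>\<^sup>+(x::real^3). ennreal (3 / (4 * pi * sqrt (1 + (norm x)\<^sup>2) ^ 5)) \<partial>lborel)
     = (\<integral>\<^sup>+r. ennreal (3 / (4 * pi * sqrt (1 + r\<^sup>2) ^ 5)) * (ennreal (4 * pi * r\<^sup>2) * indicator {0..} r) \<partial>lborel)"
    using nn_integral_radial[of "\<lambda>r. ennreal (3 / (4 * pi * sqrt (1 + r\<^sup>2) ^ 5))"] by simp
  also have "\<dots> = (\<integral>\<^sup>+r. ennreal (3 * r\<^sup>2 / sqrt (1 + r\<^sup>2) ^ 5) * indicator {0..} r \<partial>lborel)"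
    by (intro nn_integral_cong) (auto simp: indicator_def ennreal_mult[symmetric])
  also have "\<dots> = ennreal (1 - 0 ^ 3 / sqrt (1 + 0\<^sup>2) ^ 3)"
  proof (rule nn_integral_FTC_atLeast)
    fix r :: real
    define s where "s = sqrt (1 + r\<^sup>2)"
    have s: "0 < s" "s\<^sup>2 = 1 + r\<^sup>2" "0 < 1 + r\<^sup>2" by (auto simp: s_def add_pos_nonneg)
    have "((\<lambda>r. sqrt (1 + r\<^sup>2)) has_field_derivative r / s) (at r)"
      using s by (auto intro!: derivative_eq_intros simp: s_def[symmetric] divide_simps)
    then have "((\<lambda>r. r ^ 3 / sqrt (1 + r\<^sup>2) ^ 3) has_field_derivative
        (3 * r\<^sup>2 * s ^ 3 - r ^ 3 * (3 * s\<^sup>2 * (r / s))) / (s ^ 3 * s ^ 3)) (at r)"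
      using s by (auto intro!: derivative_eq_intros simp: s_def[symmetric]) (simp add: field_simps)
    moreover have "(3 * r\<^sup>2 * s ^ 3 - r ^ 3 * (3 * s\<^sup>2 * (r / s))) / (s ^ 3 * s ^ 3) = 3 * r\<^sup>2 * (s\<^sup>2 - r\<^sup>2) / s ^ 5"
      using s(1) by (simp add: field_simps eval_nat_numeral)
    ultimately show "((\<lambda>r. r ^ 3 / sqrt (1 + r\<^sup>2) ^ 3) has_field_derivative 3 * r\<^sup>2 / sqrt (1 + r\<^sup>2) ^ 5) (at r)"
      using s by (simp add: s_def)
  next
    have "((\<lambda>r::real. 1 / sqrt (1 + (inverse r)\<^sup>2) ^ 3) \<longlongrightarrow> 1 / sqrt (1 + 0\<^sup>2) ^ 3) at_top"
      by (intro tendsto_intros tendsto_inverse_0_at_top filterlim_ident) auto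
    moreover have "\<forall>\<^sub>F r::real in at_top. 1 / sqrt (1 + (inverse r)\<^sup>2) ^ 3 = r ^ 3 / sqrt (1 + r\<^sup>2) ^ 3"
      using eventually_gt_at_top[of 0]
    proof eventually_elim
      fix r :: real assume r: "0 < r"
      have "1 + (inverse r)\<^sup>2 = (1 + r\<^sup>2) / r\<^sup>2" using r by (simp add: field_simps)
      then have "sqrt (1 + (inverse r)\<^sup>2) = sqrt (1 + r\<^sup>2) / r" using r by (simp add: real_sqrt_divide)
      then show "1 / sqrt (1 + (inverse r)\<^sup>2) ^ 3 = r ^ 3 / sqrt (1 + r\<^sup>2) ^ 3"
        by (simp add: power_divide)
    qed
    ultimately show "((\<lambda>r::real. r ^ 3 / sqrt (1 + r\<^sup>2) ^ 3) \<longlongrightarrow> 1) at_top"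
      by (simp add: Lim_transform_eventually)
  qed auto
  finally show ?thesis by simp
qed

lemma
  shows integrable_kernel: "integrable lborel (\<lambda>x::real^3. 3 / (4 * pi * sqrt (1 + (norm x)\<^sup>2) ^ 5))"
    and integral_kernel: "(\<integral>(x::real^3). 3 / (4 * pi * sqrt (1 + (norm x)\<^sup>2) ^ 5) \<partial>lborel) = 1"
proof -
  show "integrable lborel (\<lambda>x::real^3. 3 / (4 * pi * sqrt (1 + (norm x)\<^sup>2) ^ 5))"
    by (rule integrableI_nn_integral_finite[where x=1]) (auto simp: nn_integral_kernel)
  show "(\<integral>(x::real^3). 3 / (4 * pi * sqrt (1 + (norm x)\<^sup>2) ^ 5) \<partial>lborel) = 1"
    by (rule integral_eq_nn_integral[THEN trans]) (auto simp: nn_integral_kernel)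
qed

section \<open>The Green function of the Helmholtz operator\<close>

text \<open>By the convention on division the value at the origin is 0. For \<open>l = 0\<close>
  this is the Newton kernel 1 / (4 pi |x|).\<close>

definition green :: "complex \<Rightarrow> real^3 \<Rightarrow> complex" where
  "green l x = exp (\<i> * l * of_real (norm x)) / of_real (4 * pi * norm x)"

definition helmholtz :: "complex \<Rightarrow> (real^3 \<Rightarrow> complex) \<Rightarrow> real^3 \<Rightarrow> complex" where
  "helmholtz l \<phi> x = (\<Sum>i\<in>UNIV. partials [i, i] \<phi> x) + l\<^sup>2 * \<phi> x"

lemma green_measurable [measurable]: "green l \<in> borel_measurable borel"
  unfolding green_def[abs_def] by measurable

lemma green_even: "green l (- x) = green l x"
  by (simp add: green_def)

lemma norm_exp_il: "cmod (exp (\<i> * l * of_real r)) = exp (- Im l * r)"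
  by (simp add: norm_exp_eq_Re)

lemma norm_green: "cmod (green l x) = exp (- Im l * norm x) / (4 * pi * norm x)"
  by (simp add: green_def norm_divide norm_exp_il norm_mult)

lemma green_integrable:
  assumes l: "0 < Im l"
  shows "integrable lborel (green l)"
proof -
  \<comment> \<open>Half of the exponential decay pays for the factor |x| that turns 1/|x| into
    1/|x|^2: b |x| exp (- 2 b |x|) <= exp (- b |x|).\<close>
  define b where "b = Im l / 2"
  have b: "0 < b" "Im l = 2 * b" using l by (auto simp: b_def)
  have "integrable lborel (\<lambda>x::real^3. 1 / (4 * pi * b) * (exp (- b * norm x) / (norm x)\<^sup>2))"
    by (intro integrable_mult_right integrable_exp_over_norm_sq b)
  then show ?thesis
  proof (rule Bochner_Integration.integrable_bound; (intro AE_I2)?)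
    fix x :: "real^3"
    have "b * norm x * exp (- Im l * norm x) \<le> exp (b * norm x) * exp (- Im l * norm x)"
      by (intro mult_right_mono le_exp_self) auto
    also have "\<dots> = exp (- b * norm x)" by (simp add: b mult_exp_exp)
    finally have "exp (- Im l * norm x) * norm x \<le> exp (- b * norm x) / b" using b by (simp add: field_simps)
    then have "exp (- Im l * norm x) * norm x / (4 * pi * (norm x)\<^sup>2) \<le> exp (- b * norm x) / b / (4 * pi * (norm x)\<^sup>2)"
      by (intro divide_right_mono) auto
    then show "norm (green l x) \<le> norm (1 / (4 * pi * b) * (exp (- b * norm x) / (norm x)\<^sup>2))"
      using b by (cases "x = 0") (auto simp: norm_green power2_eq_square mult_ac)
  qed simp
qed

lemma green_L2:
  assumes l: "0 < Im l"
  shows "green l \<in> L2"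
proof -
  have "integrable lborel (\<lambda>x::real^3. 1 / (16 * pi\<^sup>2) * (exp (- (2 * Im l) * norm x) / (norm x)\<^sup>2))"
    using l by (intro integrable_mult_right integrable_exp_over_norm_sq) auto
  moreover have "(\<lambda>x::real^3. 1 / (16 * pi\<^sup>2) * (exp (- (2 * Im l) * norm x) / (norm x)\<^sup>2)) = (\<lambda>x. (cmod (green l x))\<^sup>2)"
    by (auto simp: norm_green power_divide power_mult_distrib exp_double[symmetric] mult_ac)
  ultimately show ?thesis by (simp add: L2_iff)
qed

text \<open>A single chain rule for two uses: e > 0 for the regularised radius, and e = 0 with x
  nonzero for |x| itself.\<close>

lemma line_deriv_radial:
  assumes pos: "0 < (norm x)\<^sup>2 + e\<^sup>2" and k: "(k has_vector_derivative k') (at (sqrt ((norm x)\<^sup>2 + e\<^sup>2)))"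
  shows "line_deriv i (\<lambda>x. k (sqrt ((norm x)\<^sup>2 + e\<^sup>2))) x ((x $ i / sqrt ((norm x)\<^sup>2 + e\<^sup>2)) *\<^sub>R k')"
proof -
  have sq: "(norm (x + t *\<^sub>R axis i 1))\<^sup>2 = (norm x)\<^sup>2 + 2 * t * x $ i + t\<^sup>2" for t :: real
    unfolding power2_norm_eq_inner
    by (simp add: inner_add_left inner_add_right inner_axis inner_commute[of "axis i 1" x] power2_eq_square algebra_simps)
  have "((\<lambda>t. sqrt ((norm (x + t *\<^sub>R axis i 1))\<^sup>2 + e\<^sup>2)) has_field_derivative (x $ i / sqrt ((norm x)\<^sup>2 + e\<^sup>2))) (at 0)"
    unfolding sq using pos by (auto intro!: derivative_eq_intros simp: field_simps)
  then have "((\<lambda>t. sqrt ((norm (x + t *\<^sub>R axis i 1))\<^sup>2 + e\<^sup>2)) has_vector_derivative (x $ i / sqrt ((norm x)\<^sup>2 + e\<^sup>2))) (at 0)"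
    by (simp add: has_real_derivative_iff_has_vector_derivative)
  moreover have "(k has_vector_derivative k') (at (sqrt ((norm (x + 0 *\<^sub>R axis i 1))\<^sup>2 + e\<^sup>2)))"
    using k by simp
  ultimately show ?thesis
    by (rule vector_diff_chain_at[unfolded o_def])
qed

lemma line_deriv_component: "line_deriv i (\<lambda>x. of_real (x $ i)) x 1"
proof -
  have "((\<lambda>t. of_real (x $ i + t) :: complex) has_vector_derivative 1) (at 0)"
    using bounded_linear.has_vector_derivative[OF bounded_linear_of_real, of "\<lambda>t. x $ i + t" 1 "at 0"]
    by (auto intro!: derivative_eq_intros)
  then show ?thesis by (simp add: axis_def)
qed

lemma sum_component_sq: "(\<Sum>i\<in>UNIV. (x $ i)\<^sup>2) = (norm (x::real^3))\<^sup>2"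
  unfolding power2_norm_eq_inner inner_vec_def by (simp add: power2_eq_square)

text \<open>The profile is the factor by which the error term of \<open>green_regularised\<close>
  differs from a rescaled fixed kernel; the bound yields a majorant uniform in e. Each power of s is
  absorbed by half of the decay at the price 1/b, and for l = 0 the profile is the constant
  3.\<close>

lemma helmholtz_profile_bound:
  assumes l: "0 < Im l \<or> l = 0"
  obtains B where "0 < B"
    "\<And>s. 0 \<le> s \<Longrightarrow> cmod ((3 - 3 * \<i> * l * of_real s - l\<^sup>2 * (of_real s)\<^sup>2) * exp (\<i> * l * of_real s)) \<le> B"
proof (cases "l = 0")
  case True
  then show ?thesis using that[of 3] by simp
next
  case False
  define b where "b = Im l / 2"
  have b: "0 < b" "Im l = 2 * b" using l False by (auto simp: b_def)
  define c where "c = cmod l"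
  have c: "0 \<le> c" by (simp add: c_def)
  show ?thesis
  proof (rule that[of "3 + 3 * c / b + (c / b)\<^sup>2"])
    show "0 < 3 + 3 * c / b + (c / b)\<^sup>2" using b c by (auto intro!: add_pos_nonneg)
    fix s :: real assume s: "0 \<le> s"
    have E: "exp (- Im l * s) = exp (- b * s) * exp (- b * s)" by (simp add: b mult_exp_exp)
    have e1: "exp (- b * s) \<le> 1" using b s by simp
    have "b * s * exp (- b * s) \<le> exp (b * s) * exp (- b * s)" by (intro mult_right_mono le_exp_self) auto
    then have e2: "s * exp (- b * s) \<le> 1 / b" using b by (simp add: mult_exp_exp field_simps)
    have "cmod (3 - 3 * \<i> * l * of_real s - l\<^sup>2 * (of_real s)\<^sup>2) \<le> cmod (3 - 3 * \<i> * l * of_real s) + cmod (l\<^sup>2 * (of_real s)\<^sup>2)"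
      by (rule norm_triangle_ineq4)
    also have "\<dots> \<le> (cmod 3 + cmod (3 * \<i> * l * of_real s)) + cmod (l\<^sup>2 * (of_real s)\<^sup>2)"
      by (intro add_right_mono norm_triangle_ineq4)
    also have "\<dots> = 3 + 3 * c * s + c\<^sup>2 * s\<^sup>2"
      using s by (simp add: norm_mult norm_power c_def power_mult_distrib)
    finally have "cmod ((3 - 3 * \<i> * l * of_real s - l\<^sup>2 * (of_real s)\<^sup>2) * exp (\<i> * l * of_real s))
      \<le> (3 + 3 * c * s + c\<^sup>2 * s\<^sup>2) * (exp (- b * s) * exp (- b * s))"
      unfolding norm_mult norm_exp_il E by (intro mult_right_mono) auto
    also have "\<dots> = 3 * (exp (- b * s) * exp (- b * s)) + 3 * c * ((s * exp (- b * s)) * exp (- b * s)) + c\<^sup>2 * ((s * exp (- b * s)) * (s * exp (- b * s)))"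
      by (simp add: algebra_simps power2_eq_square)
    also have "\<dots> \<le> 3 * (1 * 1) + 3 * c * (1 / b * 1) + c\<^sup>2 * (1 / b * (1 / b))"
      using e1 e2 b c s by (intro add_mono mult_left_mono mult_mono) auto
    finally show "cmod ((3 - 3 * \<i> * l * of_real s - l\<^sup>2 * (of_real s)\<^sup>2) * exp (\<i> * l * of_real s)) \<le> 3 + 3 * c / b + (c / b)\<^sup>2"
      by (simp add: power2_eq_square)
  qed
qed

lemma compactly_supported_mult:
  fixes f g :: "real^3 \<Rightarrow> complex"
  assumes "continuous_on UNIV f" "g \<in> test_functions U"
  shows "integrable lborel (\<lambda>x. f x * g x)" "continuous_on UNIV (\<lambda>x. f x * g x)" "bounded {x. f x * g x \<noteq> 0}"
proof -
  show c: "continuous_on UNIV (\<lambda>x. f x * g x)"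
    by (intro continuous_intros assms test_continuous[OF assms(2)])
  show b: "bounded {x. f x * g x \<noteq> 0}"
    by (rule bounded_subset[OF test_bounded_support[OF assms(2)]]) auto
  show "integrable lborel (\<lambda>x. f x * g x)" by (rule compactly_supported_integrable[OF c b])
qed

lemma helmholtz_test: "\<phi> \<in> test_functions U \<Longrightarrow> helmholtz l \<phi> \<in> test_functions U"
proof -
  assume \<phi>: "\<phi> \<in> test_functions U"
  have "(\<lambda>x. \<Sum>i\<in>I. partials [i, i] \<phi> x) \<in> test_functions U" if "finite I" for I
    using that by (induction I) (simp_all add: test_zero test_add test_partial \<phi>)
  then show ?thesis unfolding helmholtz_def[abs_def] by (intro test_add test_scale \<phi>) simp
qed

text \<open>With \<open>s = sqrt (\<bar>x\<bar>\<^sup>2 + e\<^sup>2)\<close> in place of \<open>\<bar>x\<bar>\<close> the Green function is smooth, and the radial equation leaves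
  only a multiple of \<open>e\<^sup>2\<close>, which is an approximate identity as \<open>e \<rightarrow> 0\<close>.\<close>

lemma green_regularised:
  assumes e: "0 < e" and \<phi>: "\<phi> \<in> test_functions UNIV"
  defines "s \<equiv> \<lambda>x::real^3. sqrt ((norm x)\<^sup>2 + e\<^sup>2)"
  shows "(\<integral>x. exp (\<i> * l * of_real (s x)) / of_real (4 * pi * s x) * helmholtz l \<phi> x \<partial>lborel)
    = - (\<integral>x. of_real (e\<^sup>2) * ((3 - 3 * \<i> * l * of_real (s x) - l\<^sup>2 * (of_real (s x))\<^sup>2) * exp (\<i> * l * of_real (s x)))
             / of_real (4 * pi * s x ^ 5) * \<phi> x \<partial>lborel)"
proof -
  have pos: "0 < (norm x)\<^sup>2 + e\<^sup>2" for x :: "real^3" using e by (simp add: add_nonneg_pos)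
  have s: "0 < s x" "(s x)\<^sup>2 = (norm x)\<^sup>2 + e\<^sup>2" for x using e by (auto simp: s_def add_nonneg_pos)
  have s0: "s x \<noteq> 0" for x using s(1)[of x] by simp
  have s_cont: "continuous_on UNIV s" unfolding s_def by (intro continuous_intros)
  define h where "h t = exp (\<i> * l * of_real t) / of_real (4 * pi * t)" for t :: real
  define h' where "h' t = (\<i> * l * of_real t - 1) * exp (\<i> * l * of_real t) / (of_real (4 * pi) * (of_real t)^2)" for t :: real
  \<comment> \<open>k is h' divided by t. As s has i-th derivative x_i / s, the gradient of h(s) is
    the vector field x k(s), and \<open>D i\<close> below is the i-th derivative of its i-th
    component.\<close>
  define k where "k t = (\<i> * l * of_real t - 1) * exp (\<i> * l * of_real t) / (of_real (4 * pi) * (of_real t)^3)" for t :: real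
  define k' where "k' t = (3 - 3 * \<i> * l * of_real t - l\<^sup>2 * (of_real t)\<^sup>2) * exp (\<i> * l * of_real t) / (of_real (4 * pi) * (of_real t)^4)" for t :: real
  have h: "(h has_vector_derivative h' t) (at t)" if "0 < t" for t
  proof -
    have "((\<lambda>z. exp (\<i> * l * z) / (of_real (4 * pi) * z)) has_field_derivative h' t) (at (of_real t))"
      using that unfolding h'_def
      by (auto intro!: derivative_eq_intros) (simp add: field_simps power2_eq_square)
    from has_vector_derivative_real_field[OF this] show ?thesis by (simp add: h_def[abs_def])
  qed
  have k: "(k has_vector_derivative k' t) (at t)" if "0 < t" for t
  proof -
    have "((\<lambda>z. (\<i> * l * z - 1) * exp (\<i> * l * z) / (of_real (4 * pi) * z^3)) has_field_derivative k' t) (at (of_real t))"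
      using that unfolding k'_def
      by (auto intro!: derivative_eq_intros) (simp add: field_simps eval_nat_numeral)
    from has_vector_derivative_real_field[OF this] show ?thesis by (simp add: k_def[abs_def])
  qed
  have hk: "h' t = of_real t * k t" if "0 < t" for t
    using that by (simp add: h'_def k_def eval_nat_numeral)
  have c: "continuous_on UNIV (\<lambda>x. h (s x))" "continuous_on UNIV (\<lambda>x. k (s x))" "continuous_on UNIV (\<lambda>x. k' (s x))"
    unfolding h_def k_def k'_def by (intro continuous_intros s_cont; simp add: s0)+
  define D where "D i x = of_real (x $ i) * ((x $ i / s x) *\<^sub>R k' (s x)) + 1 * k (s x)" for i x
  have D_cont: "continuous_on UNIV (D i)" for i
    unfolding D_def[abs_def] by (intro continuous_intros s_cont c) (simp add: s0)
  have kl: "line_deriv i (\<lambda>x. of_real (x $ i) * k (s x)) x (D i x)" for i x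
    unfolding D_def s_def
    by (intro line_deriv_mult line_deriv_component line_deriv_radial pos k) (use s(1)[of x] in \<open>simp add: s_def\<close>)
  have hl: "line_deriv i (\<lambda>x. h (s x)) x (of_real (x $ i) * k (s x))" for i x
  proof -
    have "line_deriv i (\<lambda>x. h (s x)) x ((x $ i / s x) *\<^sub>R h' (s x))"
      unfolding s_def by (intro line_deriv_radial pos h) (use s(1)[of x] in \<open>simp add: s_def\<close>)
    moreover have "(x $ i / s x) *\<^sub>R h' (s x) = of_real (x $ i) * k (s x)"
      using s(1)[of x] by (simp add: hk scaleR_conv_of_real)
    ultimately show ?thesis by simp
  qed
  have parts: "(\<integral>x. h (s x) * partials [i, i] \<phi> x \<partial>lborel) = (\<integral>x. D i x * \<phi> x \<partial>lborel)" for i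
  proof -
    note p1 = test_partial[OF \<phi>, of i] note p2 = test_partial[OF p1, of i]
    have xk: "continuous_on UNIV (\<lambda>x. of_real (x $ i) * k (s x))" by (intro continuous_intros c)
    \<comment> \<open>Green's identity: the integrand is the i-th derivative of h(s) times the
      derivative of \<phi> minus x_i k(s) \<phi>; the terms with one derivative on each factor
      cancel.\<close>
    have "(\<integral>x. h (s x) * partials [i, i] \<phi> x - D i x * \<phi> x \<partial>lborel) = 0"
    proof (rule integral_line_deriv_zero)
      show "continuous_on UNIV (\<lambda>x. h (s x) * partial i \<phi> x - of_real (x $ i) * k (s x) * \<phi> x)"
        by (intro continuous_on_diff compactly_supported_mult(2)[OF c(1) p1] compactly_supported_mult(2)[OF xk \<phi>])
      show "bounded {x. h (s x) * partial i \<phi> x - of_real (x $ i) * k (s x) * \<phi> x \<noteq> 0}"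
        by (rule bounded_subset[OF bounded_Un[THEN iffD2, OF conjI, OF test_bounded_support[OF p1] test_bounded_support[OF \<phi>]]]) auto
      show "line_deriv i (\<lambda>x. h (s x) * partial i \<phi> x - of_real (x $ i) * k (s x) * \<phi> x) x
        (h (s x) * partials [i, i] \<phi> x - D i x * \<phi> x)" for x
        using has_vector_derivative_diff[OF
          line_deriv_mult[OF hl[where i=i and x=x] smooth_line_deriv[OF test_smooth[OF p1], where i=i and x=x]]
          line_deriv_mult[OF kl[where i=i and x=x] smooth_line_deriv[OF test_smooth[OF \<phi>], where i=i and x=x]]]
        by simp
      show "continuous_on UNIV (\<lambda>x. h (s x) * partials [i, i] \<phi> x - D i x * \<phi> x)"
        using p2 by (intro continuous_on_diff compactly_supported_mult(2)[OF D_cont \<phi>] compactly_supported_mult(2)[OF c(1)]) auto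
    qed
    moreover have "integrable lborel (\<lambda>x. h (s x) * partials [i, i] \<phi> x)" "integrable lborel (\<lambda>x. D i x * \<phi> x)"
      using p2 by (auto intro!: compactly_supported_mult(1)[OF D_cont \<phi>] compactly_supported_mult(1)[OF c(1)])
    ultimately show ?thesis by simp
  qed
  have int: "integrable lborel (\<lambda>x. h (s x) * partials [i, i] \<phi> x)" "integrable lborel (\<lambda>x. D i x * \<phi> x)"
     "integrable lborel (\<lambda>x. h (s x) * \<phi> x)" for i
    by (rule compactly_supported_mult(1)[OF c(1) test_partials[OF \<phi>]] compactly_supported_mult(1)[OF D_cont \<phi>]
        compactly_supported_mult(1)[OF c(1) \<phi>])+
  have "(\<integral>x. h (s x) * helmholtz l \<phi> x \<partial>lborel)
      = (\<integral>x. (\<Sum>i\<in>UNIV. h (s x) * partials [i, i] \<phi> x) + l\<^sup>2 * (h (s x) * \<phi> x) \<partial>lborel)"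
    unfolding helmholtz_def by (simp add: distrib_left sum_distrib_left mult_ac)
  also have "\<dots> = (\<Sum>i\<in>UNIV. \<integral>x. h (s x) * partials [i, i] \<phi> x \<partial>lborel) + l\<^sup>2 * (\<integral>x. h (s x) * \<phi> x \<partial>lborel)"
    using int by (subst Bochner_Integration.integral_add) (simp_all del: partials.simps)
  also have "\<dots> = (\<Sum>i\<in>UNIV. \<integral>x. D i x * \<phi> x \<partial>lborel) + l\<^sup>2 * (\<integral>x. h (s x) * \<phi> x \<partial>lborel)"
    by (simp only: parts)
  also have "\<dots> = (\<integral>x. (\<Sum>i\<in>UNIV. D i x * \<phi> x) + l\<^sup>2 * (h (s x) * \<phi> x) \<partial>lborel)"
    using int by (subst Bochner_Integration.integral_add) simp_all
  also have "\<dots> = (\<integral>x. - (of_real (e\<^sup>2) * ((3 - 3 * \<i> * l * of_real (s x) - l\<^sup>2 * (of_real (s x))\<^sup>2) * exp (\<i> * l * of_real (s x)))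
             / of_real (4 * pi * s x ^ 5) * \<phi> x) \<partial>lborel)"
  proof (intro Bochner_Integration.integral_cong refl)
    fix x
    define S where "S = complex_of_real (s x)"
    have S: "S \<noteq> 0" using s0[of x] by (simp add: S_def)
    have "(\<Sum>i\<in>UNIV. D i x) = of_real ((norm x)\<^sup>2) * k' (s x) / S + 3 * k (s x)"
    proof -
      have "D i x = of_real ((x $ i)\<^sup>2) * (k' (s x) / S) + k (s x)" for i
        by (simp add: D_def S_def scaleR_conv_of_real power2_eq_square)
      then have "(\<Sum>i\<in>UNIV. D i x) = of_real (\<Sum>i\<in>UNIV. (x $ i)\<^sup>2) * (k' (s x) / S) + of_nat CARD(3) * k (s x)"
        by (simp add: sum.distrib sum_distrib_right sum_divide_distrib)
      then show ?thesis by (simp add: sum_component_sq)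
    qed
    also have "of_real ((norm x)\<^sup>2) = S\<^sup>2 - of_real (e\<^sup>2)"
      using s(2)[of x] by (simp add: S_def flip: of_real_power of_real_diff)
    finally have "(\<Sum>i\<in>UNIV. D i x) + l\<^sup>2 * h (s x) = - (of_real (e\<^sup>2) * k' (s x) / S) + (S * k' (s x) + 3 * k (s x) + l\<^sup>2 * h (s x))"
      using S by (simp add: field_simps power2_eq_square)
    \<comment> \<open>The radial equation h'' + 2 h' / s + l^2 h = 0, rewritten with h' = s k and
      h'' = k + s k'.\<close>
    also have "S * k' (s x) + 3 * k (s x) + l\<^sup>2 * h (s x) = 0"
    proof -
      have "S * k' (s x) = (3 - 3 * \<i> * l * S - l\<^sup>2 * S\<^sup>2) * exp (\<i> * l * S) / (of_real (4 * pi) * S^3)"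
        "3 * k (s x) = (3 * \<i> * l * S - 3) * exp (\<i> * l * S) / (of_real (4 * pi) * S^3)"
        "l\<^sup>2 * h (s x) = (l\<^sup>2 * S\<^sup>2) * exp (\<i> * l * S) / (of_real (4 * pi) * S^3)"
        using S unfolding k'_def k_def h_def S_def[symmetric]
        by (simp_all add: S_def[symmetric] eval_nat_numeral field_simps)
      then show ?thesis
        by (simp add: add_divide_distrib[symmetric] distrib_right[symmetric] del: of_real_mult)
    qed
    also have "of_real (e\<^sup>2) * k' (s x) / S = of_real (e\<^sup>2) * ((3 - 3 * \<i> * l * of_real (s x) - l\<^sup>2 * (of_real (s x))\<^sup>2) * exp (\<i> * l * of_real (s x)))
             / of_real (4 * pi * s x ^ 5)"
      using S unfolding k'_def S_def by (simp add: eval_nat_numeral mult_ac)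
    finally have *: "(\<Sum>i\<in>UNIV. D i x) + l\<^sup>2 * h (s x) = - (of_real (e\<^sup>2) * ((3 - 3 * \<i> * l * of_real (s x) - l\<^sup>2 * (of_real (s x))\<^sup>2) * exp (\<i> * l * of_real (s x)))
             / of_real (4 * pi * s x ^ 5))" by simp
    have "(\<Sum>i\<in>UNIV. D i x * \<phi> x) + l\<^sup>2 * (h (s x) * \<phi> x) = ((\<Sum>i\<in>UNIV. D i x) + l\<^sup>2 * h (s x)) * \<phi> x"
      by (simp add: distrib_right sum_distrib_right mult.assoc)
    then show "(\<Sum>i\<in>UNIV. D i x * \<phi> x) + l\<^sup>2 * (h (s x) * \<phi> x) = - (of_real (e\<^sup>2) * ((3 - 3 * \<i> * l * of_real (s x) - l\<^sup>2 * (of_real (s x))\<^sup>2) * exp (\<i> * l * of_real (s x)))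
             / of_real (4 * pi * s x ^ 5) * \<phi> x)"
      unfolding * by simp
  qed
  finally show ?thesis unfolding h_def by simp
qed

text \<open>The limit e -> 0 of \<open>green_regularised\<close>. On the left 1/|x| dominates the
  kernels on the support. On the right the substitution x = e y turns s into e sqrt (1 + |y|^2), and
  all powers of e cancel; there remains \<phi>(e y) against a fixed kernel times the profile, whose
  value 3 at 0 makes the total mass 1.\<close>

lemma green_fundamental:
  assumes l: "0 < Im l \<or> l = 0" and \<phi>: "\<phi> \<in> test_functions UNIV"
  shows "(\<integral>x. green l x * helmholtz l \<phi> x \<partial>lborel) = - \<phi> 0"
proof -
  define P where "P t = (3 - 3 * \<i> * l * of_real t - l\<^sup>2 * (of_real t)\<^sup>2) * exp (\<i> * l * of_real t)" for t :: real
  obtain B where B: "0 < B" "\<And>t. 0 \<le> t \<Longrightarrow> cmod (P t) \<le> B"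
    using helmholtz_profile_bound[OF l] unfolding P_def by metis
  obtain M where M: "0 < M" "\<And>x. cmod (\<phi> x) \<le> M" using test_bounded[OF \<phi>] by metis
  note h\<phi> = helmholtz_test[OF \<phi>, of l]
  obtain N where N: "0 < N" "\<And>x. cmod (helmholtz l \<phi> x) \<le> N" using test_bounded[OF h\<phi>] by metis
  obtain R where R: "0 < R" "\<And>x. R < norm x \<Longrightarrow> helmholtz l \<phi> x = 0" using test_support[OF h\<phi>] by metis
  note [measurable] = smooth_measurable[OF test_smooth[OF \<phi>]] smooth_measurable[OF test_smooth[OF h\<phi>]]
  define e where "e n = 1 / real (Suc n)" for n
  have e: "0 < e n" for n by (simp add: e_def)
  have e0: "e \<longlonglongrightarrow> 0" unfolding e_def by (rule LIMSEQ_Suc[OF lim_1_over_n])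
  define s where "s n x = sqrt ((norm x)\<^sup>2 + (e n)\<^sup>2)" for n and x :: "real^3"
  define t where "t y = sqrt (1 + (norm y)\<^sup>2)" for y :: "real^3"
  have t: "0 < t y" for y by (simp add: t_def add_pos_nonneg)
  have [measurable]: "P \<in> borel_measurable borel" "t \<in> borel_measurable borel" "s n \<in> borel_measurable borel" for n
    unfolding P_def[abs_def] t_def[abs_def] s_def[abs_def] by measurable
  have "(\<lambda>n. \<integral>x. exp (\<i> * l * of_real (s n x)) / of_real (4 * pi * s n x) * helmholtz l \<phi> x \<partial>lborel)
     \<longlonglongrightarrow> (\<integral>x. green l x * helmholtz l \<phi> x \<partial>lborel)"
  proof (rule integral_dominated_convergence[where w="\<lambda>x. if norm x \<le> R then N / norm x else 0"])
    show "integrable lborel (\<lambda>x::real^3. if norm x \<le> R then N / norm x else 0)"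
      by (rule integrable_bounded_over_norm[where C=N and R=R]) (use N in auto)
    show "AE x in lborel. cmod (exp (\<i> * l * of_real (s n x)) / of_real (4 * pi * s n x) * helmholtz l \<phi> x)
        \<le> (if norm x \<le> R then N / norm x else 0)" for n
      using AE_lborel_singleton[of 0]
    proof eventually_elim
      fix x :: "real^3" assume "x \<noteq> 0"
      show "cmod (exp (\<i> * l * of_real (s n x)) / of_real (4 * pi * s n x) * helmholtz l \<phi> x)
        \<le> (if norm x \<le> R then N / norm x else 0)"
      proof (cases "norm x \<le> R")
        case True
        have s: "norm x \<le> s n x" unfolding s_def by (rule real_le_rsqrt) simp
        have s_nonneg: "0 \<le> s n x" using s norm_ge_zero order_trans by blast
        have x: "0 < norm x" using \<open>x \<noteq> 0\<close> by simp
        have "norm x * 1 \<le> s n x * (4 * pi)"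
          using s s_nonneg pi_gt3 by (intro mult_mono) auto
        then have sx: "norm x \<le> 4 * pi * s n x" by (simp add: mult.commute)
        have "exp (- Im l * s n x) \<le> 1"
          using l s_nonneg by (auto intro!: mult_nonneg_nonneg)
        then have "exp (- Im l * s n x) / (4 * pi * s n x) \<le> 1 / norm x"
          using s x sx by (intro frac_le) auto
        then have "exp (- Im l * s n x) / (4 * pi * s n x) * cmod (helmholtz l \<phi> x) \<le> 1 / norm x * N"
          using N by (intro mult_mono) auto
        then show ?thesis using True s_nonneg by (simp add: norm_mult norm_divide norm_exp_il)
      qed (use R in auto)
    qed
    show "AE x in lborel. (\<lambda>n. exp (\<i> * l * of_real (s n x)) / of_real (4 * pi * s n x) * helmholtz l \<phi> x)
       \<longlonglongrightarrow> green l x * helmholtz l \<phi> x"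
      using AE_lborel_singleton[of 0]
    proof eventually_elim
      fix x :: "real^3" assume "x \<noteq> 0"
      have "(\<lambda>n. s n x) \<longlonglongrightarrow> sqrt ((norm x)\<^sup>2 + 0\<^sup>2)" unfolding s_def by (intro tendsto_intros e0)
      then have "(\<lambda>n. s n x) \<longlonglongrightarrow> norm x" by simp
      then show "(\<lambda>n. exp (\<i> * l * of_real (s n x)) / of_real (4 * pi * s n x) * helmholtz l \<phi> x)
       \<longlonglongrightarrow> green l x * helmholtz l \<phi> x"
        unfolding green_def using \<open>x \<noteq> 0\<close> by (intro tendsto_intros) auto
    qed
  qed measurable
  moreover have "(\<integral>x. exp (\<i> * l * of_real (s n x)) / of_real (4 * pi * s n x) * helmholtz l \<phi> x \<partial>lborel)
      = - (\<integral>y. P (e n * t y) / of_real (4 * pi * t y ^ 5) * \<phi> (e n *\<^sub>R y) \<partial>lborel)" for n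
  proof -
    have "(\<integral>x. exp (\<i> * l * of_real (s n x)) / of_real (4 * pi * s n x) * helmholtz l \<phi> x \<partial>lborel)
      = - (\<integral>x. of_real ((e n)\<^sup>2) * P (s n x) / of_real (4 * pi * s n x ^ 5) * \<phi> x \<partial>lborel)"
      unfolding s_def P_def by (rule green_regularised[OF e \<phi>])
    also have "(\<integral>x. of_real ((e n)\<^sup>2) * P (s n x) / of_real (4 * pi * s n x ^ 5) * \<phi> x \<partial>lborel)
      = (e n) ^ 3 *\<^sub>R (\<integral>y. of_real ((e n)\<^sup>2) * P (s n (e n *\<^sub>R y)) / of_real (4 * pi * s n (e n *\<^sub>R y) ^ 5) * \<phi> (e n *\<^sub>R y) \<partial>lborel)"
      using e[of n] by (subst integral_lborel_affine[where c="e n" and t=0]) auto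
    also have "\<dots> = (\<integral>y. (e n) ^ 3 *\<^sub>R (of_real ((e n)\<^sup>2) * P (s n (e n *\<^sub>R y)) / of_real (4 * pi * s n (e n *\<^sub>R y) ^ 5) * \<phi> (e n *\<^sub>R y)) \<partial>lborel)"
      by simp
    also have "\<dots> = (\<integral>y. P (e n * t y) / of_real (4 * pi * t y ^ 5) * \<phi> (e n *\<^sub>R y) \<partial>lborel)"
    proof (intro Bochner_Integration.integral_cong refl)
      fix y :: "real^3"
      have "(norm (e n *\<^sub>R y))\<^sup>2 + (e n)\<^sup>2 = (e n)\<^sup>2 * (1 + (norm y)\<^sup>2)"
        by (simp add: power_mult_distrib algebra_simps)
      then have "s n (e n *\<^sub>R y) = e n * t y"
        using e[of n] by (simp add: s_def t_def real_sqrt_mult)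
      then show "(e n) ^ 3 *\<^sub>R (of_real ((e n)\<^sup>2) * P (s n (e n *\<^sub>R y)) / of_real (4 * pi * s n (e n *\<^sub>R y) ^ 5) * \<phi> (e n *\<^sub>R y))
        = P (e n * t y) / of_real (4 * pi * t y ^ 5) * \<phi> (e n *\<^sub>R y)"
        using e[of n] t[of y] by (simp add: scaleR_conv_of_real power_mult_distrib field_simps eval_nat_numeral)
    qed
    finally show ?thesis .
  qed
  moreover have "(\<lambda>n. \<integral>y. P (e n * t y) / of_real (4 * pi * t y ^ 5) * \<phi> (e n *\<^sub>R y) \<partial>lborel)
     \<longlonglongrightarrow> (\<integral>y. P 0 / of_real (4 * pi * t y ^ 5) * \<phi> 0 \<partial>lborel)"
  \<comment> \<open>The majorant is phrased with the normalised kernel so that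
    \<open>integrable_kernel\<close> applies; hence the spare factor 3.\<close>
  proof (rule integral_dominated_convergence[where w="\<lambda>y. B * M * (3 / (4 * pi * t y ^ 5))"])
    show "integrable lborel (\<lambda>y::real^3. B * M * (3 / (4 * pi * t y ^ 5)))"
      unfolding t_def by (intro integrable_mult_right integrable_kernel)
    show "AE y in lborel. cmod (P (e n * t y) / of_real (4 * pi * t y ^ 5) * \<phi> (e n *\<^sub>R y)) \<le> B * M * (3 / (4 * pi * t y ^ 5))" for n
    proof (intro AE_I2)
      fix y :: "real^3"
      have "cmod (P (e n * t y)) * cmod (\<phi> (e n *\<^sub>R y)) \<le> B * M"
        using B M e[of n] t[of y] by (intro mult_mono) auto
      then have "cmod (P (e n * t y)) * cmod (\<phi> (e n *\<^sub>R y)) / (4 * pi * t y ^ 5) \<le> B * M / (4 * pi * t y ^ 5)"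
        using t[of y] by (intro divide_right_mono) auto
      moreover have "0 \<le> B * M / (4 * pi * t y ^ 5)" using B M t[of y] by simp
      ultimately have "cmod (P (e n * t y)) * cmod (\<phi> (e n *\<^sub>R y)) / (4 * pi * t y ^ 5) \<le> 3 * (B * M / (4 * pi * t y ^ 5))"
        by linarith
      then show "cmod (P (e n * t y) / of_real (4 * pi * t y ^ 5) * \<phi> (e n *\<^sub>R y)) \<le> B * M * (3 / (4 * pi * t y ^ 5))"
        using t[of y] by (simp add: norm_mult norm_divide norm_power mult_ac)
    qed
    show "AE y in lborel. (\<lambda>n. P (e n * t y) / of_real (4 * pi * t y ^ 5) * \<phi> (e n *\<^sub>R y)) \<longlonglongrightarrow> P 0 / of_real (4 * pi * t y ^ 5) * \<phi> 0"
    proof (intro AE_I2 tendsto_intros)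
      fix y :: "real^3"
      have "isCont P 0" unfolding P_def[abs_def] by (intro continuous_intros)
      moreover have "(\<lambda>n. e n * t y) \<longlonglongrightarrow> 0" using tendsto_mult[OF e0 tendsto_const[of "t y"]] by simp
      ultimately show "(\<lambda>n. P (e n * t y)) \<longlonglongrightarrow> P 0" by (rule isCont_tendsto_compose)
      have "isCont \<phi> 0" using test_continuous[OF \<phi>] by (simp add: continuous_on_eq_continuous_at)
      moreover have "(\<lambda>n. e n *\<^sub>R y) \<longlonglongrightarrow> 0" using tendsto_scaleR[OF e0 tendsto_const[of y]] by simp
      ultimately show "(\<lambda>n. \<phi> (e n *\<^sub>R y)) \<longlonglongrightarrow> \<phi> 0" by (rule isCont_tendsto_compose)
      show "complex_of_real (4 * pi * t y ^ 5) \<noteq> 0" using t[of y] by simp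
    qed
  qed measurable
  moreover have "(\<integral>y. P 0 / of_real (4 * pi * t y ^ 5) * \<phi> 0 \<partial>lborel) = \<phi> 0"
  proof -
    have "(\<integral>y. P 0 / of_real (4 * pi * t y ^ 5) * \<phi> 0 \<partial>lborel) = (\<integral>y. of_real (3 / (4 * pi * t y ^ 5)) * \<phi> 0 \<partial>lborel)"
      by (simp add: P_def)
    also have "\<dots> = of_real (\<integral>y. 3 / (4 * pi * t y ^ 5) \<partial>lborel) * \<phi> 0"
      by (simp only: integral_mult_left_zero integral_complex_of_real)
    finally show ?thesis unfolding t_def by (simp only: integral_kernel) simp
  qed
  ultimately have "(\<lambda>n. - (\<integral>y. P (e n * t y) / of_real (4 * pi * t y ^ 5) * \<phi> (e n *\<^sub>R y) \<partial>lborel)) \<longlonglongrightarrow> (\<integral>x. green l x * helmholtz l \<phi> x \<partial>lborel)"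
    "(\<lambda>n. - (\<integral>y. P (e n * t y) / of_real (4 * pi * t y ^ 5) * \<phi> (e n *\<^sub>R y) \<partial>lborel)) \<longlonglongrightarrow> - \<phi> 0"
    by (auto intro!: tendsto_minus)
  then show ?thesis by (rule LIMSEQ_unique)
qed

section \<open>The Green function as inverse of the Helmholtz operator, in classical and weak
  form\<close>

lemma partials_translate: "smooth f \<Longrightarrow> partials is (\<lambda>x. f (x + a)) = (\<lambda>x. partials is f (x + a))"
  using partials_affine[where a=a and c=1] by (simp add: add.commute)

lemma helmholtz_translate: "smooth f \<Longrightarrow> helmholtz l (\<lambda>x. f (x + a)) = (\<lambda>x. helmholtz l f (x + a))"
  unfolding helmholtz_def[abs_def] by (simp only: partials_translate)

lemma helmholtz_reflect:
  assumes "smooth f"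
  shows "helmholtz l (\<lambda>x. f (a - x)) = (\<lambda>x. helmholtz l f (a - x))"
proof -
  have "partials [i, i] (\<lambda>x. f (a - x)) = (\<lambda>x. partials [i, i] f (a - x))" for i
    using partials_affine[OF assms, of "[i, i]" a "-1"] by simp
  then show ?thesis unfolding helmholtz_def[abs_def] by (simp only:)
qed

lemma test_translate: "f \<in> test_functions UNIV \<Longrightarrow> (\<lambda>x. f (x + a)) \<in> test_functions UNIV"
  using test_affine[where a=a and c=1] by (simp add: add.commute)

lemma test_reflect: "f \<in> test_functions UNIV \<Longrightarrow> (\<lambda>x. f (a - x)) \<in> test_functions UNIV"
  using test_affine[where a=a and c="-1"] by simp

text \<open>This is \<open>green_fundamental\<close> for the test function y -> \<phi>(x - y):
  second derivatives do not change sign under reflection.\<close>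

lemma conv_green_helmholtz:
  assumes l: "0 < Im l" and \<phi>: "\<phi> \<in> test_functions UNIV"
  shows "conv (green l) (helmholtz l \<phi>) x = - \<phi> x"
  using green_fundamental[OF disjI1[OF l] test_reflect[OF \<phi>, of x]]
  by (simp add: conv_def helmholtz_reflect[OF test_smooth[OF \<phi>]])

text \<open>G is even, so convolution with it is its own transpose and can be moved to the side of
  the test function, where it inverts the operator.\<close>

lemma weak_helmholtz_conv_green:
  assumes l: "0 < Im l" and h: "h \<in> L2" and \<phi>: "\<phi> \<in> test_functions UNIV"
  shows "(\<integral>x. conv (green l) h x * helmholtz l \<phi> x \<partial>lborel) = - (\<integral>x. h x * \<phi> x \<partial>lborel)"
  using conv_pairing_even[OF green_integrable[OF l] green_even h test_L2[OF helmholtz_test[OF \<phi>]]]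
  by (simp add: conv_green_helmholtz[OF l \<phi>])

text \<open>Translating the test function turns the weak equation into an identity of convolutions, so no
  test function of non-compact support is needed.\<close>

lemma weak_helmholtz_imp_conv_green:
  assumes l: "0 < Im l" and u: "u \<in> L2" and h: "h \<in> L2"
    and weak: "\<And>\<phi>. \<phi> \<in> test_functions UNIV \<Longrightarrow>
      (\<integral>x. u x * helmholtz l \<phi> x \<partial>lborel) = - (\<integral>x. h x * \<phi> x \<partial>lborel)"
    and \<phi>: "\<phi> \<in> test_functions UNIV"
  shows "(\<integral>x. conv (green l) h x * \<phi> x \<partial>lborel) = (\<integral>x. u x * \<phi> x \<partial>lborel)"
proof -
  note G = green_integrable[OF l]
  have "(\<integral>x. h (x - a) * \<phi> x \<partial>lborel) = - (\<integral>x. u (x - a) * helmholtz l \<phi> x \<partial>lborel)" for a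
  proof -
    note [measurable] = L2_measurable[OF h] L2_measurable[OF u] L2_measurable[OF test_L2[OF \<phi>]]
      L2_measurable[OF test_L2[OF helmholtz_test[OF \<phi>]]]
    have "(\<integral>x. h (x - a) * \<phi> x \<partial>lborel) = (\<integral>x. h x * \<phi> (x + a) \<partial>lborel)"
      using integral_translate[where f="\<lambda>x. h x * \<phi> (x + a)" and a=a] by simp
    also have "\<dots> = - (\<integral>x. u x * helmholtz l \<phi> (x + a) \<partial>lborel)"
      using weak[OF test_translate[OF \<phi>, of a]] by (simp add: helmholtz_translate[OF test_smooth[OF \<phi>]])
    also have "(\<integral>x. u x * helmholtz l \<phi> (x + a) \<partial>lborel) = (\<integral>x. u (x - a) * helmholtz l \<phi> x \<partial>lborel)"
      using integral_translate[where f="\<lambda>x. u x * helmholtz l \<phi> (x + a)" and a=a] by simp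
    finally show ?thesis .
  qed
  then have "(\<integral>x. conv (green l) h x * \<phi> x \<partial>lborel) = - (\<integral>x. conv (green l) u x * helmholtz l \<phi> x \<partial>lborel)"
    using conv_pairing[OF G h test_L2[OF \<phi>]] conv_pairing[OF G u test_L2[OF helmholtz_test[OF \<phi>]]]
    by simp
  also have "\<dots> = (\<integral>x. u x * \<phi> x \<partial>lborel)"
    using weak_helmholtz_conv_green[OF l u \<phi>] by simp
  finally show ?thesis .
qed

section \<open>The fundamental lemma of the calculus of variations\<close>

text \<open>The measures with densities r and -r, both cut off at 0 by \<open>ennreal\<close>, are
  finite and equal on boxes, hence equal. Then the positive and the negative part of r agree almost
  everywhere, which forces r = 0.\<close>

lemma AE_zero_if_integral_box_zero_real:
  fixes r :: "real^3 \<Rightarrow> real"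
  assumes [measurable]: "r \<in> borel_measurable borel"
    and int: "\<And>a b. integrable lborel (\<lambda>x. indicator (box a b) x * r x)"
    and zero: "\<And>a b. (\<integral>x. indicator (box a b) x * r x \<partial>lborel) = 0"
  shows "AE x in lborel. r x = 0"
proof -
  let ?E = "range (\<lambda>(a, b). box a b :: (real^3) set)"
  let ?M = "density lborel (\<lambda>x. ennreal (r x))" and ?N = "density lborel (\<lambda>x. ennreal (- r x))"
  have M: "emeasure ?M (box a b) = (\<integral>\<^sup>+x. ennreal (indicator (box a b) x * r x) \<partial>lborel)" for a b
    by (subst emeasure_density) (auto intro!: nn_integral_cong simp: indicator_def)
  have N: "emeasure ?N (box a b) = (\<integral>\<^sup>+x. ennreal (- (indicator (box a b) x * r x)) \<partial>lborel)" for a b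
    by (subst emeasure_density) (auto intro!: nn_integral_cong simp: indicator_def)
  have fin: "emeasure ?M (box a b) \<noteq> \<infinity>" "emeasure ?N (box a b) \<noteq> \<infinity>" for a b
    using int[of a b] unfolding M N by (auto simp: real_integrable_def)
  have eq: "emeasure ?M (box a b) = emeasure ?N (box a b)" for a b
  proof -
    have "enn2real (emeasure ?M (box a b)) = enn2real (emeasure ?N (box a b))"
      using real_lebesgue_integral_def[OF int[of a b]] zero[of a b] unfolding M N by simp
    then show ?thesis using fin[of a b] by (metis ennreal_enn2real_if infinity_ennreal_def)
  qed
  have "?M = ?N"
  proof (rule measure_eqI_generator_eq)
    show "Int_stable ?E" by (auto simp: Int_stable_def box_Int_box)
    show "sets ?M = sigma_sets UNIV ?E" "sets ?N = sigma_sets UNIV ?E"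
      by (simp_all add: borel_eq_box)
    let ?A = "\<lambda>n::nat. box (- (real n *\<^sub>R One)) (real n *\<^sub>R One) :: (real^3) set"
    show "range ?A \<subseteq> ?E" "(\<Union>i. ?A i) = UNIV"
      unfolding UN_box_eq_UNIV by auto
  qed (use eq fin in auto)
  then have "AE x in lborel. ennreal (r x) = ennreal (- r x)"
    by (intro sigma_finite_measure.density_unique[OF sigma_finite_lborel]) auto
  then show ?thesis
  proof eventually_elim
    fix x assume "ennreal (r x) = ennreal (- r x)"
    then show "r x = 0" by (cases "0 \<le> r x") (auto simp: ennreal_neg ennreal_eq_0_iff)
  qed
qed

lemma AE_zero_if_integral_box_zero:
  fixes u :: "real^3 \<Rightarrow> complex"
  assumes [measurable]: "u \<in> borel_measurable borel"
    and int: "\<And>a b. integrable lborel (\<lambda>x. indicator (box a b) x * u x)"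
    and zero: "\<And>a b. (\<integral>x. indicator (box a b) x * u x \<partial>lborel) = 0"
  shows "AE x in lborel. u x = 0"
proof -
  have eq: "indicator A x * Re (u x) = Re (indicator A x * u x)" "indicator A x * Im (u x) = Im (indicator A x * u x)" for A x
    by (auto simp: indicator_def)
  have "AE x in lborel. Re (u x) = 0"
    by (rule AE_zero_if_integral_box_zero_real)
       (auto simp only: eq integral_Re[OF int] zero zero_complex.sel intro!: integrable_Re int, measurable)
  moreover have "AE x in lborel. Im (u x) = 0"
    by (rule AE_zero_if_integral_box_zero_real)
       (auto simp only: eq integral_Im[OF int] zero zero_complex.sel intro!: integrable_Im int, measurable)
  ultimately show ?thesis by eventually_elim (simp add: complex_eq_iff)
qed

lemma L2_indicator:
  assumes [measurable]: "S \<in> sets borel" and fin: "emeasure lborel S < \<infinity>"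
  shows "(\<lambda>x. indicator S x :: complex) \<in> L2"
proof -
  have "(\<lambda>x. (cmod (indicator S x))\<^sup>2) = (\<lambda>x. indicator S x :: real)"
    by (auto simp: indicator_def)
  then show ?thesis using fin by (simp add: L2_iff)
qed

text \<open>The boundary of a box is null, and off it the indicator function is locally constant;
  there its mollifications are eventually exact.\<close>

lemma AE_box_or_outside: "AE x in lborel. x \<in> box a b \<or> x \<notin> cbox a (b :: real^3)"
proof -
  have "emeasure lborel (cbox a b - box a b) = 0"
    by (subst emeasure_Diff) (auto simp: box_subset_cbox emeasure_lborel_box_eq emeasure_lborel_cbox_eq)
  then show ?thesis by (intro AE_I'[of "cbox a b - box a b"]) auto
qed

text \<open>The indicator function of a box, with a small ball about \<open>0\<close> removed, is mollified with the
  rescalings of \<open>\<bar>\<eta>\<bar>\<^sup>2\<close>; the test functions that occur are translates of these rescalings.\<close>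

lemma L2_zero_if_test_orthogonal:
  assumes \<eta>: "\<eta> \<in> test_functions UNIV" "\<forall>\<^sub>F x in nhds 0. \<eta> x = 1"
    and u: "u \<in> L2" and orth: "\<And>\<phi>. \<phi> \<in> test_functions (- {0}) \<Longrightarrow> (\<integral>x. u x * \<phi> x \<partial>lborel) = 0"
  shows "AE x in lborel. u x = 0"
proof -
  note [measurable] = L2_measurable[OF u] L2_measurable[OF test_L2[OF \<eta>(1)]]
  \<comment> \<open>The cut-off itself supplies the mollifier. A complex-valued \<eta> might
    integrate to 0, whereas the integral of |\<eta>|^2 is positive because \<eta> = 1 near
    0.\<close>
  define q where "q x = \<eta> x * cnj (\<eta> x)" for x
  have q: "q \<in> test_functions UNIV"
    unfolding q_def[abs_def] by (intro test_mult \<eta> smooth_cnj test_smooth[OF \<eta>(1)])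
  note q_int = test_integrable[OF q]
  note [measurable] = L2_measurable[OF test_L2[OF q]]
  obtain R where R: "0 < R" "\<And>x. R < norm x \<Longrightarrow> q x = 0" using test_support[OF q] by metis
  define c where "c = (\<integral>x. q x \<partial>lborel)"
  have "c \<noteq> 0"
  proof
    assume "c = 0"
    have "q = (\<lambda>x. of_real ((cmod (\<eta> x))\<^sup>2))"
      by (simp add: q_def[abs_def] complex_norm_square[symmetric])
    then have "c = of_real (\<integral>x. (cmod (\<eta> x))\<^sup>2 \<partial>lborel)" unfolding c_def by (simp only: integral_complex_of_real)
    then have "(L2_norm \<eta>)\<^sup>2 = 0" using \<open>c = 0\<close> by (simp add: L2_norm_sq)
    then have ae: "AE x in lborel. \<eta> x = 0" using L2_norm_eq_0[OF test_L2[OF \<eta>(1)]] by simp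
    obtain d where d: "0 < d" "\<And>x. dist x 0 < d \<Longrightarrow> \<eta> x = 1"
      using \<eta>(2) unfolding eventually_nhds_metric by auto
    obtain x where "x \<in> ball 0 d" "\<eta> x = 0" using AE_ball_witness[OF ae d(1)] .
    then show False using d(2)[of x] by (simp add: dist_commute)
  qed
  define e where "e n = 1 / real (Suc n)" for n
  have e: "0 < e n" "e n \<le> 1" for n by (auto simp: e_def)
  have e0: "e \<longlonglongrightarrow> 0" unfolding e_def by (rule LIMSEQ_Suc[OF lim_1_over_n])
  have box_int: "integrable lborel (\<lambda>x. indicator (box a b) x * u x)" for a b
    by (intro L2_mult_integrable L2_indicator u) (auto intro: emeasure_lborel_box_finite[simplified])
  have box_zero: "(\<integral>x. indicator (box a b) x * u x \<partial>lborel) = 0" for a b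
  proof -
    \<comment> \<open>R e_n bounds the support of the rescaled mollifier, so for x outside the
      removed ball its translate to x has a support that avoids 0 and is an admissible test
      function.\<close>
    define S where "S n = box a b - cball 0 (R * e n)" for n
    have [measurable]: "S n \<in> sets borel" for n unfolding S_def by auto
    define v where "v n x = (indicator (S n) x :: complex)" for n x
    have v: "v n \<in> L2" for n
    proof -
      have "emeasure lborel (S n) \<le> emeasure lborel (box a b)" by (intro emeasure_mono) (auto simp: S_def)
      also have "\<dots> < \<infinity>" by (rule emeasure_lborel_box_finite)
      finally show ?thesis unfolding v_def[abs_def] by (intro L2_indicator) auto
    qed
    have [measurable]: "v n \<in> borel_measurable borel" for n using v by (rule L2_measurable)
    define w where "w n y = (\<integral>z. q z * v n (y + e n *\<^sub>R z) \<partial>lborel)" for n y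
    have w_zero: "(\<integral>y. u y * w n y \<partial>lborel) = 0" for n
    proof -
      define g where "g x = q (0 + (1 / e n) *\<^sub>R x)" for x
      have g: "g \<in> test_functions UNIV" unfolding g_def[abs_def] using e(1)[of n] by (intro test_affine q) auto
      have conv0: "conv g u x = 0" if "R * e n < norm x" for x
      proof -
        note [measurable] = L2_measurable[OF test_L2[OF g]]
        have supp: "{y. g (x - y) \<noteq> 0} \<subseteq> cball x (R * e n)"
        proof
          fix y assume "y \<in> {y. g (x - y) \<noteq> 0}"
          then have "norm ((1 / e n) *\<^sub>R (x - y)) \<le> R" using R(2) by (force simp: g_def not_less[symmetric])
          then have "norm (x - y) / e n \<le> R" using e(1)[of n] unfolding norm_scaleR by simp
          then show "y \<in> cball x (R * e n)" using e(1)[of n] by (simp add: dist_norm pos_divide_le_eq)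
        qed
        have "closure {y. g (x - y) \<noteq> 0} \<subseteq> cball x (R * e n)"
          using supp by (rule closure_minimal) simp
        then have "0 \<notin> closure {y. g (x - y) \<noteq> 0}" using that by (auto simp: dist_norm)
        then have "(\<lambda>y. g (x - y)) \<in> test_functions (- {0})"
          using test_reflect[OF g, of x] by (auto simp: test_functions_def)
        then have "(\<integral>y. u y * g (x - y) \<partial>lborel) = 0" by (rule orth)
        moreover have "conv g u x = (\<integral>y. g (x - y) * u y \<partial>lborel)" by (rule conv_commute) measurable
        ultimately show ?thesis by (simp add: mult.commute)
      qed
      have "(\<lambda>x. conv g u x * v n x) = (\<lambda>x. 0)"
        using conv0 by (auto simp: v_def S_def indicator_def fun_eq_iff not_le)
      then have "(\<integral>x. u x * conv (\<lambda>a. g (- a)) (v n) x \<partial>lborel) = 0"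
        using conv_pairing_reflect[OF test_integrable[OF g] u v[of n]] by simp
      moreover have "conv (\<lambda>a. g (- a)) (v n) x = (e n)^3 *\<^sub>R w n x" for x
      proof -
        have "conv (\<lambda>a. g (- a)) (v n) x = (\<integral>a. q (- ((1 / e n) *\<^sub>R a)) * v n (x - a) \<partial>lborel)"
          by (simp add: conv_def g_def)
        also have "\<dots> = (e n)^3 *\<^sub>R w n x"
          using e(1)[of n] by (subst integral_lborel_affine[where c="- e n" and t=0]) (auto simp: w_def)
        finally show ?thesis .
      qed
      ultimately show ?thesis using e(1)[of n] by simp
    qed
    obtain K where K: "0 < K" "box a b \<subseteq> cball 0 K"
      using bounded_box[of a b] by (auto simp: bounded_pos subset_iff)
    have w_outside: "w n y = 0" if "K + R < norm y" for n y
    proof -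
      have "q z * v n (y + e n *\<^sub>R z) = 0" for z
      proof (cases "R < norm z")
        case False
        have "norm y \<le> norm (y + e n *\<^sub>R z) + norm (e n *\<^sub>R z)"
          using norm_triangle_ineq4[of "y + e n *\<^sub>R z" "e n *\<^sub>R z"] by simp
        moreover have "norm (e n *\<^sub>R z) \<le> 1 * R"
          unfolding norm_scaleR using e[of n] False by (intro mult_mono) auto
        ultimately have "y + e n *\<^sub>R z \<notin> box a b" using that K(2) by (auto simp: subset_iff)
        then show ?thesis by (simp add: v_def S_def)
      qed (use R in simp)
      then show ?thesis unfolding w_def by (simp only: Bochner_Integration.integral_zero)
    qed
    have w_bound: "cmod (w n y) \<le> (\<integral>z. cmod (q z) \<partial>lborel)" for n y
    proof -
      have "cmod (w n y) \<le> (\<integral>z. cmod (q z * v n (y + e n *\<^sub>R z)) \<partial>lborel)"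
        unfolding w_def by (rule integral_norm_bound)
      also have "\<dots> \<le> (\<integral>z. cmod (q z) \<partial>lborel)"
      proof (rule integral_mono')
        show "cmod (q z * v n (y + e n *\<^sub>R z)) \<le> cmod (q z)" for z
          by (auto simp: v_def indicator_def)
      qed (use q_int in auto)
      finally show ?thesis .
    qed
    have [measurable]: "w n \<in> borel_measurable borel" for n
      unfolding w_def[abs_def] by (rule lborel.borel_measurable_lebesgue_integral) measurable
    have "(\<lambda>n. \<integral>y. u y * w n y \<partial>lborel) \<longlonglongrightarrow> (\<integral>y. u y * (c * indicator (box a b) y) \<partial>lborel)"
    proof (rule integral_dominated_convergence[where w="\<lambda>y. (\<integral>z. cmod (q z) \<partial>lborel) * cmod (u y * indicator (cball 0 (K + R)) y)"])
      have "(\<lambda>x. indicator (cball 0 (K + R)) x :: complex) \<in> L2"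
        using emeasure_lborel_cball_finite[of "0::real^3" "K + R"] by (intro L2_indicator) auto
      from integrable_norm[OF L2_mult_integrable[OF u this]]
      show "integrable lborel (\<lambda>y. (\<integral>z. cmod (q z) \<partial>lborel) * cmod (u y * indicator (cball 0 (K + R)) y))"
        by (rule integrable_mult_right)
      show "AE y in lborel. cmod (u y * w n y) \<le> (\<integral>z. cmod (q z) \<partial>lborel) * cmod (u y * indicator (cball 0 (K + R)) y)" for n
      proof (intro AE_I2)
        fix y
        show "cmod (u y * w n y) \<le> (\<integral>z. cmod (q z) \<partial>lborel) * cmod (u y * indicator (cball 0 (K + R)) y)"
        proof (cases "K + R < norm y")
          case False
          then show ?thesis using mult_right_mono[OF w_bound[of n y], of "cmod (u y)"]
            by (simp add: norm_mult mult.commute)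
        qed (simp add: w_outside)
      qed
      show "AE y in lborel. (\<lambda>n. u y * w n y) \<longlonglongrightarrow> u y * (c * indicator (box a b) y)"
        using AE_box_or_outside[of a b] AE_lborel_singleton[of "0::real^3"]
      proof eventually_elim
        fix y assume y: "y \<in> box a b \<or> y \<notin> cbox a b" "y \<noteq> 0"
        have "\<exists>d>0. ball y d \<subseteq> box a b \<or> ball y d \<subseteq> - cbox a b"
          using y(1) open_contains_ball_eq[OF open_box, of y a b] open_contains_ball_eq[OF open_Compl[OF closed_cbox], of y a b]
          by (metis ComplI)
        then obtain d where d: "0 < d" "ball y d \<subseteq> box a b \<or> ball y d \<subseteq> - cbox a b" by blast
        \<comment> \<open>Once R e_n is below d, averaging sees only points on the same side of the
          box as y; below |y| / 2 it also misses the removed ball about 0. From then on the value is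
          exactly c times the indicator.\<close>
        have "(\<lambda>n. R * e n) \<longlonglongrightarrow> R * 0" by (intro tendsto_intros e0)
        moreover have "R * 0 < min d (norm y / 2)" using d y by simp
        ultimately have "\<forall>\<^sub>F n in sequentially. R * e n < min d (norm y / 2)" by (rule order_tendstoD)
        then have "\<forall>\<^sub>F n in sequentially. w n y = c * indicator (box a b) y"
        proof eventually_elim
          fix n assume n: "R * e n < min d (norm y / 2)"
          have "q z * v n (y + e n *\<^sub>R z) = q z * indicator (box a b) y" for z
          proof (cases "R < norm z")
            case False
            have z: "norm (e n *\<^sub>R z) \<le> R * e n"
              using False e(1)[of n] by (simp add: mult.commute mult_left_mono)
            then have "y + e n *\<^sub>R z \<in> ball y d" using n by (simp add: dist_norm)
            moreover have "norm y \<le> norm (y + e n *\<^sub>R z) + norm (e n *\<^sub>R z)"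
              using norm_triangle_ineq4[of "y + e n *\<^sub>R z" "e n *\<^sub>R z"] by simp
            then have "y + e n *\<^sub>R z \<notin> cball 0 (R * e n)" using z n unfolding mem_cball dist_0_norm by linarith
            moreover have "y \<in> ball y d" using d(1) by simp
            ultimately have "v n (y + e n *\<^sub>R z) = indicator (box a b) y"
              using d(2) box_subset_cbox[of a b] by (auto simp: v_def S_def indicator_def subset_iff)
            then show ?thesis by simp
          qed (use R in simp)
          then show "w n y = c * indicator (box a b) y"
            unfolding w_def c_def by (simp only: integral_mult_left_zero)
        qed
        then show "(\<lambda>n. u y * w n y) \<longlonglongrightarrow> u y * (c * indicator (box a b) y)"
          by (intro tendsto_mult tendsto_const tendsto_eventually)
      qed
    qed measurable
    then have "(\<integral>y. u y * (c * indicator (box a b) y) \<partial>lborel) = 0"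
      using w_zero LIMSEQ_unique[OF _ tendsto_const] by simp
    moreover have "(\<integral>y. u y * (c * indicator (box a b) y) \<partial>lborel) = c * (\<integral>y. indicator (box a b) y * u y \<partial>lborel)"
      by (subst integral_mult_right_zero[symmetric]) (simp add: mult_ac)
    ultimately show ?thesis using \<open>c \<noteq> 0\<close> by simp
  qed
  show ?thesis by (rule AE_zero_if_integral_box_zero[OF _ box_int box_zero]) measurable
qed

section \<open>Regularity of the resolvent of the free operator\<close>

text \<open>Along a convergent, hence bounded, sequence all shifted kernels live in one ball, where
  the L2 function f is integrable; dominated convergence does the rest.\<close>

lemma conv_continuous_compact:
  assumes k: "continuous_on UNIV k" "bounded {x. k x \<noteq> 0}" and f: "f \<in> L2"
  shows "continuous_on UNIV (conv k f)"
  unfolding continuous_on_sequentially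
proof (intro allI ballI impI, elim conjE)
  fix X :: "nat \<Rightarrow> real^3" and a assume X: "X \<longlonglongrightarrow> a"
  have [measurable]: "k \<in> borel_measurable borel" using k by (intro borel_measurable_continuous_onI)
  note [measurable] = L2_measurable[OF f]
  obtain M where M: "0 < M" "\<And>x. cmod (k x) \<le> M" using compactly_supported_bounded[OF k] by metis
  obtain R where R: "0 < R" "\<And>x. R < norm x \<Longrightarrow> k x = 0"
    using k(2) by (force simp: bounded_pos not_le[symmetric])
  obtain K where K: "0 < K" "\<And>n. norm (X n) \<le> K"
    using convergent_imp_bounded[OF X] by (auto simp: bounded_pos)
  have "(\<lambda>n. \<integral>y. k (X n - y) * f y \<partial>lborel) \<longlonglongrightarrow> (\<integral>y. k (a - y) * f y \<partial>lborel)"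
  proof (rule integral_dominated_convergence[where w="\<lambda>y. M * cmod (f y * indicator (cball 0 (R + K)) y)"])
    have "(\<lambda>x. indicator (cball 0 (R + K)) x :: complex) \<in> L2"
      using emeasure_lborel_cball_finite[of "0::real^3" "R + K"] by (intro L2_indicator) auto
    from integrable_norm[OF L2_mult_integrable[OF f this]]
    show "integrable lborel (\<lambda>y. M * cmod (f y * indicator (cball 0 (R + K)) y))"
      by (rule integrable_mult_right)
    show "AE y in lborel. cmod (k (X n - y) * f y) \<le> M * cmod (f y * indicator (cball 0 (R + K)) y)" for n
    proof (intro AE_I2)
      fix y
      show "cmod (k (X n - y) * f y) \<le> M * cmod (f y * indicator (cball 0 (R + K)) y)"
      proof (cases "R < norm (X n - y)")
        case False
        then have "norm y \<le> R + K"
          using norm_triangle_ineq4[of "X n" "X n - y"] K(2)[of n] by simp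
        then show ?thesis using mult_right_mono[OF M(2)[of "X n - y"], of "cmod (f y)"] by (simp add: norm_mult)
      qed (use R M in simp)
    qed
    show "AE y in lborel. (\<lambda>n. k (X n - y) * f y) \<longlonglongrightarrow> k (a - y) * f y"
    proof (intro AE_I2 tendsto_mult tendsto_const)
      fix y
      have "isCont k (a - y)" using k(1) by (simp add: continuous_on_eq_continuous_at)
      then show "(\<lambda>n. k (X n - y)) \<longlonglongrightarrow> k (a - y)"
        by (rule isCont_tendsto_compose) (intro tendsto_intros X)
    qed
  qed measurable
  then show "(conv k f \<circ> X) \<longlonglongrightarrow> conv k f a"
    by (simp add: o_def conv_commute)
qed

lemma continuous_on_zero_near_0:
  fixes f :: "real^3 \<Rightarrow> complex"
  assumes "continuous_on (- {0}) f" "0 < d" "\<And>x. norm x < d \<Longrightarrow> f x = 0"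
  shows "continuous_on UNIV f"
proof -
  have "continuous_on (ball 0 d) f"
    by (rule continuous_on_eq[OF continuous_on_const[of _ 0]]) (use assms(3) in \<open>simp add: dist_norm\<close>)
  then have "continuous_on (- {0} \<union> ball 0 d) f"
    using assms(1) by (intro continuous_on_open_Un) auto
  moreover have "- {0} \<union> ball (0::real^3) d = UNIV" using assms(2) by auto
  ultimately show ?thesis by simp
qed

text \<open>Cut the kernel off near 0 and near infinity. The truncations converge to g in L2, so by
  \<open>conv_bound\<close> their convolutions with f converge uniformly, and continuity
  survives.\<close>

lemma conv_continuous:
  assumes g: "g \<in> L2" "continuous_on (- {0}) g" and f: "f \<in> L2"
  shows "continuous_on UNIV (conv g f)"
proof -
  note [measurable] = L2_measurable[OF g(1)]
  \<comment> \<open>A continuous cut-off: 0 for |x| <= 1/(n+1) and for |x| >= n+1, and 1 for 2/(n+1)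
    <= |x| <= n.\<close>
  define \<psi> where "\<psi> n x = max 0 (min 1 (real (Suc n) * norm x - 1)) * max 0 (min 1 (real (Suc n) - norm x))"
    for n and x :: "real^3"
  have \<psi>: "0 \<le> \<psi> n x" "\<psi> n x \<le> 1" for n x by (auto simp: \<psi>_def intro: mult_le_one)
  have \<psi>_cont: "continuous_on UNIV (\<psi> n)" for n unfolding \<psi>_def[abs_def] by (intro continuous_intros)
  have [measurable]: "\<psi> n \<in> borel_measurable borel" for n
    by (intro borel_measurable_continuous_onI \<psi>_cont)
  define k where "k n x = of_real (\<psi> n x) * g x" for n x
  have k_zero: "k n x = 0" if "norm x < 1 / real (Suc n) \<or> real (Suc n) < norm x" for n x
    using that by (auto simp: k_def \<psi>_def max_def min_def field_simps)
  have k_L2: "k n \<in> L2" for n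
    unfolding k_def[abs_def]
    by (rule L2_dominated[OF g(1), where C=1]) (use \<psi> in \<open>auto simp: norm_mult intro!: mult_left_le_one_le\<close>)
  have k_cont: "continuous_on UNIV (k n)" for n
  proof (rule continuous_on_zero_near_0)
    show "continuous_on (- {0}) (k n)"
      unfolding k_def[abs_def] by (intro continuous_intros g(2) continuous_on_subset[OF \<psi>_cont]) auto
    show "0 < 1 / real (Suc n)" by simp
  qed (simp add: k_zero)
  have k_supp: "bounded {x. k n x \<noteq> 0}" for n
    by (rule bounded_subset[OF bounded_cball[of 0 "real (Suc n)"]]) (use k_zero[of _ n] in \<open>force simp: not_le[symmetric]\<close>)
  have "(\<lambda>n. \<integral>x. (cmod (g x - k n x))\<^sup>2 \<partial>lborel) \<longlonglongrightarrow> (\<integral>(x::real^3). 0 \<partial>lborel)"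
  proof (rule integral_dominated_convergence[where w="\<lambda>x. (cmod (g x))\<^sup>2"])
    show "AE x in lborel. norm ((cmod (g x - k n x))\<^sup>2) \<le> (cmod (g x))\<^sup>2" for n
    proof (intro AE_I2)
      fix x
      have "g x - k n x = of_real (1 - \<psi> n x) * g x" by (simp add: k_def algebra_simps)
      then have "cmod (g x - k n x) = (1 - \<psi> n x) * cmod (g x)"
        using \<psi>[of n x] by (simp only: norm_mult norm_of_real)
      also have "\<dots> \<le> cmod (g x)" using \<psi>[of n x] by (intro mult_left_le_one_le) auto
      finally show "norm ((cmod (g x - k n x))\<^sup>2) \<le> (cmod (g x))\<^sup>2" by (simp add: power_mono)
    qed
    show "AE x in lborel. (\<lambda>n. (cmod (g x - k n x))\<^sup>2) \<longlonglongrightarrow> 0"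
      using AE_lborel_singleton[of "0::real^3"]
    proof eventually_elim
      fix x :: "real^3" assume "x \<noteq> 0"
      obtain N where N: "max (2 / norm x) (norm x + 1) \<le> real N" using real_arch_simple by blast
      have "\<forall>\<^sub>F n in sequentially. (cmod (g x - k n x))\<^sup>2 = 0"
        using eventually_ge_at_top[of N]
      proof eventually_elim
        fix n assume "N \<le> n"
        then have "max (2 / norm x) (norm x + 1) \<le> real (Suc n)" using N by linarith
        then have "2 \<le> real (Suc n) * norm x" "1 \<le> real (Suc n) - norm x"
          using \<open>x \<noteq> 0\<close> by (auto simp: pos_divide_le_eq)
        then show "(cmod (g x - k n x))\<^sup>2 = 0" by (simp add: k_def \<psi>_def)
      qed
      then show "(\<lambda>n. (cmod (g x - k n x))\<^sup>2) \<longlonglongrightarrow> 0" by (rule tendsto_eventually)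
    qed
  qed (use L2_integrable[OF g(1)] L2_measurable[OF k_L2] in measurable)
  then have "(\<lambda>n. sqrt (\<integral>x. (cmod (g x - k n x))\<^sup>2 \<partial>lborel)) \<longlonglongrightarrow> sqrt (\<integral>(x::real^3). 0 \<partial>lborel)"
    by (rule tendsto_real_sqrt)
  then have lim: "(\<lambda>n. L2_norm (\<lambda>x. g x - k n x)) \<longlonglongrightarrow> 0" by (simp add: L2_norm_def)
  have "uniform_limit UNIV (\<lambda>n. conv (k n) f) (conv g f) sequentially"
  proof (rule uniform_limitI)
    fix e :: real assume "0 < e"
    have "(\<lambda>n. L2_norm (\<lambda>x. g x - k n x) * L2_norm f) \<longlonglongrightarrow> 0 * L2_norm f"
      by (intro tendsto_intros lim)
    then have "\<forall>\<^sub>F n in sequentially. L2_norm (\<lambda>x. g x - k n x) * L2_norm f < e"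
      using \<open>0 < e\<close> by (simp add: order_tendstoD)
    then show "\<forall>\<^sub>F n in sequentially. \<forall>x\<in>UNIV. dist (conv (k n) f x) (conv g f x) < e"
    proof (eventually_elim, intro ballI)
      fix n x assume "L2_norm (\<lambda>x. g x - k n x) * L2_norm f < e"
      then show "dist (conv (k n) f x) (conv g f x) < e"
        using conv_bound[OF L2_diff[OF g(1) k_L2[of n]] f, of x]
        by (simp add: conv_diff_left[OF g(1) k_L2 f] dist_norm norm_minus_commute)
    qed
  qed
  then show ?thesis
    by (rule uniform_limit_theorem[rotated]) (auto intro: always_eventually conv_continuous_compact k_cont k_supp f)
qed

lemma conv_green_continuous:
  assumes "0 < Im l" "h \<in> L2"
  shows "continuous_on UNIV (conv (green l) h)"
proof (rule conv_continuous[OF green_L2[OF assms(1)] _ assms(2)])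
  show "continuous_on (- {0}) (green l)"
    unfolding green_def[abs_def] by (intro continuous_intros) auto
qed

section \<open>Energy estimates for derivatives up to second order\<close>

lemma of_real_L2_norm_sq: "of_real ((L2_norm u)\<^sup>2) = (\<integral>x. u x * cnj (u x) \<partial>lborel)"
  unfolding L2_norm_sq complex_norm_square[symmetric] of_real_power[symmetric] by (rule integral_complex_of_real[symmetric])

text \<open>Move one derivative in direction i to Q, commute it past the others, and move one in
  direction j back to P. Summed over i and j this equates the energy of the Hessian with that of the
  Laplacian.\<close>

lemma integral_partials_swap:
  assumes P: "P \<in> test_functions UNIV" and Q: "Q \<in> test_functions UNIV"
  shows "(\<integral>x. partials [i, j] P x * partials [i, j] Q x \<partial>lborel) = (\<integral>x. partials [j, j] P x * partials [i, i] Q x \<partial>lborel)"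
proof -
  note sQ = test_smooth[OF Q]
  have comm: "partial i (partial j f) = partial j (partial i f)" if "smooth f" for f
    using partial_commute[OF that] by blast
  have "(\<integral>x. partials [i, j] P x * partials [i, j] Q x \<partial>lborel) = - (\<integral>x. partial j P x * partial i (partial i (partial j Q)) x \<partial>lborel)"
    using integration_by_parts[OF test_partial[OF P] smooth_partials[OF sQ, of "[i, j]"], of i j] by simp
  also have "partial i (partial i (partial j Q)) = partial j (partial i (partial i Q))"
    by (simp only: comm sQ smooth_partial)
  also have "- (\<integral>x. partial j P x * partial j (partial i (partial i Q)) x \<partial>lborel)
      = (\<integral>x. partials [j, j] P x * partials [i, i] Q x \<partial>lborel)"
    using integration_by_parts[OF test_partial[OF P] smooth_partials[OF sQ, of "[i, i]"], of j j] by simp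
  finally show ?thesis .
qed

lemma test_sub: "f \<in> test_functions UNIV \<Longrightarrow> (\<lambda>x. f (x - a)) \<in> test_functions UNIV"
  using test_translate[of f "-a"] by simp

lemma partials_sub: "smooth f \<Longrightarrow> partials is (\<lambda>x. f (x - a)) = (\<lambda>x. partials is f (x - a))"
  using partials_translate[of f "is" "-a"] by simp

text \<open>Carries integration by parts through the convolution. The hypothesis is used for
  \<phi>(x - a) and the conjugate of \<phi>(x - b), and these identities are averaged against G and
  its conjugate.\<close>

lemma conv_green_pairing:
  assumes l: "0 < Im l" and \<phi>: "\<phi> \<in> test_functions UNIV"
    and eq: "\<And>P Q. P \<in> test_functions UNIV \<Longrightarrow> Q \<in> test_functions UNIV \<Longrightarrow>
      (\<integral>x. partials is P x * partials js Q x \<partial>lborel) = c * (\<integral>x. partials is' P x * partials js' Q x \<partial>lborel)"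
  shows "(\<integral>x. conv (green l) (partials is \<phi>) x * cnj (conv (green l) (partials js \<phi>) x) \<partial>lborel)
    = c * (\<integral>x. conv (green l) (partials is' \<phi>) x * cnj (conv (green l) (partials js' \<phi>) x) \<partial>lborel)"
proof -
  note G = green_integrable[OF l] and s\<phi> = test_smooth[OF \<phi>]
  note L2 = test_L2[OF test_partials[OF \<phi>]]
  have cc: "cnj (conv (green l) u x) = conv (\<lambda>x. cnj (green l x)) (\<lambda>x. cnj (u x)) x" for u x
    by (simp add: conv_cnj)
  have "(\<integral>x. conv (green l) (partials is \<phi>) x * conv (\<lambda>x. cnj (green l x)) (\<lambda>x. cnj (partials js \<phi> x)) x \<partial>lborel)
    = (\<integral>x. conv (green l) (\<lambda>x. c * partials is' \<phi> x) x * conv (\<lambda>x. cnj (green l x)) (\<lambda>x. cnj (partials js' \<phi> x)) x \<partial>lborel)"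
  proof (rule conv_conv_pairing_cong)
    fix a b
    let ?P = "\<lambda>x. \<phi> (x - a)" and ?Q = "\<lambda>x. cnj (\<phi> (x - b))"
    have Q: "partials ks ?Q = (\<lambda>x. cnj (partials ks \<phi> (x - b)))" for ks
      using partials_cnj[OF test_smooth[OF test_sub[OF \<phi>, of b]]] by (simp add: partials_sub[OF s\<phi>])
    show "(\<integral>x. partials is \<phi> (x - a) * cnj (partials js \<phi> (x - b)) \<partial>lborel)
      = (\<integral>x. c * partials is' \<phi> (x - a) * cnj (partials js' \<phi> (x - b)) \<partial>lborel)"
      using eq[OF test_sub[OF \<phi>, of a] test_cnj[OF test_sub[OF \<phi>, of b]]]
      by (simp only: Q partials_sub[OF s\<phi>] mult.assoc integral_mult_right_zero)
  qed (use G L2 in \<open>auto intro: L2_cnj L2_scale\<close>)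
  then show ?thesis by (simp only: cc conv_scale mult.assoc integral_mult_right_zero)
qed

text \<open>Summed over \<open>i\<close> and \<open>j\<close> the squared norms of \<open>G * \<partial>\<^sub>i\<partial>\<^sub>j\<phi>\<close> add up to that of \<open>G * \<Delta>\<phi> = - \<phi> - l\<^sup>2 (G * \<phi>)\<close>.\<close>

lemma conv_green_second_partials_bound:
  assumes l: "0 < Im l" and \<phi>: "\<phi> \<in> test_functions UNIV"
  shows "L2_norm (conv (green l) (partials [i, j] \<phi>)) \<le> (1 + (cmod l)\<^sup>2 * (\<integral>x. cmod (green l x) \<partial>lborel)) * L2_norm \<phi>"
proof -
  note G = green_integrable[OF l]
  define w where "w is = conv (green l) (partials is \<phi>)" for "is"
  have w: "w is \<in> L2" for "is"
    unfolding w_def by (rule conv_L2[OF G test_L2[OF test_partials[OF \<phi>]]])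
  have int: "integrable lborel (\<lambda>x. w is x * cnj (w js x))" for "is" js
    by (rule L2_mult_integrable[OF w L2_cnj[OF w]])
  have sum_w: "(\<Sum>i\<in>UNIV. w [i, i] x) = - (\<phi> x + l\<^sup>2 * w [] x)" for x
  proof -
    have "- \<phi> x = conv (green l) (helmholtz l \<phi>) x" by (simp add: conv_green_helmholtz[OF l \<phi>])
    also have "\<dots> = (\<Sum>i\<in>UNIV. w [i, i] x) + l\<^sup>2 * w [] x"
      unfolding helmholtz_def[abs_def] w_def
      using test_L2[OF test_partials[OF \<phi>]] test_L2[OF \<phi>]
      by (subst conv_add[OF green_L2[OF l]]) (auto simp: conv_sum[OF green_L2[OF l]] conv_scale intro!: L2_sum L2_scale simp del: partials.simps(2))
    finally show ?thesis by (simp add: algebra_simps)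
  qed
  have "complex_of_real (\<Sum>i\<in>UNIV. \<Sum>j\<in>UNIV. (L2_norm (w [i, j]))\<^sup>2) = (\<Sum>i\<in>UNIV. \<Sum>j\<in>UNIV. \<integral>x. w [j, j] x * cnj (w [i, i] x) \<partial>lborel)"
    unfolding of_real_sum of_real_L2_norm_sq
  proof (intro sum.cong refl)
    fix i j
    show "(\<integral>x. w [i, j] x * cnj (w [i, j] x) \<partial>lborel) = (\<integral>x. w [j, j] x * cnj (w [i, i] x) \<partial>lborel)"
    proof -
      have "(\<integral>x. partials [i, j] P x * partials [i, j] Q x \<partial>lborel) = 1 * (\<integral>x. partials [j, j] P x * partials [i, i] Q x \<partial>lborel)"
        if "P \<in> test_functions UNIV" "Q \<in> test_functions UNIV" for P Q
        using integral_partials_swap[OF that] by (simp only: mult_1)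
      from conv_green_pairing[OF l \<phi> this] show ?thesis unfolding w_def by (simp only: mult_1)
    qed
  qed
  also have "\<dots> = (\<integral>x. (\<Sum>i\<in>UNIV. \<Sum>j\<in>UNIV. w [j, j] x * cnj (w [i, i] x)) \<partial>lborel)"
    by (simp only: integral_linear int)
  also have "\<dots> = (\<integral>x. (\<phi> x + l\<^sup>2 * w [] x) * cnj (\<phi> x + l\<^sup>2 * w [] x) \<partial>lborel)"
  proof (intro Bochner_Integration.integral_cong refl)
    fix x
    have "(\<Sum>i\<in>UNIV. \<Sum>j\<in>UNIV. w [j, j] x * cnj (w [i, i] x)) = (\<Sum>j\<in>UNIV. w [j, j] x) * cnj (\<Sum>i\<in>UNIV. w [i, i] x)"
      by (simp only: cnj_sum sum_distrib_left sum_distrib_right)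
    then show "(\<Sum>i\<in>UNIV. \<Sum>j\<in>UNIV. w [j, j] x * cnj (w [i, i] x)) = (\<phi> x + l\<^sup>2 * w [] x) * cnj (\<phi> x + l\<^sup>2 * w [] x)"
      unfolding sum_w complex_cnj_minus by (simp only: minus_mult_minus)
  qed
  also have "\<dots> = of_real ((L2_norm (\<lambda>x. \<phi> x + l\<^sup>2 * w [] x))\<^sup>2)" by (simp only: of_real_L2_norm_sq)
  finally have eq: "(\<Sum>i\<in>UNIV. \<Sum>j\<in>UNIV. (L2_norm (w [i, j]))\<^sup>2) = (L2_norm (\<lambda>x. \<phi> x + l\<^sup>2 * w [] x))\<^sup>2"
    by (simp only: of_real_eq_iff)
  have "(L2_norm (w [i, j]))\<^sup>2 \<le> (\<Sum>j\<in>UNIV. (L2_norm (w [i, j]))\<^sup>2)"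
    by (rule member_le_sum[of j UNIV "\<lambda>j. (L2_norm (w [i, j]))\<^sup>2"]) auto
  also have "\<dots> \<le> (\<Sum>i\<in>UNIV. \<Sum>j\<in>UNIV. (L2_norm (w [i, j]))\<^sup>2)"
    by (rule member_le_sum[of i UNIV "\<lambda>i. \<Sum>j\<in>UNIV. (L2_norm (w [i, j]))\<^sup>2"]) (auto intro: sum_nonneg)
  finally have "L2_norm (w [i, j]) \<le> L2_norm (\<lambda>x. \<phi> x + l\<^sup>2 * w [] x)"
    unfolding eq by (rule power2_le_imp_le) simp
  also have "\<dots> \<le> L2_norm \<phi> + L2_norm (\<lambda>x. l\<^sup>2 * w [] x)"
    by (intro L2_norm_triangle L2_scale w test_L2[OF \<phi>])
  also have "L2_norm (\<lambda>x. l\<^sup>2 * w [] x) \<le> (cmod l)\<^sup>2 * ((\<integral>x. cmod (green l x) \<partial>lborel) * L2_norm \<phi>)"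
    unfolding L2_norm_scale norm_power w_def using conv_L2_norm[OF G test_L2[OF \<phi>]]
    by (intro mult_left_mono) auto
  finally show ?thesis unfolding w_def by (simp add: algebra_simps)
qed

text \<open>Order 0 is Young's inequality and order 2 the energy identity. Order 1 is interpolated:
  one integration by parts writes the squared norm of G * (first derivative of \<phi>) as minus the
  inner product of the functions of orders 0 and 2. The constant c + C is a convenient bound for
  sqrt (c C).\<close>

lemma conv_green_partials_bound:
  assumes l: "0 < Im l" and "length is \<le> 2"
  obtains C where "0 \<le> C" "\<And>\<phi>. \<phi> \<in> test_functions UNIV \<Longrightarrow> L2_norm (conv (green l) (partials is \<phi>)) \<le> C * L2_norm \<phi>"
proof -
  note G = green_integrable[OF l]
  define c where "c = (\<integral>x. cmod (green l x) \<partial>lborel)"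
  define C where "C = 1 + (cmod l)\<^sup>2 * c"
  have c: "0 \<le> c" "0 \<le> C" by (simp_all add: c_def C_def)
  have bound0: "L2_norm (conv (green l) \<phi>) \<le> c * L2_norm \<phi>" if "\<phi> \<in> test_functions UNIV" for \<phi>
    unfolding c_def by (rule conv_L2_norm[OF G test_L2[OF that]])
  have bound2: "L2_norm (conv (green l) (partials [i, j] \<phi>)) \<le> C * L2_norm \<phi>" if "\<phi> \<in> test_functions UNIV" for \<phi> i j
    unfolding C_def c_def by (rule conv_green_second_partials_bound[OF l that])
  have bound1: "L2_norm (conv (green l) (partials [i] \<phi>)) \<le> (c + C) * L2_norm \<phi>" if \<phi>: "\<phi> \<in> test_functions UNIV" for \<phi> i
  proof (rule power2_le_imp_le)
    have eq: "(\<integral>x. partials [i] P x * partials [i] Q x \<partial>lborel) = - 1 * (\<integral>x. partials [] P x * partials [i, i] Q x \<partial>lborel)"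
      if "P \<in> test_functions UNIV" "Q \<in> test_functions UNIV" for P Q
      using integration_by_parts[OF that(1) smooth_partial[OF test_smooth[OF that(2)]], of i i] by simp
    have "complex_of_real ((L2_norm (conv (green l) (partials [i] \<phi>)))\<^sup>2)
       = - 1 * (\<integral>x. conv (green l) (partials [] \<phi>) x * cnj (conv (green l) (partials [i, i] \<phi>) x) \<partial>lborel)"
      unfolding of_real_L2_norm_sq by (rule conv_green_pairing[OF l \<phi> eq])
    from arg_cong[OF this, of cmod] have "(L2_norm (conv (green l) (partials [i] \<phi>)))\<^sup>2
       = cmod (\<integral>x. conv (green l) (partials [] \<phi>) x * cnj (conv (green l) (partials [i, i] \<phi>) x) \<partial>lborel)"
      by (simp only: norm_of_real norm_mult norm_minus_cancel norm_one mult_1 abs_power2)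
    also have "\<dots> \<le> L2_norm (conv (green l) (partials [] \<phi>)) * L2_norm (\<lambda>x. cnj (conv (green l) (partials [i, i] \<phi>) x))"
      by (intro L2_Cauchy_Schwarz(2) L2_cnj conv_L2[OF G] test_L2[OF test_partials[OF \<phi>]])
    also have "\<dots> \<le> (c * L2_norm \<phi>) * (C * L2_norm \<phi>)"
      unfolding L2_norm_cnj using bound0[OF \<phi>] bound2[OF \<phi>] c by (intro mult_mono) auto
    also have "\<dots> \<le> ((c + C) * L2_norm \<phi>) * ((c + C) * L2_norm \<phi>)"
      using c by (intro mult_mono mult_right_mono) auto
    finally show "(L2_norm (conv (green l) (partials [i] \<phi>)))\<^sup>2 \<le> ((c + C) * L2_norm \<phi>)\<^sup>2"
      by (simp add: power2_eq_square)
  qed (use c in simp)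
  consider "is = []" | i where "is = [i]" | i j where "is = [i, j]"
    using assms(2) by (cases "is"; cases "tl is"; cases "tl (tl is)") auto
  then show ?thesis
  proof cases
    case 1 then show ?thesis using that[of c] bound0 c by simp
  next
    case 2 then show ?thesis using that[of "c + C"] bound1 c by simp
  next
    case 3 then show ?thesis using that[of C] bound2 c by simp
  qed
qed

text \<open>The weak derivatives come from the Riesz theorem: \<open>\<phi> \<mapsto> \<integral> (G * h) \<partial>\<^sup>\<alpha>\<phi> = \<integral> h (G * \<partial>\<^sup>\<alpha>\<phi>)\<close> is bounded in the
  \<open>L\<^sup>2\<close>-norm of \<open>\<phi>\<close>.\<close>

lemma conv_green_sobolev:
  assumes l: "0 < Im l" and h: "h \<in> L2"
  shows "conv (green l) h \<in> sobolev 2"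
proof -
  note G = green_integrable[OF l]
  have u: "conv (green l) h \<in> L2" by (rule conv_L2[OF G h])
  have "\<exists>g\<in>L2. weak_partials is (conv (green l) h) g" if len: "length is \<le> 2" for "is"
  proof -
    obtain C where C: "0 \<le> C" "\<And>\<phi>. \<phi> \<in> test_functions UNIV \<Longrightarrow> L2_norm (conv (green l) (partials is \<phi>)) \<le> C * L2_norm \<phi>"
      using conv_green_partials_bound[OF l len] by metis
    define \<Lambda> where "\<Lambda> \<phi> = (\<integral>x. conv (green l) h x * partials is \<phi> x \<partial>lborel)" for \<phi>
    have int: "integrable lborel (\<lambda>x. conv (green l) h x * partials is \<phi> x)" if "\<phi> \<in> test_functions UNIV" for \<phi>
      by (intro L2_mult_integrable u test_L2[OF test_partials[OF that]])
    obtain g where g: "g \<in> L2" "\<And>\<phi>. \<phi> \<in> test_functions UNIV \<Longrightarrow> \<Lambda> \<phi> = (\<integral>x. g x * \<phi> x \<partial>lborel)"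
    proof (rule L2_Riesz[where V="test_functions UNIV" and \<Lambda>=\<Lambda> and C="L2_norm h * C"])
      show "test_functions UNIV \<subseteq> L2" using test_L2 by auto
      show "test_functions UNIV \<noteq> {}" using test_zero by blast
      show "\<Lambda> (\<lambda>x. f x + g x) = \<Lambda> f + \<Lambda> g" if "f \<in> test_functions UNIV" "g \<in> test_functions UNIV" for f g
        unfolding \<Lambda>_def partials_add[OF that[THEN test_smooth]] distrib_left using int that by simp
      show "\<Lambda> (\<lambda>x. c * f x) = c * \<Lambda> f" if "f \<in> test_functions UNIV" for c f
        unfolding \<Lambda>_def partials_cmult[OF test_smooth[OF that]]
        by (subst integral_mult_right_zero[symmetric]) (simp add: mult_ac)
      show "cmod (\<Lambda> f) \<le> L2_norm h * C * L2_norm f" if "f \<in> test_functions UNIV" for f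
      proof -
        note p = test_L2[OF test_partials[OF that, of "is"]]
        have "\<Lambda> f = (\<integral>x. h x * conv (green l) (partials is f) x \<partial>lborel)"
          unfolding \<Lambda>_def by (rule conv_pairing_even[OF G green_even h p])
        then have "cmod (\<Lambda> f) \<le> L2_norm h * L2_norm (conv (green l) (partials is f))"
          using L2_Cauchy_Schwarz(2)[OF h conv_L2[OF G p]] by simp
        also have "\<dots> \<le> L2_norm h * (C * L2_norm f)" by (intro mult_left_mono C that) simp
        finally show ?thesis by (simp add: mult.assoc)
      qed
    qed (auto intro: test_add test_scale)
    \<comment> \<open>The Riesz theorem represents the functional without a sign, while
      \<open>weak_partials\<close> carries (-1)^|is|; multiplying g by the same sign
      compensates.\<close>
    have "weak_partials is (conv (green l) h) (\<lambda>x. (-1) ^ length is * g x)"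
      unfolding weak_partials_def
    proof
      fix \<phi> :: "real^3 \<Rightarrow> complex" assume "\<phi> \<in> test_functions UNIV"
      from g(2)[OF this]
      show "(\<integral>x. conv (green l) h x * partials is \<phi> x \<partial>lborel) = (-1) ^ length is * (\<integral>x. (-1) ^ length is * g x * \<phi> x \<partial>lborel)"
        unfolding \<Lambda>_def by (simp add: mult.assoc power_mult_distrib[symmetric] flip: power_add)
    qed
    then show ?thesis using L2_scale[OF g(1)] by blast
  qed
  with u show ?thesis by (simp add: sobolev_def)
qed

section \<open>The singular part of the domain\<close>

text \<open>The set where f and g differ is open and null, hence empty. This is how the value
  \<phi>(0) in the domain condition is read off from an identity known only almost
  everywhere.\<close>

lemma continuous_AE_eq:
  fixes f g :: "real^3 \<Rightarrow> complex"
  assumes "continuous_on UNIV f" "continuous_on UNIV g" and ae: "AE x in lborel. f x = g x"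
  shows "f = g"
proof (rule ccontr)
  assume "f \<noteq> g"
  then obtain c where "f c \<noteq> g c" by auto
  moreover have "open {x. f x \<noteq> g x}" by (intro open_Collect_neq assms)
  ultimately obtain e where e: "0 < e" "ball c e \<subseteq> {x. f x \<noteq> g x}"
    using open_contains_ball_eq by blast
  obtain x where "x \<in> ball c e" "f x = g x" using AE_ball_witness[OF ae e(1)] .
  then show False using e by auto
qed

lemma test_over_norm:
  assumes \<psi>: "\<psi> \<in> test_functions U"
  shows "integrable lborel (\<lambda>x. 1 / of_real (norm x) * \<psi> x)" "(\<lambda>x. 1 / of_real (norm x) * \<psi> x) \<in> L2"
proof -
  obtain M where M: "0 < M" "\<And>x. cmod (\<psi> x) \<le> M" using test_bounded[OF \<psi>] by metis
  obtain R where R: "0 < R" "\<And>x. R < norm x \<Longrightarrow> \<psi> x = 0" using test_support[OF \<psi>] by metis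
  note [measurable] = L2_measurable[OF test_L2[OF \<psi>]]
  have b: "cmod (1 / of_real (norm x) * \<psi> x) \<le> M / norm x" for x
    using M by (simp add: norm_mult norm_divide divide_right_mono)
  then have "norm ((cmod (1 / of_real (norm x) * \<psi> x))\<^sup>2) \<le> M\<^sup>2 / (norm x)\<^sup>2" for x
    using power_mono[OF b norm_ge_zero, of x 2] by (simp add: power_divide)
  then have "integrable lborel (\<lambda>x. (cmod (1 / of_real (norm x) * \<psi> x))\<^sup>2)"
    by (intro integrable_bounded_over_norm_sq[where C="M\<^sup>2" and R=R]) (use R in auto)
  then show "(\<lambda>x. 1 / of_real (norm x) * \<psi> x) \<in> L2" by (simp add: L2_iff)
  show "integrable lborel (\<lambda>x. 1 / of_real (norm x) * \<psi> x)"
    by (intro integrable_bounded_over_norm[where C=M and R=R]) (use M R b in auto)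
qed

text \<open>The case \<open>l = 0\<close> of \<open>green_fundamental\<close>, multiplied by 4
  pi.\<close>

lemma integral_laplacian_over_norm:
  fixes \<phi> :: "real^3 \<Rightarrow> complex"
  assumes \<phi>: "\<phi> \<in> test_functions UNIV"
  shows "(\<integral>x. 1 / of_real (norm x) * (\<Sum>i\<in>UNIV. partials [i, i] \<phi> x) \<partial>lborel) = - of_real (4 * pi) * \<phi> 0"
proof -
  have eq: "1 / of_real (norm x) * (\<Sum>i\<in>UNIV. partials [i, i] \<phi> x) = of_real (4 * pi) * (green 0 x * helmholtz 0 \<phi> x)" for x
    by (simp add: green_def helmholtz_def)
  show ?thesis
    unfolding eq integral_mult_right_zero green_fundamental[OF disjI2[OF refl] \<phi>] by simp
qed

text \<open>The constant term of 4 pi G at the origin, after removal of 1/|x|: the source of i l in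
  the boundary condition.\<close>

lemma green_expansion:
  "((\<lambda>t. (exp (\<i> * l * of_real t) - 1) / of_real t) \<longlongrightarrow> \<i> * l) (at (0::real))"
proof -
  have "((\<lambda>z. exp (\<i> * l * z)) has_field_derivative \<i> * l) (at 0)"
    by (auto intro!: derivative_eq_intros)
  then have "((\<lambda>z. (exp (\<i> * l * z) - 1) / z) \<longlongrightarrow> \<i> * l) (at 0)"
    by (simp add: DERIV_def)
  moreover have "filterlim (of_real :: real \<Rightarrow> complex) (at 0) (at 0)"
    by (auto simp: filterlim_at eventually_at_filter intro!: tendsto_eq_intros)
  ultimately show ?thesis by (rule filterlim_compose)
qed

text \<open>\<open>F = (\<Delta> + l\<^sup>2) (\<eta> / \<bar>x\<bar>) + 4 \<pi> \<delta>\<^sub>0\<close> in the sense of distributions; the two delta functions cancel.\<close>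

lemma green_minus_cutoff:
  assumes l: "0 < Im l" and \<eta>: "\<eta> \<in> test_functions UNIV" "\<forall>\<^sub>F x in nhds 0. \<eta> x = 1"
  obtains F where "F \<in> L2"
    "AE x in lborel. conv (green l) F x = of_real (4 * pi) * green l x - \<eta> x / of_real (norm x)"
    "conv (green l) F 0 = \<i> * l"
proof -
  note s\<eta> = test_smooth[OF \<eta>(1)]
  obtain d where d: "0 < d" and \<eta>1: "\<And>x. norm x < d \<Longrightarrow> \<eta> x = 1"
    using \<eta>(2) unfolding eventually_nhds_metric by auto
  have near: "\<forall>\<^sub>F y in nhds x. norm y < d" if "norm x < d" for x :: "real^3"
    using eventually_nhds_in_open[of "ball 0 d" x] that by (simp add: dist_norm)
  have \<eta>': "partial i \<eta> x = 0" if "norm x < d" for i x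
  proof (rule partial_eqI)
    have "\<forall>\<^sub>F y in nhds x. 1 = \<eta> y" using near[OF that] by eventually_elim (simp add: \<eta>1)
    moreover have "line_deriv i (\<lambda>x. 1) x 0" by simp
    ultimately show "line_deriv i \<eta> x 0" by (rule line_deriv_transform[rotated])
  qed
  have \<eta>'': "partial j (partial i \<eta>) x = 0" if "norm x < d" for i j x
  proof (rule partial_eqI)
    have "\<forall>\<^sub>F y in nhds x. 0 = partial i \<eta> y" using near[OF that] by eventually_elim (simp add: \<eta>')
    moreover have "line_deriv j (\<lambda>x. 0) x 0" by simp
    ultimately show "line_deriv j (partial i \<eta>) x 0" by (rule line_deriv_transform[rotated])
  qed
  define N where "N x = (1 / of_real (norm x) :: complex)" for x :: "real^3"
  define N' where "N' i x = (- of_real (x $ i) / of_real (norm x) ^ 3 :: complex)" for i and x :: "real^3"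
  have N_deriv: "line_deriv i N x (N' i x)" if "x \<noteq> 0" for i x
  proof -
    have "((\<lambda>z::complex. 1 / z) has_field_derivative - (1 / (of_real (norm x))\<^sup>2)) (at (of_real (sqrt ((norm x)\<^sup>2 + 0\<^sup>2))))"
      using that by (auto intro!: derivative_eq_intros simp: field_simps power2_eq_square)
    from has_vector_derivative_real_field[OF this]
    have "line_deriv i (\<lambda>x. 1 / of_real (sqrt ((norm x)\<^sup>2 + 0\<^sup>2))) x ((x $ i / sqrt ((norm x)\<^sup>2 + 0\<^sup>2)) *\<^sub>R - (1 / (of_real (norm x))\<^sup>2))"
      using that by (intro line_deriv_radial) auto
    moreover have "(x $ i / sqrt ((norm x)\<^sup>2 + 0\<^sup>2)) *\<^sub>R - (1 / (of_real (norm x))\<^sup>2) = N' i x"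
      by (simp add: N'_def scaleR_conv_of_real eval_nat_numeral)
    ultimately show ?thesis by (simp add: N_def)
  qed
  \<comment> \<open>Since \<eta> is constant near 0, these functions vanish there and are regular in
    spite of the factor 1/|x|. They carry the cross term of the Leibniz rule; \<open>b'\<close> is
    their derivative in direction i.\<close>
  define b where "b i x = N x * partial i \<eta> x" for i x
  define b' where "b' i x = N x * partials [i, i] \<eta> x + N' i x * partial i \<eta> x" for i x
  have b_zero: "b i x = 0" "b' i x = 0" if "norm x < d" for i x
    using \<eta>'[OF that] \<eta>''[OF that] by (simp_all add: b_def b'_def)
  have N_cont: "continuous_on (- {0}) N" "continuous_on (- {0}) (N' i)" for i
    unfolding N_def[abs_def] N'_def[abs_def] by (intro continuous_intros; simp)+
  have b_cont: "continuous_on UNIV (b i)" "continuous_on UNIV (b' i)" for i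
    unfolding b_def[abs_def] b'_def[abs_def]
    by (rule continuous_on_zero_near_0[OF _ d],
        intro continuous_intros N_cont continuous_on_subset[OF test_continuous[OF test_partials[OF \<eta>(1)]]]
          continuous_on_subset[OF test_continuous[OF test_partial[OF \<eta>(1)]]] subset_UNIV,
        use b_zero in \<open>simp add: b_def b'_def\<close>)+
  have b_deriv: "line_deriv i (b i) x (b' i x)" for i x
  proof (cases "x = 0")
    case True
    have "\<forall>\<^sub>F y in nhds x. 0 = b i y" using near[of x] d True by (auto elim!: eventually_mono simp: b_zero)
    moreover have "line_deriv i (\<lambda>x. 0) x 0" by simp
    ultimately have "line_deriv i (b i) x 0" by (rule line_deriv_transform[rotated])
    then show ?thesis using b_zero(2)[of x] d True by simp
  next
    case False
    have "line_deriv i (b i) x (N x * partial i (partial i \<eta>) x + N' i x * partial i \<eta> x)"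
      unfolding b_def[abs_def] by (intro line_deriv_mult N_deriv False smooth_line_deriv smooth_partial s\<eta>)
    then show ?thesis by (simp add: b'_def)
  qed
  have b'_supp: "bounded {x. b' i x \<noteq> 0}" for i
    by (rule bounded_subset[OF bounded_Un[THEN iffD2, OF conjI, OF test_bounded_support[OF test_partials[OF \<eta>(1), of "[i, i]"]]
        test_bounded_support[OF test_partial[OF \<eta>(1), of i]]]]) (auto simp: b'_def)
  have b'_L2: "b' i \<in> L2" for i by (rule compactly_supported_L2[OF b_cont(2) b'_supp])
  have NL2: "(\<lambda>x. N x * \<psi> x) \<in> L2" and Nint: "integrable lborel (\<lambda>x. N x * \<psi> x)"
    if "\<psi> \<in> test_functions UNIV" for \<psi>
    unfolding N_def using test_over_norm[OF that] by auto
  \<comment> \<open>Away from 0, where N is harmonic, (Delta + l^2)(N \<eta>) is 2 grad N . grad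
    \<eta> + N Delta \<eta> + l^2 N \<eta>. As the \<open>b'\<close> sum to grad N . grad \<eta> + N
    Delta \<eta>, taking them twice overshoots by N Delta \<eta>, which is subtracted.\<close>
  define F where "F x = (\<Sum>i\<in>UNIV. 2 * b' i x - N x * partials [i, i] \<eta> x) + l\<^sup>2 * (N x * \<eta> x)" for x
  have F: "F \<in> L2"
    unfolding F_def[abs_def] by (intro L2_add L2_sum L2_diff L2_scale b'_L2 NL2 test_partials \<eta>(1))
  have cutoff: "(\<integral>x. N x * \<eta> x * helmholtz l \<phi> x \<partial>lborel) = - of_real (4 * pi) * \<phi> 0 + (\<integral>x. F x * \<phi> x \<partial>lborel)"
    if \<phi>: "\<phi> \<in> test_functions UNIV" for \<phi> :: "real^3 \<Rightarrow> complex"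
  proof -
    note s\<phi> = test_smooth[OF \<phi>]
    have \<eta>\<phi>: "(\<lambda>x. \<eta> x * \<phi> x) \<in> test_functions UNIV" by (rule test_mult[OF \<eta>(1) s\<phi>])
    have dd: "partials [i, i] (\<lambda>x. \<eta> x * \<phi> x) x
        = \<eta> x * partials [i, i] \<phi> x + 2 * (partial i \<eta> x * partial i \<phi> x) + partials [i, i] \<eta> x * \<phi> x" for i x
    proof -
      have "partial i (\<lambda>x. \<eta> x * \<phi> x) = (\<lambda>x. \<eta> x * partial i \<phi> x + partial i \<eta> x * \<phi> x)"
        by (intro ext partial_eqI line_deriv_mult smooth_line_deriv s\<eta> s\<phi>)
      moreover have "partial i (\<lambda>x. \<eta> x * partial i \<phi> x + partial i \<eta> x * \<phi> x) x
         = (\<eta> x * partial i (partial i \<phi>) x + partial i \<eta> x * partial i \<phi> x)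
          + (partial i \<eta> x * partial i \<phi> x + partial i (partial i \<eta>) x * \<phi> x)"
        by (intro partial_eqI line_deriv_add line_deriv_mult smooth_line_deriv smooth_partial s\<eta> s\<phi>)
      ultimately show ?thesis by simp
    qed
    have parts: "(\<integral>x. b i x * partial i \<phi> x \<partial>lborel) = - (\<integral>x. b' i x * \<phi> x \<partial>lborel)" for i
    proof -
      have "(\<integral>x. b i x * partial i \<phi> x + b' i x * \<phi> x \<partial>lborel) = 0"
      proof (rule integral_line_deriv_zero)
        show "line_deriv i (\<lambda>x. b i x * \<phi> x) x (b i x * partial i \<phi> x + b' i x * \<phi> x)" for x
          by (intro line_deriv_mult b_deriv smooth_line_deriv s\<phi>)
        show "continuous_on UNIV (\<lambda>x. b i x * partial i \<phi> x + b' i x * \<phi> x)"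
          by (intro continuous_on_add compactly_supported_mult(2)[OF b_cont(1) test_partial[OF \<phi>]]
              compactly_supported_mult(2)[OF b_cont(2) \<phi>])
      qed (rule compactly_supported_mult[OF b_cont(1) \<phi>])+
      moreover have "integrable lborel (\<lambda>x. b i x * partial i \<phi> x)" "integrable lborel (\<lambda>x. b' i x * \<phi> x)"
        by (rule compactly_supported_mult(1)[OF b_cont(1) test_partial[OF \<phi>]] compactly_supported_mult(1)[OF b_cont(2) \<phi>])+
      ultimately show ?thesis by (simp add: eq_neg_iff_add_eq_0)
    qed
    have i1: "integrable lborel (\<lambda>x. N x * partials [i, i] (\<lambda>x. \<eta> x * \<phi> x) x)" for i
      by (rule Nint[OF test_partials[OF \<eta>\<phi>]])
    have i2: "integrable lborel (\<lambda>x. b i x * partial i \<phi> x)" for i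
      by (rule compactly_supported_mult(1)[OF b_cont(1) test_partial[OF \<phi>]])
    have i3: "integrable lborel (\<lambda>x. N x * partials [i, i] \<eta> x * \<phi> x)" for i
      using Nint[OF test_mult[OF test_partials[OF \<eta>(1)] s\<phi>]] by (simp only: mult.assoc)
    have i4: "integrable lborel (\<lambda>x. N x * \<eta> x * \<phi> x)"
      using Nint[OF \<eta>\<phi>] by (simp only: mult.assoc)
    have i5: "integrable lborel (\<lambda>x. b' i x * \<phi> x)" for i
      by (rule compactly_supported_mult(1)[OF b_cont(2) \<phi>])
    \<comment> \<open>The Leibniz rule for the Laplacian of \<eta> \<phi>, solved for \<eta> Delta
      \<phi>. The first term then yields the delta function through
      \<open>integral_laplacian_over_norm\<close>, and the cross term is integrated by
      parts.\<close>
    have "N x * \<eta> x * helmholtz l \<phi> x = N x * (\<Sum>i\<in>UNIV. partials [i, i] (\<lambda>x. \<eta> x * \<phi> x) x)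
       + (\<Sum>i\<in>UNIV. (- 2) * (b i x * partial i \<phi> x) + (- 1) * (N x * partials [i, i] \<eta> x * \<phi> x)) + l\<^sup>2 * (N x * \<eta> x * \<phi> x)" for x
      unfolding helmholtz_def dd b_def
      by (simp add: algebra_simps sum.distrib sum_distrib_left sum_subtractf sum_negf del: partials.simps(2))
    then have "(\<integral>x. N x * \<eta> x * helmholtz l \<phi> x \<partial>lborel)
      = (\<integral>x. N x * (\<Sum>i\<in>UNIV. partials [i, i] (\<lambda>x. \<eta> x * \<phi> x) x) \<partial>lborel)
       + (\<Sum>i\<in>UNIV. (- 2) * (\<integral>x. b i x * partial i \<phi> x \<partial>lborel) + (- 1) * (\<integral>x. N x * partials [i, i] \<eta> x * \<phi> x \<partial>lborel))
       + l\<^sup>2 * (\<integral>x. N x * \<eta> x * \<phi> x \<partial>lborel)"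
      using i1 i2 i3 i4
      by (simp only: sum_distrib_left Bochner_Integration.integral_add Bochner_Integration.integrable_add
          Bochner_Integration.integral_sum Bochner_Integration.integrable_sum integrable_mult_right integral_mult_right_zero)
    also have "(\<integral>x. N x * (\<Sum>i\<in>UNIV. partials [i, i] (\<lambda>x. \<eta> x * \<phi> x) x) \<partial>lborel) = - of_real (4 * pi) * \<phi> 0"
      unfolding N_def integral_laplacian_over_norm[OF \<eta>\<phi>] using \<eta>1[of 0] d by simp
    also have "(\<Sum>i\<in>UNIV. (- 2) * (\<integral>x. b i x * partial i \<phi> x \<partial>lborel) + (- 1) * (\<integral>x. N x * partials [i, i] \<eta> x * \<phi> x \<partial>lborel))
      = (\<Sum>i\<in>UNIV. 2 * (\<integral>x. b' i x * \<phi> x \<partial>lborel) + (- 1) * (\<integral>x. N x * partials [i, i] \<eta> x * \<phi> x \<partial>lborel))"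
      by (simp only: parts minus_mult_minus)
    also have "- of_real (4 * pi) * \<phi> 0 + \<dots> + l\<^sup>2 * (\<integral>x. N x * \<eta> x * \<phi> x \<partial>lborel)
      = - of_real (4 * pi) * \<phi> 0 + (\<integral>x. (\<Sum>i\<in>UNIV. 2 * (b' i x * \<phi> x) + (- 1) * (N x * partials [i, i] \<eta> x * \<phi> x)) + l\<^sup>2 * (N x * \<eta> x * \<phi> x) \<partial>lborel)"
      using i3 i4 i5
      by (simp only: add.assoc integral_linear)
    also have "(\<lambda>x. (\<Sum>i\<in>UNIV. 2 * (b' i x * \<phi> x) + (- 1) * (N x * partials [i, i] \<eta> x * \<phi> x)) + l\<^sup>2 * (N x * \<eta> x * \<phi> x))
       = (\<lambda>x. F x * \<phi> x)"
      unfolding F_def by (simp add: algebra_simps sum_distrib_left sum_distrib_right sum_subtractf del: partials.simps(2))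
    finally show ?thesis .
  qed
  define D where "D x = of_real (4 * pi) * green l x - N x * \<eta> x" for x
  have D: "D \<in> L2" unfolding D_def[abs_def] by (intro L2_diff L2_scale green_L2[OF l] NL2 \<eta>(1))
  note E = conv_L2[OF green_integrable[OF l] F]
  have weak: "(\<integral>x. D x * helmholtz l \<phi> x \<partial>lborel) = - (\<integral>x. F x * \<phi> x \<partial>lborel)" if \<phi>: "\<phi> \<in> test_functions UNIV" for \<phi>
  proof -
    note h = test_L2[OF helmholtz_test[OF \<phi>]]
    have "(\<integral>x. D x * helmholtz l \<phi> x \<partial>lborel) = (\<integral>x. of_real (4 * pi) * (green l x * helmholtz l \<phi> x) - N x * \<eta> x * helmholtz l \<phi> x \<partial>lborel)"
      by (simp add: D_def algebra_simps)
    also have "\<dots> = of_real (4 * pi) * (\<integral>x. green l x * helmholtz l \<phi> x \<partial>lborel) - (\<integral>x. N x * \<eta> x * helmholtz l \<phi> x \<partial>lborel)"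
      using L2_mult_integrable[OF green_L2[OF l] h] L2_mult_integrable[OF NL2[OF \<eta>(1)] h]
      by (subst Bochner_Integration.integral_diff) (simp_all add: integral_mult_right_zero del: of_real_mult)
    also have "\<dots> = - (\<integral>x. F x * \<phi> x \<partial>lborel)"
      unfolding green_fundamental[OF disjI1[OF l] \<phi>] cutoff[OF \<phi>] by simp
    finally show ?thesis .
  qed
  have "AE x in lborel. conv (green l) F x - D x = 0"
  proof (rule L2_zero_if_test_orthogonal[OF \<eta> L2_diff[OF E D]])
    fix \<phi> :: "real^3 \<Rightarrow> complex" assume "\<phi> \<in> test_functions (- {0})"
    then have \<phi>: "\<phi> \<in> test_functions UNIV" by (rule test_UNIV)
    show "(\<integral>x. (conv (green l) F x - D x) * \<phi> x \<partial>lborel) = 0"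
      using weak_helmholtz_imp_conv_green[OF l D F weak \<phi>] L2_mult_integrable[OF E test_L2[OF \<phi>]] L2_mult_integrable[OF D test_L2[OF \<phi>]]
      by (simp add: left_diff_distrib)
  qed
  then have ae: "AE x in lborel. conv (green l) F x = of_real (4 * pi) * green l x - \<eta> x / of_real (norm x)"
    by eventually_elim (simp add: D_def N_def)
  \<comment> \<open>The identity holds only almost everywhere, so the value at 0 is reached along a
    sequence of good nonzero points tending to 0 inside the region where \<eta> = 1; continuity of G
    * F then identifies it.\<close>
  have "\<exists>x. x \<in> ball 0 (min d (1 / real (Suc n))) \<and> x \<noteq> 0 \<and> conv (green l) F x = of_real (4 * pi) * green l x - \<eta> x / of_real (norm x)" for n
  proof -
    have "AE x in lborel. x \<noteq> 0 \<and> conv (green l) F x = of_real (4 * pi) * green l x - \<eta> x / of_real (norm x)"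
      using ae AE_lborel_singleton[of "0::real^3"] by eventually_elim auto
    moreover have "0 < min d (1 / real (Suc n))" using d by simp
    ultimately show ?thesis by (rule AE_ball_witness[where c=0]) blast
  qed
  then obtain X where X: "\<And>n. norm (X n :: real^3) < min d (1 / real (Suc n))" "\<And>n. X n \<noteq> 0"
    "\<And>n. conv (green l) F (X n) = of_real (4 * pi) * green l (X n) - \<eta> (X n) / of_real (norm (X n))"
    unfolding mem_ball dist_0_norm by metis
  have X0: "(\<lambda>n. norm (X n)) \<longlonglongrightarrow> 0"
    by (rule tendsto_sandwich[OF _ _ tendsto_const LIMSEQ_Suc[OF lim_1_over_n]])
       (use X(1) in \<open>auto intro!: always_eventually less_imp_le\<close>)
  then have "filterlim (\<lambda>n. norm (X n)) (at 0) sequentially" using X(2) by (auto simp: filterlim_at)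
  from filterlim_compose[OF green_expansion this, of l]
  have "(\<lambda>n. (exp (\<i> * l * of_real (norm (X n))) - 1) / of_real (norm (X n))) \<longlonglongrightarrow> \<i> * l" .
  also have "(\<lambda>n. (exp (\<i> * l * of_real (norm (X n))) - 1) / of_real (norm (X n))) = (\<lambda>n. conv (green l) F (X n))"
  proof
    fix n
    have "\<eta> (X n) = 1" using X(1)[of n] by (simp add: \<eta>1)
    then show "(exp (\<i> * l * of_real (norm (X n))) - 1) / of_real (norm (X n)) = conv (green l) F (X n)"
      unfolding X(3) by (simp add: green_def diff_divide_distrib)
  qed
  finally have lim: "(\<lambda>n. conv (green l) F (X n)) \<longlonglongrightarrow> \<i> * l" .
  have cont: "isCont (conv (green l) F) 0"
    using conv_green_continuous[OF l F] by (simp add: continuous_on_eq_continuous_at)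
  have "X \<longlonglongrightarrow> 0" using X0 by (simp only: tendsto_norm_zero_iff)
  from LIMSEQ_unique[OF isCont_tendsto_compose[OF cont this] lim]
  have "conv (green l) F 0 = \<i> * l" .
  with F ae show ?thesis by (rule that)
qed

section \<open>The resolvent\<close>

text \<open>The adjoint is defined by a sesquilinear pairing and the convolution calculus is
  bilinear. Test functions away from 0 are closed under conjugation, so the two formulations match;
  adding l^2 times the pairing of u with the test function to both sides replaces v by f.\<close>

lemma adjoint_L_op_iff:
  assumes u: "u \<in> L2" and v: "v \<in> L2" and f: "f \<in> L2" and fv: "AE x in lborel. f x = v x - l\<^sup>2 * u x"
  shows "(u, v) \<in> adjoint L_op \<longleftrightarrow>
    (\<forall>\<phi>\<in>test_functions (- {0}). (\<integral>x. u x * helmholtz l \<phi> x \<partial>lborel) = - (\<integral>x. f x * \<phi> x \<partial>lborel))"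
proof -
  let ?\<Delta> = "\<lambda>\<phi> x. \<Sum>i\<in>UNIV. partials [i, i] \<phi> x"
  note [measurable] = L2_measurable[OF u] L2_measurable[OF v] L2_measurable[OF f]
  have alg: "- a = b \<longleftrightarrow> a + c = - (b - c)" for a b c :: complex
    by (auto simp: complex_eq_iff)
  have inner: "L2_inner (\<lambda>x. - ?\<Delta> \<phi> x) u = L2_inner \<phi> v \<longleftrightarrow>
      (\<integral>x. u x * helmholtz l (\<lambda>x. cnj (\<phi> x)) x \<partial>lborel) = - (\<integral>x. f x * cnj (\<phi> x) \<partial>lborel)"
    if \<phi>: "\<phi> \<in> test_functions (- {0})" for \<phi>
  proof -
    note c\<phi> = test_cnj[OF \<phi>]
    note [measurable] = L2_measurable[OF test_L2[OF c\<phi>]]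
    have iv: "integrable lborel (\<lambda>x. v x * cnj (\<phi> x))" and iu: "integrable lborel (\<lambda>x. u x * cnj (\<phi> x))"
      and iD: "integrable lborel (\<lambda>x. u x * ?\<Delta> (\<lambda>x. cnj (\<phi> x)) x)"
      by (intro L2_mult_integrable u v test_L2[OF c\<phi>] L2_sum test_L2[OF test_partials[OF c\<phi>]])+
    have "cnj (L2_inner (\<lambda>x. - ?\<Delta> \<phi> x) u) = (\<integral>x. - (u x * ?\<Delta> (\<lambda>x. cnj (\<phi> x)) x) \<partial>lborel)"
      unfolding L2_inner_def Bochner_Integration.integral_cnj[symmetric] partials_cnj[OF test_smooth[OF \<phi>]]
      by (simp add: mult.commute del: partials.simps(2))
    then have 1: "cnj (L2_inner (\<lambda>x. - ?\<Delta> \<phi> x) u) = - (\<integral>x. u x * ?\<Delta> (\<lambda>x. cnj (\<phi> x)) x \<partial>lborel)"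
      by (simp only: integral_linear)
    have 2: "cnj (L2_inner \<phi> v) = (\<integral>x. v x * cnj (\<phi> x) \<partial>lborel)"
      unfolding L2_inner_def Bochner_Integration.integral_cnj[symmetric] by (simp add: mult.commute)
    have "(\<integral>x. u x * helmholtz l (\<lambda>x. cnj (\<phi> x)) x \<partial>lborel)
        = (\<integral>x. u x * ?\<Delta> (\<lambda>x. cnj (\<phi> x)) x + l\<^sup>2 * (u x * cnj (\<phi> x)) \<partial>lborel)"
      unfolding helmholtz_def by (simp add: distrib_left mult.left_commute del: partials.simps(2))
    then have 3: "(\<integral>x. u x * helmholtz l (\<lambda>x. cnj (\<phi> x)) x \<partial>lborel)
        = (\<integral>x. u x * ?\<Delta> (\<lambda>x. cnj (\<phi> x)) x \<partial>lborel) + l\<^sup>2 * (\<integral>x. u x * cnj (\<phi> x) \<partial>lborel)"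
      using iD iu by (simp only: integral_linear)
    have "(\<integral>x. f x * cnj (\<phi> x) \<partial>lborel) = (\<integral>x. v x * cnj (\<phi> x) - l\<^sup>2 * (u x * cnj (\<phi> x)) \<partial>lborel)"
    proof (rule integral_cong_AE)
      show "AE x in lborel. f x * cnj (\<phi> x) = v x * cnj (\<phi> x) - l\<^sup>2 * (u x * cnj (\<phi> x))"
        using fv by eventually_elim (erule ssubst, simp add: algebra_simps)
    qed measurable
    then have 4: "(\<integral>x. f x * cnj (\<phi> x) \<partial>lborel) = (\<integral>x. v x * cnj (\<phi> x) \<partial>lborel) - l\<^sup>2 * (\<integral>x. u x * cnj (\<phi> x) \<partial>lborel)"
      using iv iu by (simp only: integral_linear)
    have "L2_inner (\<lambda>x. - ?\<Delta> \<phi> x) u = L2_inner \<phi> v \<longleftrightarrow> cnj (L2_inner (\<lambda>x. - ?\<Delta> \<phi> x) u) = cnj (L2_inner \<phi> v)"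
      by (simp only: complex_cnj_cancel_iff)
    also have "\<dots> \<longleftrightarrow> - (\<integral>x. u x * ?\<Delta> (\<lambda>x. cnj (\<phi> x)) x \<partial>lborel) = (\<integral>x. v x * cnj (\<phi> x) \<partial>lborel)"
      unfolding 1 2 ..
    also have "\<dots> \<longleftrightarrow> (\<integral>x. u x * helmholtz l (\<lambda>x. cnj (\<phi> x)) x \<partial>lborel) = - (\<integral>x. f x * cnj (\<phi> x) \<partial>lborel)"
      unfolding 3 4 by (rule alg)
    finally show ?thesis .
  qed
  have "(u, v) \<in> adjoint L_op \<longleftrightarrow>
    (\<forall>\<phi>\<in>test_functions (- {0}). L2_inner (\<lambda>x. - ?\<Delta> \<phi> x) u = L2_inner \<phi> v)"
    unfolding adjoint_def L_op_def using u v by (auto simp del: partials.simps(2))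
  also have "\<dots> \<longleftrightarrow> (\<forall>\<phi>\<in>test_functions (- {0}).
    (\<integral>x. u x * helmholtz l (\<lambda>x. cnj (\<phi> x)) x \<partial>lborel) = - (\<integral>x. f x * cnj (\<phi> x) \<partial>lborel))"
    by (intro ball_cong refl inner)
  also have "\<dots> \<longleftrightarrow> (\<forall>\<phi>\<in>test_functions (- {0}).
    (\<integral>x. u x * helmholtz l \<phi> x \<partial>lborel) = - (\<integral>x. f x * \<phi> x \<partial>lborel))" (is "?A \<longleftrightarrow> ?B")
  proof
    assume A: ?A
    show ?B
    proof
      fix \<phi> :: "real^3 \<Rightarrow> complex" assume "\<phi> \<in> test_functions (- {0})"
      from bspec[OF A test_cnj[OF this]]
      show "(\<integral>x. u x * helmholtz l \<phi> x \<partial>lborel) = - (\<integral>x. f x * \<phi> x \<partial>lborel)" by simp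
    qed
  qed (use test_cnj in blast)
  finally show ?thesis .
qed

text \<open>By \<open>green_fundamental\<close>, G is therefore a homogeneous solution with respect
  to these test functions.\<close>

lemma test_at_0: "\<phi> \<in> test_functions (- {0}) \<Longrightarrow> \<phi> 0 = 0"
  using closure_subset[of "{x. \<phi> x \<noteq> 0}"] by (auto simp: test_functions_def)

text \<open>The equation holds for test functions that need not vanish at 0, so the regular part of
  a domain element carries no point source there.\<close>

lemma sobolev_laplacian:
  assumes \<phi>: "\<phi> \<in> sobolev 2"
  obtains g where "g \<in> L2" "\<And>\<psi>. \<psi> \<in> test_functions UNIV \<Longrightarrow>
    (\<integral>x. \<phi> x * helmholtz l \<psi> x \<partial>lborel) = (\<integral>x. g x * \<psi> x \<partial>lborel)"
proof -
  have "\<forall>i. \<exists>g\<in>L2. weak_partials [i, i] \<phi> g" using \<phi> by (auto simp: sobolev_def)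
  then obtain h where h: "\<And>i. h i \<in> L2" "\<And>i. weak_partials [i, i] \<phi> (h i)" by metis
  have \<phi>2: "\<phi> \<in> L2" using \<phi> by (simp add: sobolev_def)
  show ?thesis
  proof (rule that)
    show "(\<lambda>x. (\<Sum>i\<in>UNIV. h i x) + l\<^sup>2 * \<phi> x) \<in> L2" by (intro L2_add L2_sum L2_scale h \<phi>2)
    fix \<psi> :: "real^3 \<Rightarrow> complex" assume \<psi>: "\<psi> \<in> test_functions UNIV"
    have int: "integrable lborel (\<lambda>x. \<phi> x * partials [i, i] \<psi> x)" "integrable lborel (\<lambda>x. h i x * \<psi> x)"
      "integrable lborel (\<lambda>x. \<phi> x * \<psi> x)" for i
      by (intro L2_mult_integrable \<phi>2 h test_L2[OF test_partials[OF \<psi>]] test_L2[OF \<psi>])+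
    have w: "(\<integral>x. \<phi> x * partials [i, i] \<psi> x \<partial>lborel) = (\<integral>x. h i x * \<psi> x \<partial>lborel)" for i
      using h(2)[of i] \<psi> by (simp add: weak_partials_def)
    have "(\<integral>x. \<phi> x * helmholtz l \<psi> x \<partial>lborel) = (\<integral>x. (\<Sum>i\<in>UNIV. \<phi> x * partials [i, i] \<psi> x) + l\<^sup>2 * (\<phi> x * \<psi> x) \<partial>lborel)"
      unfolding helmholtz_def by (simp add: distrib_left sum_distrib_left mult.left_commute del: partials.simps(2))
    also have "\<dots> = (\<integral>x. (\<Sum>i\<in>UNIV. h i x * \<psi> x) + l\<^sup>2 * (\<phi> x * \<psi> x) \<partial>lborel)"
      using int by (simp only: integral_linear w)
    also have "\<dots> = (\<integral>x. ((\<Sum>i\<in>UNIV. h i x) + l\<^sup>2 * \<phi> x) * \<psi> x \<partial>lborel)"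
      by (simp add: distrib_right sum_distrib_right mult.assoc)
    finally show "(\<integral>x. \<phi> x * helmholtz l \<psi> x \<partial>lborel) = (\<integral>x. ((\<Sum>i\<in>UNIV. h i x) + l\<^sup>2 * \<phi> x) * \<psi> x \<partial>lborel)" .
  qed
qed

context
  fixes \<mu> :: real and l :: complex and \<eta> :: "real^3 \<Rightarrow> complex"
  assumes \<eta>: "\<eta> \<in> test_functions UNIV" "\<forall>\<^sub>F x in nhds 0. \<eta> x = 1"
    and l: "0 < Im l" and l\<mu>: "l \<noteq> - \<i> * of_real \<mu>"
begin

lemma denominator: "l + \<i> * of_real \<mu> \<noteq> 0"
  using l\<mu> by (simp flip: eq_neg_iff_add_eq_0)

lemma resolvent_eq:
  assumes fu: "(f, u) \<in> resolvent (L_mu \<eta> \<mu>) (l\<^sup>2)"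
  shows "AE x in lborel. u x = conv (green l) f x
    + of_real (4 * pi) * (\<i> * conv (green l) f 0 / (l + \<i> * of_real \<mu>)) * green l x"
proof -
  from fu obtain v where f: "f \<in> L2" and uv: "(u, v) \<in> L_mu \<eta> \<mu>" and fv: "AE x in lborel. f x = v x - l\<^sup>2 * u x"
    by (auto simp: resolvent_def)
  from uv have adj: "(u, v) \<in> adjoint L_op" and dom: "u \<in> L_mu_domain \<eta> \<mu>" by (auto simp: L_mu_def)
  from adj have u: "u \<in> L2" and v: "v \<in> L2" by (auto simp: adjoint_def)
  from dom obtain \<beta> \<phi> where \<phi>: "\<phi> \<in> sobolev 2" "continuous_on UNIV \<phi>" "\<phi> 0 = 0"
    and u_eq: "AE x in lborel. u x = \<eta> x * \<beta> * of_real (1 / norm x + \<mu>) + \<phi> x"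
    by (auto simp: L_mu_domain_def)
  obtain F where F: "F \<in> L2"
    and E: "AE x in lborel. conv (green l) F x = of_real (4 * pi) * green l x - \<eta> x / of_real (norm x)"
    and E0: "conv (green l) F 0 = \<i> * l"
    using green_minus_cutoff[OF l \<eta>] .
  let ?E = "conv (green l) F" and ?A = "conv (green l) f"
  have EL2: "?E \<in> L2" and AL2: "?A \<in> L2" by (intro conv_L2 green_integrable l F f)+
  have \<phi>2: "\<phi> \<in> L2" using \<phi> by (simp add: sobolev_def)
  note \<eta>2 = test_L2[OF \<eta>(1)] and h\<eta> = test_L2[OF helmholtz_test[OF \<eta>(1), of l]]
  \<comment> \<open>4 pi \<beta> G has the same singularity \<beta> / |x| as u. By
    \<open>D_eq\<close> the difference is built from \<phi>, G * F and \<eta> alone.\<close>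
  define D where "D x = u x - of_real (4 * pi) * \<beta> * green l x" for x
  have D: "D \<in> L2" unfolding D_def[abs_def] by (intro L2_diff L2_scale u green_L2 l)
  have D_eq: "AE x in lborel. D x = \<phi> x - \<beta> * ?E x + \<beta> * \<mu> * \<eta> x"
    using u_eq E by eventually_elim (simp add: D_def, simp add: algebra_simps)
  obtain g where g: "g \<in> L2" "\<And>\<psi>. \<psi> \<in> test_functions UNIV \<Longrightarrow>
    (\<integral>x. \<phi> x * helmholtz l \<psi> x \<partial>lborel) = (\<integral>x. g x * \<psi> x \<partial>lborel)"
    using sobolev_laplacian[OF \<phi>(1)] by metis
  \<comment> \<open>Minus (Delta + l^2) of the right-hand side of \<open>D_eq\<close>, term by term;
    G * F contributes through (Delta + l^2)(G * F) = - F.\<close>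
  define h where "h x = - g x - \<beta> * F x - \<beta> * \<mu> * helmholtz l \<eta> x" for x
  have h: "h \<in> L2" unfolding h_def[abs_def] by (intro L2_diff L2_uminus L2_scale g F h\<eta>)
  have weak_h: "(\<integral>x. D x * helmholtz l \<psi> x \<partial>lborel) = - (\<integral>x. h x * \<psi> x \<partial>lborel)"
    if \<psi>: "\<psi> \<in> test_functions UNIV" for \<psi>
  proof -
    note \<psi>2 = test_L2[OF \<psi>] and h\<psi> = test_L2[OF helmholtz_test[OF \<psi>]]
    note [measurable] = L2_measurable[OF D] L2_measurable[OF h\<psi>] L2_measurable[OF \<phi>2] L2_measurable[OF EL2] L2_measurable[OF \<eta>2]
    have \<eta>_eq: "(\<lambda>x. - conv (green l) (helmholtz l \<eta>) x) = \<eta>" by (simp add: conv_green_helmholtz[OF l \<eta>(1)])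
    have \<eta>w: "(\<integral>x. \<eta> x * helmholtz l \<psi> x \<partial>lborel) = (\<integral>x. helmholtz l \<eta> x * \<psi> x \<partial>lborel)"
      using weak_helmholtz_conv_green[OF l h\<eta> \<psi>] by (simp add: conv_green_helmholtz[OF l \<eta>(1)])
    have "(\<integral>x. D x * helmholtz l \<psi> x \<partial>lborel)
      = (\<integral>x. \<phi> x * helmholtz l \<psi> x - \<beta> * (?E x * helmholtz l \<psi> x) + \<beta> * \<mu> * (\<eta> x * helmholtz l \<psi> x) \<partial>lborel)"
    proof (rule integral_cong_AE)
      show "AE x in lborel. D x * helmholtz l \<psi> x = \<phi> x * helmholtz l \<psi> x - \<beta> * (?E x * helmholtz l \<psi> x) + \<beta> * \<mu> * (\<eta> x * helmholtz l \<psi> x)"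
        using D_eq by eventually_elim (erule ssubst, simp add: algebra_simps)
    qed measurable
    also have "\<dots> = (\<integral>x. g x * \<psi> x \<partial>lborel) - \<beta> * (- (\<integral>x. F x * \<psi> x \<partial>lborel)) + \<beta> * \<mu> * (\<integral>x. helmholtz l \<eta> x * \<psi> x \<partial>lborel)"
      using L2_mult_integrable[OF \<phi>2 h\<psi>] L2_mult_integrable[OF EL2 h\<psi>] L2_mult_integrable[OF \<eta>2 h\<psi>]
      by (simp only: integral_linear
          g(2)[OF \<psi>] weak_helmholtz_conv_green[OF l F \<psi>] \<eta>w)
    also have "\<dots> = - (- (\<integral>x. g x * \<psi> x \<partial>lborel) - \<beta> * (\<integral>x. F x * \<psi> x \<partial>lborel) - \<beta> * \<mu> * (\<integral>x. helmholtz l \<eta> x * \<psi> x \<partial>lborel))"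
      by simp
    also have "- (\<integral>x. g x * \<psi> x \<partial>lborel) - \<beta> * (\<integral>x. F x * \<psi> x \<partial>lborel) - \<beta> * \<mu> * (\<integral>x. helmholtz l \<eta> x * \<psi> x \<partial>lborel)
       = (\<integral>x. - (g x * \<psi> x) - \<beta> * (F x * \<psi> x) - \<beta> * \<mu> * (helmholtz l \<eta> x * \<psi> x) \<partial>lborel)"
      using L2_mult_integrable[OF g(1) \<psi>2] L2_mult_integrable[OF F \<psi>2] L2_mult_integrable[OF h\<eta> \<psi>2]
      by (simp only: integral_linear)
    also have "(\<lambda>x. - (g x * \<psi> x) - \<beta> * (F x * \<psi> x) - \<beta> * \<mu> * (helmholtz l \<eta> x * \<psi> x)) = (\<lambda>x. h x * \<psi> x)"
      by (simp add: h_def algebra_simps)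
    finally show ?thesis .
  qed
  have weak_f: "(\<integral>x. D x * helmholtz l \<psi> x \<partial>lborel) = - (\<integral>x. f x * \<psi> x \<partial>lborel)"
    if \<psi>: "\<psi> \<in> test_functions (- {0})" for \<psi>
  proof -
    note h\<psi> = test_L2[OF helmholtz_test[OF \<psi>]]
    have "(\<integral>x. D x * helmholtz l \<psi> x \<partial>lborel)
      = (\<integral>x. u x * helmholtz l \<psi> x - of_real (4 * pi) * \<beta> * (green l x * helmholtz l \<psi> x) \<partial>lborel)"
      by (simp add: D_def algebra_simps)
    also have "\<dots> = (\<integral>x. u x * helmholtz l \<psi> x \<partial>lborel) - of_real (4 * pi) * \<beta> * (\<integral>x. green l x * helmholtz l \<psi> x \<partial>lborel)"
      using L2_mult_integrable[OF u h\<psi>] L2_mult_integrable[OF green_L2[OF l] h\<psi>]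
      by (simp only: integral_linear)
    also have "\<dots> = - (\<integral>x. f x * \<psi> x \<partial>lborel)"
      using adj \<psi> unfolding adjoint_L_op_iff[OF u v f fv] green_fundamental[OF disjI1[OF l] test_UNIV[OF \<psi>]]
      by (simp add: test_at_0)
    finally show ?thesis .
  qed
  \<comment> \<open>Away from 0 both h and f are sources of D, so they agree almost everywhere. This
    extends the equation with source f to test functions that do not vanish at 0.\<close>
  have hf: "AE x in lborel. h x - f x = 0"
  proof (rule L2_zero_if_test_orthogonal[OF \<eta> L2_diff[OF h f]])
    fix \<psi> :: "real^3 \<Rightarrow> complex" assume \<psi>: "\<psi> \<in> test_functions (- {0})"
    show "(\<integral>x. (h x - f x) * \<psi> x \<partial>lborel) = 0"
      using weak_h[OF test_UNIV[OF \<psi>]] weak_f[OF \<psi>] L2_mult_integrable[OF h test_L2[OF \<psi>]] L2_mult_integrable[OF f test_L2[OF \<psi>]]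
      by (simp add: left_diff_distrib)
  qed
  have weak: "(\<integral>x. D x * helmholtz l \<psi> x \<partial>lborel) = - (\<integral>x. f x * \<psi> x \<partial>lborel)"
    if \<psi>: "\<psi> \<in> test_functions UNIV" for \<psi>
  proof -
    note [measurable] = L2_measurable[OF h] L2_measurable[OF f] L2_measurable[OF test_L2[OF \<psi>]]
    have "(\<integral>x. h x * \<psi> x \<partial>lborel) = (\<integral>x. f x * \<psi> x \<partial>lborel)"
      by (intro integral_cong_AE) (use hf in \<open>auto elim!: eventually_mono\<close>)
    then show ?thesis by (simp add: weak_h[OF \<psi>])
  qed
  have "AE x in lborel. ?A x - D x = 0"
  proof (rule L2_zero_if_test_orthogonal[OF \<eta> L2_diff[OF AL2 D]])
    fix \<psi> :: "real^3 \<Rightarrow> complex" assume "\<psi> \<in> test_functions (- {0})"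
    then have \<psi>: "\<psi> \<in> test_functions UNIV" by (rule test_UNIV)
    show "(\<integral>x. (?A x - D x) * \<psi> x \<partial>lborel) = 0"
      using weak_helmholtz_imp_conv_green[OF l D f weak \<psi>] L2_mult_integrable[OF AL2 test_L2[OF \<psi>]] L2_mult_integrable[OF D test_L2[OF \<psi>]]
      by (simp add: left_diff_distrib)
  qed
  then have AD: "AE x in lborel. D x = ?A x" by eventually_elim simp
  \<comment> \<open>Both sides are continuous, so the equality holds at 0 too, where \<phi>(0) = 0,
    (G * F)(0) = i l and \<eta>(0) = 1 leave a linear equation for \<beta>.\<close>
  have "\<phi> = (\<lambda>x. ?A x + \<beta> * ?E x - \<beta> * \<mu> * \<eta> x)"
  proof (rule continuous_AE_eq[OF \<phi>(2)])
    show "continuous_on UNIV (\<lambda>x. ?A x + \<beta> * ?E x - \<beta> * \<mu> * \<eta> x)"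
      by (intro continuous_intros conv_green_continuous l f F test_continuous[OF \<eta>(1)])
    show "AE x in lborel. \<phi> x = ?A x + \<beta> * ?E x - \<beta> * \<mu> * \<eta> x"
      using AD D_eq by eventually_elim (simp add: algebra_simps)
  qed
  from fun_cong[OF this, of 0] have "0 = ?A 0 + \<beta> * (\<i> * l) - \<beta> * \<mu>"
    using \<phi>(3) E0 eventually_nhds_x_imp_x[OF \<eta>(2)] by simp
  then have "\<beta> * (l + \<i> * of_real \<mu>) = \<i> * ?A 0"
    by (simp add: complex_eq_iff algebra_simps)
  then have "\<beta> = \<i> * ?A 0 / (l + \<i> * of_real \<mu>)" using denominator by (simp add: eq_divide_eq)
  then show ?thesis using AD by (auto elim!: eventually_mono simp: D_def algebra_simps)
qed

text \<open>The coefficient \<beta> is the one forced by \<open>resolvent_eq\<close>. A multiple of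
  G is invisible to the adjoint, so the substance is membership in the domain.\<close>

lemma resolvent_exists:
  assumes f: "f \<in> L2"
  shows "\<exists>u. (f, u) \<in> resolvent (L_mu \<eta> \<mu>) (l\<^sup>2)"
proof -
  obtain F where F: "F \<in> L2"
    and E: "AE x in lborel. conv (green l) F x = of_real (4 * pi) * green l x - \<eta> x / of_real (norm x)"
    and E0: "conv (green l) F 0 = \<i> * l"
    using green_minus_cutoff[OF l \<eta>] .
  let ?E = "conv (green l) F" and ?A = "conv (green l) f"
  have AL2: "?A \<in> L2" by (intro conv_L2 green_integrable l f)
  note h\<eta> = test_L2[OF helmholtz_test[OF \<eta>(1), of l]]
  define \<beta> where "\<beta> = \<i> * ?A 0 / (l + \<i> * of_real \<mu>)"
  define u where "u x = ?A x + of_real (4 * pi) * \<beta> * green l x" for x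
  have u: "u \<in> L2" unfolding u_def[abs_def] by (intro L2_add L2_scale AL2 green_L2 l)
  define v where "v x = f x + l\<^sup>2 * u x" for x
  have v: "v \<in> L2" unfolding v_def[abs_def] by (intro L2_add L2_scale f u)
  have fv: "AE x in lborel. f x = v x - l\<^sup>2 * u x" by (simp add: v_def)
  have "(u, v) \<in> adjoint L_op"
    unfolding adjoint_L_op_iff[OF u v f fv]
  proof
    fix \<psi> :: "real^3 \<Rightarrow> complex" assume \<psi>: "\<psi> \<in> test_functions (- {0})"
    note h\<psi> = test_L2[OF helmholtz_test[OF \<psi>]]
    have "(\<integral>x. u x * helmholtz l \<psi> x \<partial>lborel)
      = (\<integral>x. ?A x * helmholtz l \<psi> x + of_real (4 * pi) * \<beta> * (green l x * helmholtz l \<psi> x) \<partial>lborel)"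
      by (simp add: u_def algebra_simps)
    also have "\<dots> = (\<integral>x. ?A x * helmholtz l \<psi> x \<partial>lborel) + of_real (4 * pi) * \<beta> * (\<integral>x. green l x * helmholtz l \<psi> x \<partial>lborel)"
      using L2_mult_integrable[OF AL2 h\<psi>] L2_mult_integrable[OF green_L2[OF l] h\<psi>]
      by (simp only: integral_linear)
    finally show "(\<integral>x. u x * helmholtz l \<psi> x \<partial>lborel) = - (\<integral>x. f x * \<psi> x \<partial>lborel)"
      unfolding green_fundamental[OF disjI1[OF l] test_UNIV[OF \<psi>]] weak_helmholtz_conv_green[OF l f test_UNIV[OF \<psi>]]
      by (simp add: test_at_0[OF \<psi>])
  qed
  moreover have "u \<in> L_mu_domain \<eta> \<mu>"
  proof -
    \<comment> \<open>Chosen so that G * h is the entire regular part of u; the \<eta>-term enters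
      through \<eta> = - G * (Delta + l^2) \<eta>. Being a single convolution, the regular part is
      continuous and in W^{2,2} at once, and the choice of \<beta> makes it vanish at 0.\<close>
    define h where "h x = f x + (\<beta> * F x + \<beta> * \<mu> * helmholtz l \<eta> x)" for x
    have h: "h \<in> L2" unfolding h_def[abs_def] by (intro L2_add L2_scale f F h\<eta>)
    have conv_h: "conv (green l) h x = ?A x + \<beta> * ?E x - \<beta> * \<mu> * \<eta> x" for x
      unfolding h_def[abs_def] conv_add[OF green_L2[OF l] f L2_add[OF L2_scale[OF F] L2_scale[OF h\<eta>]]]
        conv_add[OF green_L2[OF l] L2_scale[OF F] L2_scale[OF h\<eta>]] conv_scale conv_green_helmholtz[OF l \<eta>(1)]
      by simp
    have "conv (green l) h 0 = ?A 0 + \<beta> * (\<i> * l) - \<beta> * \<mu>"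
      using E0 eventually_nhds_x_imp_x[OF \<eta>(2)] by (simp add: conv_h)
    also have "\<dots> = ?A 0 + \<i> * (\<beta> * (l + \<i> * of_real \<mu>))" by (simp add: algebra_simps)
    also have "\<beta> * (l + \<i> * of_real \<mu>) = \<i> * ?A 0" using denominator by (simp add: \<beta>_def)
    finally have "conv (green l) h 0 = 0" by simp
    moreover have "AE x in lborel. u x = \<eta> x * \<beta> * of_real (1 / norm x + \<mu>) + conv (green l) h x"
      using E by eventually_elim (simp add: u_def conv_h, simp add: algebra_simps)
    ultimately show ?thesis
      using u conv_green_sobolev[OF l h] conv_green_continuous[OF l h] unfolding L_mu_domain_def by blast
  qed
  ultimately show ?thesis using f fv by (auto simp: resolvent_def L_mu_def)
qed

text \<open>Young's inequality for the free part. The correction is (G * f)(0) times a fixed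
  multiple of G, and G in L2 bounds both the functional and the function, whence the squared
  norm.\<close>

lemma resolvent_bound:
  assumes fu: "(f, u) \<in> resolvent (L_mu \<eta> \<mu>) (l\<^sup>2)"
  shows "L2_norm u \<le> ((\<integral>x. cmod (green l x) \<partial>lborel) + 4 * pi / cmod (l + \<i> * of_real \<mu>) * (L2_norm (green l))\<^sup>2) * L2_norm f"
proof -
  have f: "f \<in> L2" using fu by (simp add: resolvent_def)
  have u: "u \<in> L2" using fu by (auto simp: resolvent_def L_mu_def adjoint_def)
  note G = green_L2[OF l]
  define c where "c = of_real (4 * pi) * (\<i> * conv (green l) f 0 / (l + \<i> * of_real \<mu>))"
  have A: "conv (green l) f \<in> L2" by (rule conv_L2[OF green_integrable[OF l] f])
  have "L2_norm u = L2_norm (\<lambda>x. conv (green l) f x + c * green l x)"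
    using resolvent_eq[OF fu] u L2_add[OF A L2_scale[OF G, of c]]
    by (intro L2_norm_cong_AE) (auto simp: c_def L2_measurable)
  also have "\<dots> \<le> L2_norm (conv (green l) f) + L2_norm (\<lambda>x. c * green l x)"
    by (intro L2_norm_triangle A L2_scale G)
  also have "\<dots> \<le> (\<integral>x. cmod (green l x) \<partial>lborel) * L2_norm f + (4 * pi / cmod (l + \<i> * of_real \<mu>) * (L2_norm (green l) * L2_norm f)) * L2_norm (green l)"
  proof (intro add_mono conv_L2_norm[OF green_integrable[OF l] f])
    have "cmod c = 4 * pi / cmod (l + \<i> * of_real \<mu>) * cmod (conv (green l) f 0)"
      by (simp add: c_def norm_mult norm_divide)
    also have "\<dots> \<le> 4 * pi / cmod (l + \<i> * of_real \<mu>) * (L2_norm (green l) * L2_norm f)"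
      by (intro mult_left_mono conv_bound G f) auto
    finally show "L2_norm (\<lambda>x. c * green l x) \<le> (4 * pi / cmod (l + \<i> * of_real \<mu>) * (L2_norm (green l) * L2_norm f)) * L2_norm (green l)"
      unfolding L2_norm_scale by (intro mult_right_mono) auto
  qed
  finally show ?thesis by (simp add: algebra_simps power2_eq_square)
qed

text \<open>The exponential of |x| + |y| factors, so the second summand of the kernel is 4 pi i / (l
  + i \<mu>) G(x) G(y). Evenness of G turns the integral of G(y) f(y) into (G * f)(0). The
  identities hold for every x, including 0, since both sides follow the same convention on division
  by zero.\<close>

lemma kernel_integral:
  assumes f: "f \<in> L2"
  defines "K \<equiv> \<lambda>x y. exp (\<i> * l * of_real (norm (x - y))) / of_real (4 * pi * norm (x - y))
         + \<i> * exp (\<i> * l * of_real (norm x + norm y))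
             / (of_real (4 * pi * norm x * norm y) * (l + \<i> * of_real \<mu>))"
  shows "integrable lborel (\<lambda>y. K x y * f y)"
    and "(\<integral>y. K x y * f y \<partial>lborel) = conv (green l) f x
      + of_real (4 * pi) * (\<i> * conv (green l) f 0 / (l + \<i> * of_real \<mu>)) * green l x"
proof -
  note G = green_L2[OF l]
  note [measurable] = L2_measurable[OF f]
  define c where "c = of_real (4 * pi) * (\<i> / (l + \<i> * of_real \<mu>)) * green l x"
  have K: "(\<lambda>y. K x y * f y) = (\<lambda>y. green l (x - y) * f y + c * (green l y * f y))"
    unfolding K_def c_def green_def by (auto simp: distrib_left exp_add field_simps)
  have int: "integrable lborel (\<lambda>y. green l (x - y) * f y)" "integrable lborel (\<lambda>y. green l y * f y)"
    by (intro L2_mult_integrable L2_reflect G f)+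
  show "integrable lborel (\<lambda>y. K x y * f y)"
    unfolding K by (intro Bochner_Integration.integrable_add integrable_mult_right int)
  have "(\<integral>y. K x y * f y \<partial>lborel) = (\<integral>y. green l (x - y) * f y \<partial>lborel) + c * (\<integral>y. green l y * f y \<partial>lborel)"
    unfolding K using int by (simp only: integral_linear)
  also have "\<dots> = conv (green l) f x + c * conv (green l) f 0"
    by (simp add: conv_commute green_even)
  finally show "(\<integral>y. K x y * f y \<partial>lborel) = conv (green l) f x
      + of_real (4 * pi) * (\<i> * conv (green l) f 0 / (l + \<i> * of_real \<mu>)) * green l x"
    by (simp add: c_def mult_ac)
qed

end

theorem mainTheorem5:
  fixes \<mu> :: real and l :: complex and \<eta> :: "real^3 \<Rightarrow> complex"
  assumes "\<eta> \<in> test_functions UNIV"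
    and "\<forall>\<^sub>F x in nhds 0. \<eta> x = 1"
    and "Im l > 0"
    and "l \<noteq> - \<i> * of_real \<mu>"
  shows "is_resolvent_kernel (L_mu \<eta> \<mu>) (l\<^sup>2)
    (\<lambda>x y. exp (\<i> * l * of_real (norm (x - y))) / of_real (4 * pi * norm (x - y))
         + \<i> * exp (\<i> * l * of_real (norm x + norm y))
             / (of_real (4 * pi * norm x * norm y) * (l + \<i> * of_real \<mu>)))"
proof -
  note eq = resolvent_eq[OF assms] and bound = resolvent_bound[OF assms] and kernel = kernel_integral[OF assms]
  have "l\<^sup>2 \<in> resolvent_set (L_mu \<eta> \<mu>)"
    unfolding resolvent_set_def mem_Collect_eq
  proof (intro conjI allI ballI impI)
    fix f :: "real^3 \<Rightarrow> complex" assume "f \<in> L2"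
    then show "\<exists>u. (f, u) \<in> resolvent (L_mu \<eta> \<mu>) (l\<^sup>2)" by (rule resolvent_exists[OF assms])
  next
    fix f u u' assume "(f, u) \<in> resolvent (L_mu \<eta> \<mu>) (l\<^sup>2)" "(f, u') \<in> resolvent (L_mu \<eta> \<mu>) (l\<^sup>2)"
    from eq[OF this(1)] eq[OF this(2)] show "AE x in lborel. u x = u' x" by eventually_elim simp
  next
    show "\<exists>C. \<forall>(f, u)\<in>resolvent (L_mu \<eta> \<mu>) (l\<^sup>2). L2_norm u \<le> C * L2_norm f"
      using bound by blast
  qed
  moreover have "AE x in lborel. integrable lborel (\<lambda>y. (exp (\<i> * l * of_real (norm (x - y))) / of_real (4 * pi * norm (x - y))
         + \<i> * exp (\<i> * l * of_real (norm x + norm y))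
             / (of_real (4 * pi * norm x * norm y) * (l + \<i> * of_real \<mu>))) * f y)
      \<and> u x = (\<integral>y. (exp (\<i> * l * of_real (norm (x - y))) / of_real (4 * pi * norm (x - y))
         + \<i> * exp (\<i> * l * of_real (norm x + norm y))
             / (of_real (4 * pi * norm x * norm y) * (l + \<i> * of_real \<mu>))) * f y \<partial>lborel)"
    if fu: "(f, u) \<in> resolvent (L_mu \<eta> \<mu>) (l\<^sup>2)" for f u
  proof -
    have f: "f \<in> L2" using fu by (simp add: resolvent_def)
    show ?thesis
      using eq[OF fu] by eventually_elim (simp only: kernel[OF f] simp_thms)
  qed
  ultimately show ?thesis unfolding is_resolvent_kernel_def by blast
qed

end
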